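(* Let $(X,d)$ be a complete separable metric space, let $\gamma:\mathbb{R}_+\to\mathbb{R}_+$ be a lower-semicontinuous function with $\gamma(0)=0$ and $\gamma(u+v)\le C(\gamma(u)+\gamma(v))$ for all $u,v\ge0$ and some constant $C$, and let $c:X\times\mathcal{P}_\gamma(X)\to[0,\infty)$ be a measurable cost function such that $c(x,\delta_x)=0$ for all $x\in X$ and for which duality holds (see context). For $\mu\in\mathcal{P}_\gamma(X)$ and $a_1,a_2>0$, the following are equivalent: (i) $\mu$ satisfies $\mathbf{T}_c(a_1,a_2)$, i.e. $\mathcal{T}_c(\nu_1|\nu_2)\le a_1H(\nu_1|\mu)+a_2H(\nu_2|\mu)$ for all $\nu_1,\nu_2\in\mathcal{P}_\gamma(X)$; (ii) there exists a constant $K$ such that for all integers $n\ge1$ and all Borel sets $A\subset X^n$, $$\mu^n(X^n\setminus A^n_t)^{a_2}\,\mu^n(A)^{a_1}\le Ke^{-t},\qquad\forall t\ge0;$$ (iii) there exists a constant $K$ such that for all integers $n\ge1$ and all non-negative $\varphi\in\Phi_\gamma(X^n)$, $$\mu^n(R_{c^n}\varphi>u)^{a_2}\,\mu^n(\varphi\le v)^{a_1}\le Ke^{-u+v},\qquad\forall u,v\in\mathbb{R}.$$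
   Context: $\mathcal{P}_\gamma(X)$ is the set of Borel probability measures $\mu$ on $X$ with $\int\gamma(d(x,x_o))\,\mu(dx)<\infty$ for some (hence all) $x_o$; it carries the $\sigma$-field generated by $\nu\mapsto\nu(A)$, $A$ Borel. $\Phi_\gamma(X)$ is the set of continuous $\varphi:X\to\mathbb{R}$ with $|\varphi(x)|\le a+b\,\gamma(d(x,x_o))$ for some $a,b\ge0$; $\Phi_{\gamma,b}(X)$ is the subset of those bounded from below. The same definitions are used on $X^n$, equipped with the $\ell_1$ product metric. $H(\nu|\mu)=\int\log\frac{d\nu}{d\mu}\,d\nu$ if $\nu\ll\mu$, and $+\infty$ otherwise. $\mathcal{T}_c(\nu|\mu)=\inf_{\pi\in\Pi(\mu,\nu)}\int c(x,p_x)\,\mu(dx)$, where $\Pi(\mu,\nu)$ is the set of couplings with first marginal $\mu$ and second marginal $\nu$, and $\pi(dxdy)=\mu(dx)p_x(dy)$. "Duality holds for $c$" means: for all $\mu,\nu\in\mathcal{P}_\gamma(X)$, $$\mathcal{T}_c(\nu|\mu)=\sup_{\varphi\in\Phi_{\gamma,b}(X)}\left\{\int R_c\varphi\,d\mu_*-\int\varphi\,d\nu\right\},\qquad R_c\varphi(x)=\inf_{p\in\mathcal{P}_\gamma(X)}\left\{\int\varphi\,dp+c(x,p)\right\},$$ where $\int g\,d\mu_*=\sup\{\int f\,d\mu: f\le g,\ f\text{ bounded measurable}\}$ (the ordinary integral when $g$ is measurable). For $n\ge1$, $c^n(x,p)=\sum_{i=1}^nc(x_i,p_i)$ for $x\in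 X^n$ and $p\in\mathcal{P}_\gamma(X^n)$, where $p_i$ is the $i$-th marginal of $p$; $R_{c^n}\varphi(x)=\inf_{p\in\mathcal{P}_\gamma(X^n)}\{\int\varphi\,dp+c^n(x,p)\}$; for Borel $A\subset X^n$, $c^n_A(x)=\inf\{c^n(x,p):p\in\mathcal{P}_\gamma(X^n),\,p(A)=1\}$ and $A^n_t=\{x\in X^n:c^n_A(x)\le t\}$. $\mu^n$ is the $n$-fold product measure.
   Formalization: It is additionally assumed that finiteness of ∫γ(d(x,x_o))dp does not depend on x_o, and that marginals of measures in P_γ(X^n) lie in P_γ(X); both are needed for the definitions to make sense and hold automatically for nondecreasing γ. *)

theory Defs
  imports "HOL-Probability.Probability"
begin

definition lower_semicontinuous_on :: "'a::topological_space set \<Rightarrow> ('a \<Rightarrow> real) \<Rightarrow> bool" where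
  "lower_semicontinuous_on S f \<longleftrightarrow>
     (\<forall>u\<in>S. \<forall>r<f u. eventually (\<lambda>v. r < f v) (at u within S))"

text \<open>
  The definitions up to \<open>inf_conv\<close> take a measurable space \<open>S\<close> together with a metric \<open>d\<close> on
  its carrier. They are used for \<open>X\<close> itself (\<open>S = borel\<close>, \<open>d = dist\<close>) and for \<open>X\<^sup>n\<close>
  (\<open>S = Xn n\<close>, \<open>d = l1_dist n\<close>).
\<close>

definition P_gamma :: "(real \<Rightarrow> real) \<Rightarrow> 'b measure \<Rightarrow> ('b \<Rightarrow> 'b \<Rightarrow> real) \<Rightarrow> 'b measure set" where
  "P_gamma \<gamma> S d =
     {p \<in> space (prob_algebra S). \<exists>xo\<in>space S. (\<integral>\<^sup>+ x. ennreal (\<gamma> (d x xo)) \<partial>p) < \<infinity>}"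

text \<open>\<open>prob_algebra S\<close> carries the sigma-field generated by the evaluations at measurable sets.\<close>

definition P_gamma_algebra ::
  "(real \<Rightarrow> real) \<Rightarrow> 'b measure \<Rightarrow> ('b \<Rightarrow> 'b \<Rightarrow> real) \<Rightarrow> 'b measure measure" where
  "P_gamma_algebra \<gamma> S d = restrict_space (prob_algebra S) (P_gamma \<gamma> S d)"

definition Phi_gamma :: "(real \<Rightarrow> real) \<Rightarrow> 'b measure \<Rightarrow> ('b \<Rightarrow> 'b \<Rightarrow> real) \<Rightarrow> ('b \<Rightarrow> real) set" where
  "Phi_gamma \<gamma> S d =
     {\<phi>. continuous_map (Metric_space.mtopology (space S) d) euclideanreal \<phi> \<and>
         (\<exists>xo\<in>space S. \<exists>a\<ge>0. \<exists>b\<ge>0. \<forall>x\<in>space S. \<bar>\<phi> x\<bar> \<le> a + b * \<gamma> (d x xo))}"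

definition Phi_gamma_b :: "(real \<Rightarrow> real) \<Rightarrow> 'b measure \<Rightarrow> ('b \<Rightarrow> 'b \<Rightarrow> real) \<Rightarrow> ('b \<Rightarrow> real) set" where
  "Phi_gamma_b \<gamma> S d = {\<phi> \<in> Phi_gamma \<gamma> S d. bdd_below (\<phi> ` space S)}"

definition inf_conv :: "'b measure set \<Rightarrow> ('b \<Rightarrow> 'b measure \<Rightarrow> real) \<Rightarrow> ('b \<Rightarrow> real) \<Rightarrow> 'b \<Rightarrow> ereal" where
  "inf_conv P c \<phi> x = (INF p\<in>P. ereal ((\<integral>y. \<phi> y \<partial>p) + c x p))"

text \<open>The integral against \<open>\<mu>\<^sub>*\<close> and the corresponding inner measure of a set.\<close>

definition lower_integral :: "'b measure \<Rightarrow> ('b \<Rightarrow> ereal) \<Rightarrow> ereal" where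
  "lower_integral \<mu> g =
     (SUP f\<in>{f \<in> borel_measurable \<mu>. bounded (f ` space \<mu>) \<and> (\<forall>x\<in>space \<mu>. ereal (f x) \<le> g x)}.
        ereal (\<integral>x. f x \<partial>\<mu>))"

text \<open>
  The inner measure agrees with \<open>measure \<mu>\<close> on measurable sets and with the completion of \<open>\<mu>\<close> on
  universally measurable ones, whereas \<open>measure \<mu> A = 0\<close> by convention if \<open>A \<notin> sets \<mu>\<close>.
\<close>

definition inner_prob :: "'b measure \<Rightarrow> 'b set \<Rightarrow> real" where
  "inner_prob \<mu> A = (SUP B\<in>{B \<in> sets \<mu>. B \<subseteq> A}. measure \<mu> B)"

text \<open>
  \<open>KL_divergence\<close> is a Bochner integral and is \<open>0\<close> if the integrand is not integrable. The negative
  part of \<open>ln (d\<nu>/d\<mu>)\<close> always has finite \<open>\<nu>\<close>-integral, so in that case the integral is \<open>\<infinity>\<close>.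
\<close>

definition rel_entropy :: "'b measure \<Rightarrow> 'b measure \<Rightarrow> ereal" where
  "rel_entropy \<nu> \<mu> =
     (if absolutely_continuous \<mu> \<nu> \<and> integrable \<nu> (entropy_density (exp 1) \<mu> \<nu>)
      then ereal (KL_divergence (exp 1) \<mu> \<nu>) else \<infinity>)"

definition couplings ::
  "'a::topological_space measure \<Rightarrow> 'a measure \<Rightarrow> ('a \<times> 'a) measure set" where
  "couplings \<mu> \<nu> =
     {\<pi> \<in> space (prob_algebra borel). distr \<pi> borel fst = \<mu> \<and> distr \<pi> borel snd = \<nu>}"

text \<open>
  The kernels \<open>p\<close> with \<open>\<pi>(dx dy) = \<mu>(dx) p\<^sub>x(dy)\<close>. If the second marginal of \<open>\<pi>\<close> is in \<open>P_gamma\<close>, then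
  \<open>p\<^sub>x\<close> is in \<open>P_gamma\<close> for almost every \<open>x\<close>; we take versions for which this holds everywhere, so
  that \<open>c x (p x)\<close> is meaningful.
\<close>

definition disintegrations ::
  "(real \<Rightarrow> real) \<Rightarrow> 'a::metric_space measure \<Rightarrow> ('a \<times> 'a) measure \<Rightarrow> ('a \<Rightarrow> 'a measure) set" where
  "disintegrations \<gamma> \<mu> \<pi> =
     {p \<in> borel \<rightarrow>\<^sub>M P_gamma_algebra \<gamma> borel dist.
        \<forall>A\<in>sets borel. \<forall>B\<in>sets borel. emeasure \<pi> (A \<times> B) = (\<integral>\<^sup>+x\<in>A. emeasure (p x) B \<partial>\<mu>)}"

definition transport_cost ::
  "(real \<Rightarrow> real) \<Rightarrow> ('a \<Rightarrow> 'a measure \<Rightarrow> real) \<Rightarrow> 'a::metric_space measure \<Rightarrow> 'a measure \<Rightarrow> ereal" where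
  "transport_cost \<gamma> c \<nu> \<mu> =
     (INF \<pi>\<in>couplings \<mu> \<nu>. INF p\<in>disintegrations \<gamma> \<mu> \<pi>.
        enn2ereal (\<integral>\<^sup>+x. ennreal (c x (p x)) \<partial>\<mu>))"

definition duality_holds ::
  "(real \<Rightarrow> real) \<Rightarrow> ('a::metric_space \<Rightarrow> 'a measure \<Rightarrow> real) \<Rightarrow> bool" where
  "duality_holds \<gamma> c \<longleftrightarrow>
     (\<forall>\<mu>\<in>P_gamma \<gamma> borel dist. \<forall>\<nu>\<in>P_gamma \<gamma> borel dist.
        transport_cost \<gamma> c \<nu> \<mu> =
          (SUP \<phi>\<in>Phi_gamma_b \<gamma> borel dist.
             lower_integral \<mu> (inf_conv (P_gamma \<gamma> borel dist) c \<phi>) - ereal (\<integral>x. \<phi> x \<partial>\<nu>)))"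

definition T_inequality ::
  "(real \<Rightarrow> real) \<Rightarrow> ('a::metric_space \<Rightarrow> 'a measure \<Rightarrow> real) \<Rightarrow> real \<Rightarrow> real \<Rightarrow> 'a measure \<Rightarrow> bool" where
  "T_inequality \<gamma> c a1 a2 \<mu> \<longleftrightarrow>
     (\<forall>\<nu>1\<in>P_gamma \<gamma> borel dist. \<forall>\<nu>2\<in>P_gamma \<gamma> borel dist.
        transport_cost \<gamma> c \<nu>1 \<nu>2 \<le> ereal a1 * rel_entropy \<nu>1 \<mu> + ereal a2 * rel_entropy \<nu>2 \<mu>)"

text \<open>
  Points of \<open>X\<^sup>n\<close> are the functions on \<open>{..<n}\<close> extended by \<open>undefined\<close>. As \<open>X\<close> is separable, the
  product sigma-field is the Borel sigma-field of the \<open>l\<^sub>1\<close> metric; see \<open>sets_Xn_eq_borel\<close>.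
\<close>

definition Xn :: "nat \<Rightarrow> (nat \<Rightarrow> 'a::topological_space) measure" where
  "Xn n = (\<Pi>\<^sub>M i\<in>{..<n}. borel)"

definition l1_dist :: "nat \<Rightarrow> (nat \<Rightarrow> 'a::metric_space) \<Rightarrow> (nat \<Rightarrow> 'a) \<Rightarrow> real" where
  "l1_dist n x y = (\<Sum>i<n. dist (x i) (y i))"

abbreviation power_measure :: "nat \<Rightarrow> 'a measure \<Rightarrow> (nat \<Rightarrow> 'a) measure" where
  "power_measure n \<mu> \<equiv> (\<Pi>\<^sub>M i\<in>{..<n}. \<mu>)"

definition marginal :: "nat \<Rightarrow> (nat \<Rightarrow> 'a::topological_space) measure \<Rightarrow> 'a measure" where
  "marginal i p = distr p borel (\<lambda>x. x i)"

definition cost_n ::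
  "('a::topological_space \<Rightarrow> 'a measure \<Rightarrow> real) \<Rightarrow> nat \<Rightarrow> (nat \<Rightarrow> 'a) \<Rightarrow> (nat \<Rightarrow> 'a) measure \<Rightarrow> real" where
  "cost_n c n x p = (\<Sum>i<n. c (x i) (marginal i p))"

definition cost_to_set ::
  "(real \<Rightarrow> real) \<Rightarrow> ('a::metric_space \<Rightarrow> 'a measure \<Rightarrow> real) \<Rightarrow> nat \<Rightarrow> (nat \<Rightarrow> 'a) set \<Rightarrow> (nat \<Rightarrow> 'a) \<Rightarrow> ereal" where
  "cost_to_set \<gamma> c n A x =
     (INF p\<in>{p \<in> P_gamma \<gamma> (Xn n) (l1_dist n). emeasure p A = 1}. ereal (cost_n c n x p))"

definition enlargement ::
  "(real \<Rightarrow> real) \<Rightarrow> ('a::metric_space \<Rightarrow> 'a measure \<Rightarrow> real) \<Rightarrow> nat \<Rightarrow> (nat \<Rightarrow> 'a) set \<Rightarrow> real \<Rightarrow> (nat \<Rightarrow> 'a) set" where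
  "enlargement \<gamma> c n A t = {x \<in> space (Xn n). cost_to_set \<gamma> c n A x \<le> ereal t}"


lemma space_Xn: "space (Xn n) = PiE {..<n} (\<lambda>_. UNIV)"
  by (simp add: Xn_def space_PiM)

lemma Metric_space_l1: "Metric_space (space (Xn n)) (l1_dist n)"
proof
  show "0 \<le> l1_dist n x y" for x y :: "nat \<Rightarrow> 'a"
    by (simp add: l1_dist_def sum_nonneg)
  show "l1_dist n x y = l1_dist n y x" for x y :: "nat \<Rightarrow> 'a"
    by (simp add: l1_dist_def dist_commute)
  show "l1_dist n x y = 0 \<longleftrightarrow> x = y" if "x \<in> space (Xn n)" "y \<in> space (Xn n)" for x y :: "nat \<Rightarrow> 'a"
  proof
    assume "l1_dist n x y = 0"
    then have "\<forall>i<n. x i = y i"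
      by (auto simp: l1_dist_def sum_nonneg_eq_0_iff)
    then show "x = y"
      using that by (intro PiE_ext[of x "{..<n}" _ y]) (auto simp: space_Xn)
  qed (simp add: l1_dist_def)
  show "l1_dist n x z \<le> l1_dist n x y + l1_dist n y z" for x y z :: "nat \<Rightarrow> 'a"
    unfolding l1_dist_def sum.distrib[symmetric] by (intro sum_mono dist_triangle)
qed

lemma sets_Xn_eq_borel:
  "sets (Xn n :: (nat \<Rightarrow> 'a::{metric_space, second_countable_topology}) measure) =
     sigma_sets (space (Xn n)) {U. openin (Metric_space.mtopology (space (Xn n)) (l1_dist n)) U}"
    (is "_ = sigma_sets ?X ?O")
proof
  interpret M: Metric_space ?X "l1_dist n" by (rule Metric_space_l1)
  have boxes: "sets (Xn n :: (nat \<Rightarrow> 'a) measure) =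
      sigma_sets ?X {{f \<in> ?X. f i \<in> A} | i A. i < n \<and> A \<in> sets borel}"
    by (simp add: Xn_def sets_PiM_single space_PiM)
  have cyl: "{f \<in> ?X. f i \<in> A} \<in> sigma_sets ?X ?O" if i: "i < n" and A: "A \<in> sets borel"
    for i and A :: "'a set"
  proof -
    have meas: "(\<lambda>f. f i) \<in> measurable (sigma ?X ?O) (borel :: 'a measure)"
    proof (rule borel_measurableI)
      fix U :: "'a set" assume U: "open U"
      have sub: "?O \<subseteq> Pow ?X" using openin_subset[where U = M.mtopology] by auto
      have "openin M.mtopology {f \<in> ?X. f i \<in> U}"
        unfolding M.openin_mtopology
      proof (intro conjI allI impI)
        fix f assume f: "f \<in> {f \<in> ?X. f i \<in> U}"
        then obtain e where e: "e > 0" "\<And>y. dist y (f i) < e \<Longrightarrow> y \<in> U"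
          using U unfolding open_dist by blast
        have "M.mball f e \<subseteq> {f \<in> ?X. f i \<in> U}"
        proof
          fix g assume g: "g \<in> M.mball f e"
          have "dist (f i) (g i) \<le> l1_dist n f g"
            unfolding l1_dist_def using i by (intro member_le_sum) auto
          with g show "g \<in> {f \<in> ?X. f i \<in> U}"
            by (auto simp: M.in_mball dist_commute intro!: e(2))
        qed
        then show "\<exists>r>0. M.mball f r \<subseteq> {f \<in> ?X. f i \<in> U}" using e by blast
      qed auto
      then have "{f \<in> ?X. f i \<in> U} \<in> sets (sigma ?X ?O)"
        using sub by (simp add: sets_measure_of)
      moreover have "(\<lambda>f. f i) -` U \<inter> space (sigma ?X ?O) = {f \<in> ?X. f i \<in> U}"
        using sub by (auto simp: space_measure_of)
      ultimately show "(\<lambda>f. f i) -` U \<inter> space (sigma ?X ?O) \<in> sets (sigma ?X ?O)" by simp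
    qed
    have sub: "?O \<subseteq> Pow ?X" using openin_subset[where U = M.mtopology] by auto
    have "(\<lambda>f. f i) -` A \<inter> space (sigma ?X ?O) \<in> sets (sigma ?X ?O)"
      using meas A by (rule measurable_sets)
    moreover have "(\<lambda>f. f i) -` A \<inter> space (sigma ?X ?O) = {f \<in> ?X. f i \<in> A}"
      using sub by (auto simp: space_measure_of)
    ultimately show ?thesis using sub by (simp add: sets_measure_of)
  qed
  show "sets (Xn n) \<subseteq> sigma_sets ?X ?O"
    unfolding boxes by (rule sigma_sets_mono) (auto intro: cyl)
  obtain B :: "'a set set" where B: "countable B" "topological_basis B"
    using ex_countable_basis by blast
  show "sigma_sets ?X ?O \<subseteq> sets (Xn n)"
  proof (rule sets.sigma_sets_subset, rule subsetI)
    fix U :: "(nat \<Rightarrow> 'a) set" assume "U \<in> ?O"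
    then have UX: "U \<subseteq> ?X" and U: "\<And>x. x \<in> U \<Longrightarrow> \<exists>r>0. M.mball x r \<subseteq> U"
      by (auto simp: M.openin_mtopology)
    define F where "F = {b \<in> PiE {..<n} (\<lambda>_. B). PiE {..<n} b \<subseteq> U}"
    have "countable F"
      unfolding F_def using B by (intro countable_Collect countable_PiE) auto
    moreover have "PiE {..<n} b \<in> sets (Xn n)" if b: "b \<in> F" for b
    proof -
      have "b i \<in> sets borel" if "i \<in> {..<n}" for i
      proof -
        have "b i \<in> B" using b that unfolding F_def by (simp add: PiE_iff)
        then show ?thesis using topological_basis_open[OF B(2)] by (simp add: borel_open)
      qed
      then show ?thesis unfolding Xn_def by (intro sets_PiM_I_finite) simp_all
    qed
    moreover have "U = (\<Union>b\<in>F. PiE {..<n} b)"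
    proof (intro equalityI subsetI)
      fix x assume x: "x \<in> U"
      then obtain r where r: "r > 0" "M.mball x r \<subseteq> U" using U by blast
      have "\<exists>b\<in>B. x i \<in> b \<and> b \<subseteq> ball (x i) (r / (real n + 1))" for i
      proof -
        have "x i \<in> ball (x i) (r / (real n + 1))" using r by simp
        then show ?thesis using topological_basisE[OF B(2) open_ball] by metis
      qed
      then obtain b where b: "\<And>i. b i \<in> B" "\<And>i. x i \<in> b i"
          "\<And>i. b i \<subseteq> ball (x i) (r / (real n + 1))" by metis
      have "PiE {..<n} (restrict b {..<n}) \<subseteq> M.mball x r"
      proof
        fix y assume y: "y \<in> PiE {..<n} (restrict b {..<n})"
        have "dist (x i) (y i) \<le> r / (real n + 1)" if "i < n" for i
        proof -
          have "y i \<in> b i" using y that by (auto simp: PiE_iff)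
          then show ?thesis using b(3)[of i] by (auto simp: subset_iff less_imp_le)
        qed
        then have "l1_dist n x y \<le> (\<Sum>i<n. r / (real n + 1))"
          unfolding l1_dist_def by (intro sum_mono) auto
        also have "\<dots> < r" using r by (simp add: field_simps)
        finally have "l1_dist n x y < r" .
        moreover have "y \<in> ?X" using y by (auto simp: space_Xn PiE_iff)
        moreover have "x \<in> ?X" using x UX by blast
        ultimately show "y \<in> M.mball x r" by simp
      qed
      then have "restrict b {..<n} \<in> F" using b r by (auto simp: F_def)
      moreover have "x \<in> PiE {..<n} (restrict b {..<n})"
        using b x UX by (auto simp: space_Xn PiE_iff)
      ultimately show "x \<in> (\<Union>b\<in>F. PiE {..<n} b)" by blast
    qed (auto simp: F_def)
    ultimately show "U \<in> sets (Xn n)"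
      using sets.countable_UN''[of F "PiE {..<n}" "Xn n"] by simp
  qed
qed

text \<open>
  Two facts are implicit in the definitions: \<open>P_gamma\<close> does not depend on the base point, and the
  marginals of elements of \<open>P_gamma\<close> on \<open>X\<^sup>n\<close> are in \<open>P_gamma\<close> on \<open>X\<close>, the domain of \<open>c x\<close>. Both hold
  if \<open>\<gamma>\<close> is nondecreasing, but not for every lower semicontinuous \<open>\<gamma>\<close> with \<open>\<gamma> 0 = 0\<close> and
  \<open>\<gamma> (u + v) \<le> C * (\<gamma> u + \<gamma> v)\<close>.
\<close>

lemma mono_gauge_base_point:
  fixes \<gamma> :: "real \<Rightarrow> real" and x0 x1 :: "'a::metric_space"
  assumes nonneg: "\<And>u. 0 \<le> u \<Longrightarrow> 0 \<le> \<gamma> u"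
    and sub: "\<And>u v. 0 \<le> u \<Longrightarrow> 0 \<le> v \<Longrightarrow> \<gamma> (u + v) \<le> C * (\<gamma> u + \<gamma> v)"
    and mono: "mono_on {0..} \<gamma>"
    and p: "p \<in> space (prob_algebra borel)"
    and fin: "(\<integral>\<^sup>+ x. ennreal (\<gamma> (dist x x0)) \<partial>p) < \<infinity>"
  shows "(\<integral>\<^sup>+ x. ennreal (\<gamma> (dist x x1)) \<partial>p) < \<infinity>"
proof -
  interpret prob_space p using p by (simp add: space_prob_algebra)
  have sp: "sets p = sets borel" using p by (simp add: space_prob_algebra)
  define D where "D = \<bar>C\<bar>"
  have meas: "(\<lambda>x. \<gamma> (dist x x0)) \<in> borel_measurable p"
  proof -
    have "(\<lambda>u. \<gamma> (max 0 u)) \<in> borel_measurable borel"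
      by (rule borel_measurable_mono) (auto intro!: monoI mono_onD[OF mono])
    then have "(\<lambda>x. \<gamma> (max 0 (dist x x0))) \<in> borel_measurable borel"
      by (rule measurable_compose[rotated]) (intro borel_measurable_continuous_onI continuous_intros)
    then show ?thesis by (simp add: measurable_cong_sets[OF sp refl])
  qed
  have "(\<integral>\<^sup>+ x. ennreal (\<gamma> (dist x x1)) \<partial>p)
      \<le> (\<integral>\<^sup>+ x. ennreal D * ennreal (\<gamma> (dist x x0)) + ennreal (D * \<gamma> (dist x0 x1)) \<partial>p)"
  proof (rule nn_integral_mono)
    fix x
    have "\<gamma> (dist x x1) \<le> \<gamma> (dist x x0 + dist x0 x1)"
      by (rule mono_onD[OF mono]) (auto intro: dist_triangle)
    also have "\<dots> \<le> C * (\<gamma> (dist x x0) + \<gamma> (dist x0 x1))"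
      by (rule sub) auto
    also have "\<dots> \<le> D * (\<gamma> (dist x x0) + \<gamma> (dist x0 x1))"
      unfolding D_def using nonneg by (intro mult_right_mono add_nonneg_nonneg) auto
    finally show "ennreal (\<gamma> (dist x x1)) \<le> ennreal D * ennreal (\<gamma> (dist x x0)) + ennreal (D * \<gamma> (dist x0 x1))"
      using nonneg by (simp add: D_def ennreal_mult[symmetric] ennreal_plus[symmetric]
          distrib_left ennreal_leI del: ennreal_plus)
  qed
  also have "\<dots> = ennreal D * (\<integral>\<^sup>+ x. ennreal (\<gamma> (dist x x0)) \<partial>p) + ennreal (D * \<gamma> (dist x0 x1))"
    using meas by (simp add: nn_integral_add nn_integral_cmult emeasure_space_1)
  also have "\<dots> < \<infinity>" using fin by (simp add: ennreal_mult_less_top)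
  finally show ?thesis .
qed

lemma mono_gauge_marginal:
  fixes \<gamma> :: "real \<Rightarrow> real" and p :: "(nat \<Rightarrow> 'a::metric_space) measure"
  assumes mono: "mono_on {0..} \<gamma>" and i: "i < n" and p: "p \<in> P_gamma \<gamma> (Xn n) (l1_dist n)"
  shows "marginal i p \<in> P_gamma \<gamma> borel dist"
proof -
  from p obtain xo where sp: "sets p = sets (Xn n)" and pr: "prob_space p"
    and fin: "(\<integral>\<^sup>+ x. ennreal (\<gamma> (l1_dist n x xo)) \<partial>p) < \<infinity>"
    by (auto simp: P_gamma_def space_prob_algebra)
  have [measurable]: "(\<lambda>x. x i) \<in> p \<rightarrow>\<^sub>M borel"
    unfolding measurable_cong_sets[OF sp refl] Xn_def
    by (rule measurable_component_singleton) (simp add: i)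
  have "(\<lambda>u. \<gamma> (max 0 u)) \<in> borel_measurable borel"
    by (rule borel_measurable_mono) (auto intro!: monoI mono_onD[OF mono])
  then have "(\<lambda>x. \<gamma> (max 0 (dist x (xo i)))) \<in> borel_measurable borel"
    by (rule measurable_compose[rotated]) (intro borel_measurable_continuous_onI continuous_intros)
  then have [measurable]: "(\<lambda>x. \<gamma> (dist x (xo i))) \<in> borel_measurable borel"
    by simp
  have "(\<integral>\<^sup>+ x. ennreal (\<gamma> (dist x (xo i))) \<partial>marginal i p) = (\<integral>\<^sup>+ x. ennreal (\<gamma> (dist (x i) (xo i))) \<partial>p)"
    unfolding marginal_def by (subst nn_integral_distr) auto
  also have "\<dots> \<le> (\<integral>\<^sup>+ x. ennreal (\<gamma> (l1_dist n x xo)) \<partial>p)"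
  proof (intro nn_integral_mono ennreal_leI)
    fix x
    have "dist (x i) (xo i) \<le> l1_dist n x xo"
      unfolding l1_dist_def using i by (intro member_le_sum) auto
    then show "\<gamma> (dist (x i) (xo i)) \<le> \<gamma> (l1_dist n x xo)"
      by (intro mono_onD[OF mono]) (auto simp: l1_dist_def sum_nonneg)
  qed
  also note fin
  finally show ?thesis
    using prob_space.prob_space_distr[OF pr, of "\<lambda>x. x i" borel]
    by (auto simp: P_gamma_def space_prob_algebra marginal_def)
qed

end

theory Submission
  imports Defs
begin

text \<open>
  (i) implies (ii) with \<open>K = 1\<close> by tensorising the primal inequality for \<open>\<nu>\<^sub>1 = \<mu>\<^sup>n(\<cdot>|A)\<close> and
  \<open>\<nu>\<^sub>2 = \<mu>\<^sup>n(\<cdot>|B)\<close>, where \<open>B\<close> lies outside \<open>A\<^sup>n\<^sub>t\<close>. No measurable selection is needed: the coordinates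
  of a point of \<open>B\<close> are fixed one at a time, and \<open>A\<close> is replaced by sets that depend only on a finite
  partition of \<open>X\<close>, so that each step uses finitely many one-dimensional kernels. A sequence of such
  sets decreasing to a compact \<open>K \<subseteq> A\<close> is treated simultaneously; Fatou's lemma yields one point
  of \<open>B\<close> that works for infinitely many of them. Duality at Dirac masses makes \<open>c\<close> convex and lower
  semicontinuous in its second argument, which permits finite mixtures and the passage to a weak limit
  on \<open>K\<close>.

  (ii) implies (iii) because \<open>R\<^bsub>c\<^esub> \<phi> \<le> v + c\<^sub>A\<close> for \<open>A = {\<phi> \<le> v}\<close>. For (iii) implies (i), apply (iii) to
  \<open>\<phi>(x\<^sub>1) + \<dots> + \<phi>(x\<^sub>n)\<close>: integrating the tail bounds costs a factor polynomial in \<open>n\<close>, and taking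
  \<open>n\<close>-th roots gives the exponential inequality dual to (i).
\<close>

section \<open>Weak compactness on compact sets\<close>

text \<open>The induction spends the budget \<open>a1 * neg_ln (\<mu>\<^sup>n A) + a2 * neg_ln
  (\<mu>\<^sup>n B)\<close>. By the chain rule it splits into the entropies of the laws of one
  coordinate, which pay for a one-dimensional transport, and the mean of the same budget over the
  sections, which is left for the other coordinates. A coordinate value \<open>z\<close> with at
  most average expense then exists. The section of \<open>A\<close> is taken at a random point drawn
  from the kernel at \<open>z\<close>, so the induction hypothesis has to cover finite mixtures of
  sets together with the cost already paid. Partition sets approximate \<open>A\<close> only from
  outside, whereas \<open>cost_to_set\<close> demands full mass on \<open>A\<close> itself: hence
  the limit along finer partitions, and the need for one point that serves all of them. As \<gamma>
  may be unbounded on compact sets, the compact set is also cut down to a sublevel set of \<gamma>,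
  so that the limit has a finite moment. In the converse direction the constant in (iii) enters only
  through its logarithm, which disappears after division by \<open>n\<close>; so any constant leads
  back to the constant 1.\<close>

definition ternary :: "(nat \<Rightarrow> bool) \<Rightarrow> real" where
  "ternary d = (\<Sum>i. 2 * of_bool (d i) * (1/3) ^ Suc i)"

lemma summable_ternary: "summable (\<lambda>i. 2 * of_bool (d i) * (1/3::real) ^ Suc i)"
  by (rule summable_comparison_test'[where N = 0 and g = "\<lambda>i. 2 * (1/3) ^ Suc i"])
     (auto simp: of_bool_def intro!: summable_mult summable_geometric)

text \<open>Sequences are coded in the Cantor set, with ternary digits 0 and 2. Omitting the digit 1
  leaves gaps: at the first disagreement \<open>k\<close> the terms differ by
  \<open>2 * (1/3) ^ Suc k\<close>, while all later terms together contribute at most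
  \<open>(1/3) ^ Suc k\<close>.\<close>

lemma ternary_digits_eq:
  assumes "\<bar>ternary a - ternary b\<bar> < (1/3) ^ m" "i < m"
  shows "a i = b i"
proof (rule ccontr)
  assume ne: "a i \<noteq> b i"
  define k where "k = (LEAST i. a i \<noteq> b i)"
  have k: "a k \<noteq> b k" "k < m"
    using LeastI[of "\<lambda>i. a i \<noteq> b i", OF ne] Least_le[of "\<lambda>i. a i \<noteq> b i", OF ne] \<open>i < m\<close>
    unfolding k_def by (blast, linarith)
  have lt: "a j = b j" if "j < k" for j
    using not_less_Least[of j "\<lambda>i. a i \<noteq> b i"] that unfolding k_def by blast
  define e where "e j = 2 * (of_bool (a j) - of_bool (b j)) * (1/3::real) ^ Suc j" for j
  have eq: "e = (\<lambda>j. 2 * of_bool (a j) * (1/3) ^ Suc j - 2 * of_bool (b j) * (1/3) ^ Suc j)"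
    by (rule ext) (simp only: e_def right_diff_distrib left_diff_distrib)
  have e: "summable e" "ternary a - ternary b = suminf e"
    unfolding eq ternary_def
    by (intro summable_diff summable_ternary, intro suminf_diff summable_ternary)
  have eabs: "\<bar>e j\<bar> \<le> 2 * (1/3) ^ Suc j" for j
    by (auto simp: e_def of_bool_def)
  have g: "(\<lambda>j. 2 * (1/3::real) ^ Suc (j + Suc k)) sums ((1/3) ^ Suc k)"
    using sums_mult[OF geometric_sums[of "1/3::real"], of "2 * (1/3) ^ (k+2)"]
    by (simp add: power_add mult_ac)
  have "suminf e = (\<Sum>j. e (j + Suc k)) + (\<Sum>j<Suc k. e j)"
    by (rule suminf_split_initial_segment[OF e(1)])
  also have "(\<Sum>j<Suc k. e j) = e k"
    using lt by (simp add: e_def)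
  finally have "\<bar>suminf e\<bar> \<ge> \<bar>e k\<bar> - \<bar>\<Sum>j. e (j + Suc k)\<bar>" by linarith
  moreover have "\<bar>\<Sum>j. e (j + Suc k)\<bar> \<le> (1/3) ^ Suc k"
  proof -
    have "norm (e (j + Suc k)) \<le> 2 * (1/3) ^ Suc (j + Suc k)" for j using eabs[of "j + Suc k"] by (simp only: real_norm_def)
    then have "norm (\<Sum>j. e (j + Suc k)) \<le> (\<Sum>j. 2 * (1/3) ^ Suc (j + Suc k))"
      by (rule norm_suminf_le) (use g in \<open>rule sums_summable\<close>)
    then show ?thesis using sums_unique[OF g] by simp
  qed
  moreover have "\<bar>e k\<bar> = 2 * (1/3) ^ Suc k"
    using k(1) by (auto simp: e_def of_bool_def)
  ultimately have "(1/3) ^ Suc k \<le> \<bar>ternary a - ternary b\<bar>" using e by simp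
  moreover have "(1/3::real) ^ m \<le> (1/3) ^ Suc k"
    using k(2) by (intro power_decreasing) auto
  ultimately show False using assms by linarith
qed

lemma ternary_bounds: "0 \<le> ternary d" "ternary d \<le> 1"
proof -
  have g: "(\<lambda>j. 2 * (1/3::real) ^ Suc j) sums 1"
    using sums_mult[OF geometric_sums[of "1/3::real"], of "2 * (1/3)"] by simp
  show "0 \<le> ternary d" unfolding ternary_def by (rule suminf_nonneg[OF summable_ternary]) simp
  have "2 * of_bool (d j) * (1/3) ^ Suc j \<le> 2 * (1/3::real) ^ Suc j" for j
    by (cases "d j") simp_all
  then have "ternary d \<le> (\<Sum>j. 2 * (1/3) ^ Suc j)"
    unfolding ternary_def by (rule suminf_le[OF _ summable_ternary sums_summable[OF g]])
  also have "\<dots> = 1" by (rule sums_unique[OF g, symmetric])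
  finally show "ternary d \<le> 1" .
qed

text \<open>
  The inverse of the code is uniformly continuous because the tests \<open>x \<in> U i\<close> contain a finite cover
  of the compact set by sets of arbitrarily small diameter.
\<close>

lemma compact_real_code:
  fixes S :: "'b::{metric_space, second_countable_topology} set"
  assumes S: "compact S"
  obtains s :: "'b \<Rightarrow> real" where "s \<in> borel_measurable borel" "\<And>x. 0 \<le> s x" "\<And>x. s x \<le> 1"
    "\<And>e. 0 < e \<Longrightarrow> \<exists>d>0. \<forall>x\<in>S. \<forall>y\<in>S. \<bar>s x - s y\<bar> < d \<longrightarrow> dist x y < e"
proof -
  obtain B :: "'b set set" where B: "countable B" "topological_basis B"
    using ex_countable_basis by blast
  \<comment> \<open>\<open>from_nat_into\<close> enumerates only nonempty sets; the added empty set
    is a test that always fails.\<close>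
  define B' where "B' = insert {} B"
  define U where "U = from_nat_into B'"
  have B': "countable B'" "B' \<noteq> {}" using B by (auto simp: B'_def)
  have U: "range U = B'" unfolding U_def by (rule range_from_nat_into[OF B'(2,1)])
  have openU: "open (U i)" for i
    using U topological_basis_open[OF B(2)] unfolding B'_def by (metis insertE open_empty rangeI)
  define s where "s x = ternary (\<lambda>i. x \<in> U i)" for x
  have "s \<in> borel_measurable borel"
    unfolding s_def ternary_def
  proof (rule borel_measurable_suminf)
    fix i
    have [measurable]: "U i \<in> sets borel" using openU by simp
    show "(\<lambda>x. 2 * of_bool (x \<in> U i) * (1/3::real) ^ Suc i) \<in> borel_measurable borel"
      unfolding of_bool_def by measurable
  qed
  moreover have "\<exists>d>0. \<forall>x\<in>S. \<forall>y\<in>S. \<bar>s x - s y\<bar> < d \<longrightarrow> dist x y < e" if e: "0 < e" for e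
  proof -
    have "\<exists>i. x \<in> U i \<and> (\<forall>y\<in>U i. \<forall>z\<in>U i. dist y z < e)" for x
    proof -
      obtain b where b: "b \<in> B" "x \<in> b" "b \<subseteq> ball x (e/2)"
        using topological_basisE[OF B(2) open_ball, of x x "e/2"] e by auto
      have "dist y z < e" if "y \<in> b" "z \<in> b" for y z
      proof -
        have "dist x y < e/2" "dist x z < e/2" using b(3) that by auto
        then show ?thesis using dist_triangle2[of y z x] by (simp add: dist_commute)
      qed
      moreover have "b \<in> range U" using b U by (simp add: B'_def)
      ultimately show ?thesis using b by blast
    qed
    then obtain i where i: "\<And>x. x \<in> U (i x)" "\<And>x y z. y \<in> U (i x) \<Longrightarrow> z \<in> U (i x) \<Longrightarrow> dist y z < e"
      by metis
    have "S \<subseteq> (\<Union>x\<in>S. U (i x))" using i by auto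
    then obtain F where F: "F \<subseteq> S" "finite F" "S \<subseteq> (\<Union>x\<in>F. U (i x))"
      using compactE_image[OF S, of S "\<lambda>x. U (i x)"] openU by metis
    \<comment> \<open>Larger than every index used by the finite cover: codes closer than
      \<open>(1/3) ^ m\<close> agree on all tests of the cover.\<close>
    define m where "m = Suc (Max (insert 0 (i ` F)))"
    have m: "i x < m" if "x \<in> F" for x
      unfolding m_def using F(2) that by (intro le_imp_less_Suc Max_ge) auto
    have "dist x y < e" if xy: "x \<in> S" "y \<in> S" "\<bar>s x - s y\<bar> < (1/3)^m" for x y
    proof -
      obtain z where z: "z \<in> F" "x \<in> U (i z)" using F xy by auto
      have "(x \<in> U (i z)) = (y \<in> U (i z))"
        using ternary_digits_eq[OF xy(3)[unfolded s_def] m[OF z(1)]] .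
      with z i(2) show ?thesis by blast
    qed
    then show ?thesis by (intro exI[of _ "(1/3)^m"]) auto
  qed
  ultimately show thesis using that[of s] ternary_bounds by (auto simp: s_def)
qed

text \<open>Prokhorov's theorem on a compact set, reduced to the line. The images under the code
  \<open>s\<close> live on the unit interval, so they are tight and have a weakly convergent
  subsequence; its limit is carried back by the inverse of \<open>s\<close>. Only the inverse has to
  be continuous, \<open>s\<close> itself is merely measurable.\<close>

lemma weakly_compact_prob_on_compact:
  fixes S :: "'b::polish_space set" and p :: "nat \<Rightarrow> 'b measure"
  assumes S: "compact S"
    and p: "\<And>k. prob_space (p k)" "\<And>k. sets (p k) = sets borel" "\<And>k. AE x in p k. x \<in> S"
  obtains r :: "nat \<Rightarrow> nat" and q where "strict_mono r" "prob_space q" "sets q = sets borel"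
    "AE x in q. x \<in> S"
    "\<And>\<phi> :: 'b \<Rightarrow> real. continuous_on UNIV \<phi> \<Longrightarrow> (\<lambda>k. \<integral>x. \<phi> x \<partial>p (r k)) \<longlonglongrightarrow> (\<integral>x. \<phi> x \<partial>q)"
proof -
  obtain s :: "'b \<Rightarrow> real" where s[measurable]: "s \<in> borel_measurable borel" and s01: "\<And>x. 0 \<le> s x" "\<And>x. s x \<le> 1"
    and inv: "\<And>e. 0 < e \<Longrightarrow> \<exists>d>0. \<forall>x\<in>S. \<forall>y\<in>S. \<bar>s x - s y\<bar> < d \<longrightarrow> dist x y < e"
    using compact_real_code[OF S] by blast
  have Sne: "S \<noteq> {}"
  proof
    assume "S = {}"
    then show False using p(3)[of 0] prob_space.AE_False[OF p(1)[of 0]] by simp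
  qed
  have inj: "inj_on s S"
  proof (rule inj_onI, rule ccontr)
    fix x y assume xy: "x \<in> S" "y \<in> S" "s x = s y" "x \<noteq> y"
    then obtain d where "d > 0" "\<forall>x'\<in>S. \<forall>y'\<in>S. \<bar>s x' - s y'\<bar> < d \<longrightarrow> dist x' y' < dist x y"
      using inv[of "dist x y"] by auto
    then have "dist x y < dist x y" using xy by (metis abs_zero right_minus_eq)
    then show False by simp
  qed
  define T where "T = s ` S"
  have T01: "T \<subseteq> {0..1}" using s01 by (auto simp: T_def)
  define g0 where "g0 = the_inv_into S s"
  have g0: "g0 (s x) = x" if "x \<in> S" for x
    using the_inv_into_f_f[OF inj that] by (simp add: g0_def)
  have ucg: "uniformly_continuous_on T g0"
    unfolding uniformly_continuous_on_def
  proof (intro allI impI)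
    fix e :: real assume "0 < e"
    then obtain d where d: "d > 0" "\<forall>x\<in>S. \<forall>y\<in>S. \<bar>s x - s y\<bar> < d \<longrightarrow> dist x y < e"
      using inv by blast
    have "dist (g0 t) (g0 u) < e" if "t \<in> T" "u \<in> T" "dist t u < d" for t u
      using that d(2) g0 by (auto simp: T_def dist_real_def)
    with d(1) show "\<exists>d>0. \<forall>x\<in>T. \<forall>x'\<in>T. dist x' x < d \<longrightarrow> dist (g0 x') (g0 x) < e" by blast
  qed
  \<comment> \<open>\<open>T\<close> need not be closed, so the limit law is only known to live on
    \<open>closure T\<close>; uniform continuity extends the inverse to it.\<close>
  obtain g where g: "uniformly_continuous_on (closure T) g" "\<And>t. t \<in> T \<Longrightarrow> g0 t = g t"
    by (rule uniformly_continuous_on_extension_on_closure[OF ucg]) blast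
  have gs: "g (s x) = x" if "x \<in> S" for x using g(2)[of "s x"] g0[OF that] that by (auto simp: T_def)
  have contg: "continuous_on (closure T) g" using g(1) by (rule uniformly_continuous_imp_continuous)
  have gS: "g t \<in> S" if "t \<in> closure T" for t
  proof -
    have "g ` closure T \<subseteq> closure S"
      by (rule image_closure_subset[OF contg]) (auto simp: T_def gs closure_subset[THEN subsetD])
    then show ?thesis using that compact_imp_closed[OF S] by auto
  qed
  obtain x0 where x0: "x0 \<in> S" using Sne by blast
  \<comment> \<open>The value \<open>x0\<close> is taken on an \<open>M\<close>-null set only, by
    \<open>AEM\<close> below; it keeps \<open>h\<close> inside \<open>S\<close> everywhere.\<close>
  define h where "h t = (if t \<in> closure T then g t else x0)" for t
  have [measurable]: "closure T \<in> sets borel" by simp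
  have h[measurable]: "h \<in> borel \<rightarrow>\<^sub>M borel"
    unfolding h_def
    using borel_measurable_continuous_on_restrict[OF contg]
    by (subst measurable_If_restrict_space_iff) (auto)
  define \<mu> where "\<mu> k = distr (p k) borel s" for k
  have ms[measurable]: "s \<in> borel_measurable (p k)" for k
    using s p(2)[of k] by (simp add: measurable_cong_sets[OF p(2) refl])
  have rd: "real_distribution (\<mu> k)" for k
    unfolding \<mu>_def real_distribution_def real_distribution_axioms_def
    using prob_space.prob_space_distr[OF p(1) ms] by simp
  have "tight \<mu>"
    unfolding tight_def
  proof (intro conjI allI impI rd)
    fix e :: real assume e: "0 < e"
    have "measure (\<mu> k) {-1<..1} = 1" for k
    proof -
      have "measure (\<mu> k) {-1<..1} = measure (p k) (s -` {-1<..1} \<inter> space (p k))"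
        unfolding \<mu>_def by (intro measure_distr) auto
      also have "s -` {-1<..1} \<inter> space (p k) = space (p k)" using less_le_trans[OF _ s01(1), of "-1"] s01(2) by auto
      finally show ?thesis using prob_space.prob_space[OF p(1)] by simp
    qed
    then show "\<exists>a b. a < b \<and> (\<forall>n. 1 - e < measure (\<mu> n) {a<..b})"
      using e by (intro exI[of _ "-1"] exI[of _ 1]) auto
  qed
  then obtain r M where r: "strict_mono (r :: nat \<Rightarrow> nat)" and M: "real_distribution M"
    and conv: "weak_conv_m (\<mu> \<circ> id \<circ> r) M"
    using tight_imp_convergent_subsubsequence[of \<mu> id] strict_mono_id by blast
  interpret M: real_distribution M by fact
  interpret \<mu>: real_distribution "\<mu> k" for k by (rule rd)
  have lim: "(\<lambda>k. \<integral>t. f t \<partial>\<mu> (r k)) \<longlonglongrightarrow> (\<integral>t. f t \<partial>M)"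
    if "continuous_on UNIV f" "\<And>t. norm (f t) \<le> b" for f :: "real \<Rightarrow> real" and b
  proof -
    have "\<And>k. real_distribution ((\<mu> \<circ> id \<circ> r) k)" using rd by simp
    from weak_conv_imp_integral_bdd_continuous_conv[OF this M conv, of f b] that
    show ?thesis by (simp add: continuous_on_eq_continuous_at)
  qed
  have int\<mu>: "(\<integral>t. f t \<partial>\<mu> k) = (\<integral>x. f (s x) \<partial>p k)" if "f \<in> borel_measurable borel" for f :: "real \<Rightarrow> real" and k
    unfolding \<mu>_def by (rule integral_distr) (use that in auto)
  have AEM: "AE t in M. t \<in> closure T"
  proof -
    \<comment> \<open>A bounded continuous function that vanishes exactly on
      \<open>closure T\<close>: its integrals against all \<open>\<mu> k\<close> are 0, hence so is
      the one against the limit.\<close>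
    define f where "f t = min 1 (infdist t (closure T))" for t :: real
    have cf: "continuous_on UNIV f" unfolding f_def by (intro continuous_intros)
    have bf: "norm (f t) \<le> 1" for t unfolding f_def by (auto simp: infdist_nonneg)
    have [measurable]: "f \<in> borel_measurable borel" by (rule borel_measurable_continuous_onI[OF cf])
    have "(\<integral>t. f t \<partial>\<mu> k) = 0" for k
    proof -
      have "(\<integral>x. f (s x) \<partial>p k) = (\<integral>x. 0 \<partial>p k)"
      proof (rule integral_cong_AE)
        show "AE x in p k. f (s x) = 0"
          using p(3)[of k]
        proof eventually_elim
          case (elim x)
          then have "s x \<in> closure T" using closure_subset[of T] by (auto simp: T_def)
          then show ?case by (simp add: f_def)
        qed
      qed auto
      then show ?thesis using int\<mu>[of f k] by simp
    qed
    then have "(\<integral>t. f t \<partial>M) = 0" using lim[OF cf bf] by (simp add: LIMSEQ_const_iff)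
    moreover have "integrable M f"
      using bf by (intro M.integrable_const_bound[of _ 1]) auto
    moreover have "0 \<le> f t" for t by (auto simp: f_def infdist_nonneg)
    ultimately have "AE t in M. f t = 0" by (simp add: integral_nonneg_eq_0_iff_AE)
    then show ?thesis
    proof eventually_elim
      case (elim t)
      then have "infdist t (closure T) = 0" by (auto simp: f_def min_def split: if_splits)
      moreover have "closure T \<noteq> {}" using Sne by (simp add: T_def)
      ultimately show ?case using in_closed_iff_infdist_zero[of "closure T" t] by simp
    qed
  qed
  define q where "q = distr M borel h"
  have "prob_space q" unfolding q_def by (rule M.prob_space_distr) simp
  moreover have "sets q = sets borel" by (simp add: q_def)
  moreover have "AE x in q. x \<in> S"
  proof -
    have [measurable]: "S \<in> sets borel" using compact_imp_closed[OF S] by simp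
    have "h t \<in> S" for t using gS x0 by (simp add: h_def)
    then show ?thesis unfolding q_def by (subst AE_distr_iff) auto
  qed
  moreover have "(\<lambda>k. \<integral>x. \<phi> x \<partial>p (r k)) \<longlonglongrightarrow> (\<integral>x. \<phi> x \<partial>q)" if c\<phi>: "continuous_on UNIV \<phi>" for \<phi> :: "'b \<Rightarrow> real"
  proof -
    have [measurable]: "\<phi> \<in> borel_measurable borel" by (rule borel_measurable_continuous_onI[OF c\<phi>])
    have m\<phi>[measurable]: "\<phi> \<in> borel_measurable (p k)" for k
      by (simp add: measurable_cong_sets[OF p(2) refl])
    have c: "continuous_on (closure T) (\<lambda>t. \<phi> (g t))"
      by (rule continuous_on_compose2[OF c\<phi> contg]) auto
    have "bounded (\<phi> ` S)"
      by (intro compact_imp_bounded compact_continuous_image S continuous_on_subset[OF c\<phi>]) auto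
    then obtain b where b: "0 < b" "\<And>x. x \<in> S \<Longrightarrow> norm (\<phi> x) \<le> b" unfolding bounded_pos by auto
    \<comment> \<open>\<phi> may be unbounded, but it is bounded on \<open>S\<close>. Tietze extends
      its transported version from \<open>closure T\<close> to a bounded continuous function on the
      line, which weak convergence can test.\<close>
    obtain f where f: "continuous_on UNIV f" "\<And>t. t \<in> closure T \<Longrightarrow> f t = \<phi> (g t)" "\<And>t. norm (f t) \<le> b"
      using Tietze[OF c, of UNIV b] b gS by auto
    have [measurable]: "f \<in> borel_measurable borel" by (rule borel_measurable_continuous_onI[OF f(1)])
    have "(\<integral>t. f t \<partial>\<mu> k) = (\<integral>x. \<phi> x \<partial>p k)" for k
    proof -
      have "(\<integral>x. f (s x) \<partial>p k) = (\<integral>x. \<phi> x \<partial>p k)"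
      proof (rule integral_cong_AE)
        show "AE x in p k. f (s x) = \<phi> x"
          using p(3)[of k]
        proof eventually_elim
          case (elim x)
          then have "s x \<in> closure T" using closure_subset[of T] by (auto simp: T_def)
          then show ?case using f(2)[of "s x"] gs[OF elim] by simp
        qed
      qed auto
      then show ?thesis using int\<mu>[of f k] by simp
    qed
    moreover have "(\<integral>t. f t \<partial>M) = (\<integral>x. \<phi> x \<partial>q)"
    proof -
      have "(\<integral>x. \<phi> x \<partial>q) = (\<integral>t. \<phi> (h t) \<partial>M)" unfolding q_def by (rule integral_distr) auto
      also have "\<dots> = (\<integral>t. f t \<partial>M)"
      proof (rule integral_cong_AE)
        show "AE t in M. \<phi> (h t) = f t" using AEM by eventually_elim (simp add: h_def f(2))
      qed auto
      finally show ?thesis by simp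
    qed
    ultimately show ?thesis using lim[OF f(1,3)] by simp
  qed
  ultimately show thesis using r that by blast
qed

section \<open>Convexity and semicontinuity\<close>

locale transport_setting =
  fixes \<gamma> :: "real \<Rightarrow> real" and c :: "'a::polish_space \<Rightarrow> 'a measure \<Rightarrow> real"
  assumes gamma_nonneg: "\<And>u. 0 \<le> u \<Longrightarrow> 0 \<le> \<gamma> u"
    and gamma_lsc: "lower_semicontinuous_on {0..} \<gamma>"
    and gamma_zero: "\<gamma> 0 = 0"
    and base_point: "\<And>(p :: 'a measure) x0 x1. p \<in> space (prob_algebra borel) \<Longrightarrow>
          (\<integral>\<^sup>+ x. ennreal (\<gamma> (dist x x0)) \<partial>p) < \<infinity> \<Longrightarrow> (\<integral>\<^sup>+ x. ennreal (\<gamma> (dist x x1)) \<partial>p) < \<infinity>"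
    and marginals: "\<And>n i (p :: (nat \<Rightarrow> 'a) measure). i < n \<Longrightarrow>
          p \<in> P_gamma \<gamma> (Xn n) (l1_dist n) \<Longrightarrow> marginal i p \<in> P_gamma \<gamma> borel dist"
    and c_nonneg: "\<And>x p. p \<in> P_gamma \<gamma> borel dist \<Longrightarrow> 0 \<le> c x p"
    and c_measurable: "(\<lambda>(x, p). c x p) \<in>
          borel_measurable (borel \<Otimes>\<^sub>M P_gamma_algebra \<gamma> borel dist)"
    and duality: "duality_holds \<gamma> c"
begin

abbreviation Pg :: "'a measure set" where
  "Pg \<equiv> P_gamma \<gamma> borel dist"

text \<open>Composition with the 1-Lipschitz retraction \<open>max 0\<close> carries lower
  semicontinuity from the half-line to the whole line. Both the measurability of \<gamma> and the
  closedness of its sublevel sets rest on this.\<close>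

lemma open_gamma_greater: "open {u. r < \<gamma> (max 0 u)}"
  unfolding open_dist
proof safe
  fix u assume u: "r < \<gamma> (max 0 u)"
  have "eventually (\<lambda>v. r < \<gamma> v) (at (max 0 u) within {0..})"
    using gamma_lsc u unfolding lower_semicontinuous_on_def by auto
  then obtain d where d: "d > 0" "\<And>v. v \<ge> 0 \<Longrightarrow> v \<noteq> max 0 u \<Longrightarrow> dist v (max 0 u) < d \<Longrightarrow> r < \<gamma> v"
    unfolding eventually_at by auto
  have "r < \<gamma> (max 0 v)" if v: "dist v u < d" for v
  proof (cases "max 0 v = max 0 u")
    case False
    have "dist (max 0 v) (max 0 u) \<le> dist v u" by (auto simp: dist_real_def max_def)
    then show ?thesis using d(2)[of "max 0 v"] False v by simp
  qed (use u in simp)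
  then show "\<exists>e>0. \<forall>y. dist y u < e \<longrightarrow> y \<in> {u. r < \<gamma> (max 0 u)}" using d(1) by auto
qed

lemma gamma_measurable [measurable]:
  assumes "f \<in> borel_measurable M" "\<And>x. 0 \<le> f x"
  shows "(\<lambda>x. \<gamma> (f x)) \<in> borel_measurable M"
proof -
  have "(\<lambda>u. \<gamma> (max 0 u)) \<in> borel_measurable borel"
    unfolding borel_measurable_iff_greater using open_gamma_greater by auto
  from measurable_compose[OF assms(1) this] show ?thesis using assms(2) by (simp add: max_absorb2)
qed

lemma PgD:
  assumes "p \<in> Pg"
  shows "prob_space p" "sets p = sets borel" "space p = UNIV" "p \<in> space (prob_algebra borel)"
    "(\<integral>\<^sup>+ x. ennreal (\<gamma> (dist x x0)) \<partial>p) < \<infinity>"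
  using assms base_point[of p _ x0] sets_eq_imp_space_eq[of p borel]
  by (auto simp: P_gamma_def space_prob_algebra)

lemma PgI:
  assumes "prob_space p" "sets p = sets borel" "(\<integral>\<^sup>+ x. ennreal (\<gamma> (dist x x0)) \<partial>p) < \<infinity>"
  shows "p \<in> Pg"
  using assms by (auto simp: P_gamma_def space_prob_algebra)

lemma return_Pg: "return borel x \<in> Pg"
  by (rule PgI[of _ x]) (auto simp: prob_space_return nn_integral_return gamma_zero)

lemma kernel_iff:
  "p \<in> M \<rightarrow>\<^sub>M P_gamma_algebra \<gamma> borel dist \<longleftrightarrow>
    p \<in> M \<rightarrow>\<^sub>M prob_algebra borel \<and> (\<forall>x\<in>space M. p x \<in> Pg)"
  unfolding P_gamma_algebra_def measurable_restrict_space2_iff by auto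

lemma cost_measurable:
  assumes "p \<in> borel \<rightarrow>\<^sub>M P_gamma_algebra \<gamma> borel dist"
  shows "(\<lambda>x. c x (p x)) \<in> borel_measurable borel"
  using measurable_compose[OF measurable_Pair[OF measurable_ident_sets[OF refl] assms] c_measurable]
  by simp

lemma Phi_continuous:
  assumes "\<phi> \<in> Phi_gamma \<gamma> borel dist"
  shows "continuous_on UNIV \<phi>"
proof -
  have "continuous_map (Metric_space.mtopology UNIV dist) euclidean \<phi>"
    using assms unfolding Phi_gamma_def by (simp only: mem_Collect_eq space_borel)
  then show ?thesis by (simp only: mtopology_is_euclidean continuous_map_iff_continuous2)
qed

lemma Phi_integrable:
  assumes \<phi>: "\<phi> \<in> Phi_gamma \<gamma> borel dist" and p: "p \<in> Pg"
  shows "integrable p \<phi>"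
proof -
  interpret prob_space p using PgD[OF p] by simp
  obtain x0 a b where ab: "a \<ge> 0" "b \<ge> 0" "\<And>x. \<bar>\<phi> x\<bar> \<le> a + b * \<gamma> (dist x x0)"
    using \<phi> by (auto simp: Phi_gamma_def)
  have [measurable]: "\<phi> \<in> borel_measurable p"
    using borel_measurable_continuous_onI[OF Phi_continuous[OF \<phi>]]
    by (simp add: measurable_cong_sets[OF PgD(2)[OF p] refl])
  have [measurable]: "(\<lambda>x. \<gamma> (dist x x0)) \<in> borel_measurable p"
  proof -
    have "(\<lambda>x. \<gamma> (dist x x0)) \<in> borel_measurable borel" by measurable
    then show ?thesis by (simp add: measurable_cong_sets[OF PgD(2)[OF p] refl])
  qed
  have "integrable p (\<lambda>x. \<gamma> (dist x x0))"
    using PgD(5)[OF p, of x0] by (intro integrableI_bounded) (auto simp: gamma_nonneg)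
  then have "integrable p (\<lambda>x. a + b * \<gamma> (dist x x0))" by simp
  then show ?thesis
    by (rule Bochner_Integration.integrable_bound)
      (use ab(3) in \<open>auto intro: order_trans[OF _ abs_ge_self]\<close>)
qed

lemma disintegration_second_marginal:
  assumes \<pi>: "\<pi> \<in> couplings \<mu> \<nu>" and k: "k \<in> disintegrations \<gamma> \<mu> \<pi>" and B: "B \<in> sets borel"
  shows "emeasure \<nu> B = (\<integral>\<^sup>+x. emeasure (k x) B \<partial>\<mu>)"
proof -
  have s: "distr \<pi> borel snd = \<nu>" and sp: "sets \<pi> = sets borel"
    using \<pi> by (auto simp: couplings_def space_prob_algebra)
  have msnd: "snd \<in> \<pi> \<rightarrow>\<^sub>M borel"
    unfolding measurable_cong_sets[OF sp refl] by (intro borel_measurable_continuous_onI continuous_intros)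
  have "emeasure \<nu> B = emeasure \<pi> (UNIV \<times> B)"
    unfolding s[symmetric] using msnd sets_eq_imp_space_eq[OF sp] B
    by (subst emeasure_distr) (auto intro!: arg_cong[where f = "emeasure \<pi>"])
  also have "\<dots> = (\<integral>\<^sup>+x\<in>UNIV. emeasure (k x) B \<partial>\<mu>)"
    using k B by (auto simp: disintegrations_def)
  finally show ?thesis by simp
qed

text \<open>From a point mass there is only one transport: averaging a disintegration
  \<open>k\<close> over the Dirac mass at \<open>y\<close> returns \<open>k y\<close>, which must
  therefore be the second marginal \<open>p\<close>.\<close>

lemma cost_le_transport_cost_return:
  assumes p: "p \<in> Pg"
  shows "ereal (c y p) \<le> transport_cost \<gamma> c p (return borel y)"
  unfolding transport_cost_def
proof (intro INF_greatest)
  fix \<pi> k assume \<pi>: "\<pi> \<in> couplings (return borel y) p"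
    and k: "k \<in> disintegrations \<gamma> (return borel y) \<pi>"
  have km: "k \<in> borel \<rightarrow>\<^sub>M P_gamma_algebra \<gamma> borel dist" using k by (simp add: disintegrations_def)
  have kP: "k y \<in> Pg" and km': "k \<in> borel \<rightarrow>\<^sub>M prob_algebra borel" using km by (auto simp: kernel_iff)
  have "p = k y"
  proof (rule measure_eqI)
    show "sets p = sets (k y)" using PgD(2)[OF p] PgD(2)[OF kP] by simp
    fix B assume "B \<in> sets p"
    then have B[measurable]: "B \<in> sets borel" using PgD(2)[OF p] by simp
    have "emeasure p B = (\<integral>\<^sup>+x. emeasure (k x) B \<partial>return borel y)"
      by (rule disintegration_second_marginal[OF \<pi> k B])
    also have "\<dots> = emeasure (k y) B"
      using measurable_compose[OF measurable_prob_algebraD[OF km'] measurable_emeasure_subprob_algebra[OF B]]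
      by (simp add: nn_integral_return)
    finally show "emeasure p B = emeasure (k y) B" .
  qed
  moreover have "(\<integral>\<^sup>+x. ennreal (c x (k x)) \<partial>return borel y) = ennreal (c y (k y))"
    using cost_measurable[OF km] by (simp add: nn_integral_return)
  ultimately show "ereal (c y p) \<le> enn2ereal (\<integral>\<^sup>+x. ennreal (c x (k x)) \<partial>return borel y)"
    using c_nonneg[OF p] by simp
qed

text \<open>
  Duality at \<open>\<mu> = \<delta>\<^sub>y\<close> exhibits \<open>c y\<close> as a supremum of affine functions of \<open>p\<close>; here \<open>s\<close> ranges
  over the lower bounds of \<open>R\<^sub>c \<phi> (y)\<close>.
\<close>

lemma cost_leI:
  assumes p: "p \<in> Pg"
    and bound: "\<And>(\<phi> :: 'a \<Rightarrow> real) s. \<phi> \<in> Phi_gamma_b \<gamma> borel dist \<Longrightarrow>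
      (\<And>q. q \<in> Pg \<Longrightarrow> s \<le> (\<integral>x. \<phi> x \<partial>q) + c y q) \<Longrightarrow> s \<le> (\<integral>x. \<phi> x \<partial>p) + r"
  shows "c y p \<le> r"
proof -
  have "transport_cost \<gamma> c p (return borel y) =
      (SUP \<phi>\<in>Phi_gamma_b \<gamma> borel dist.
         lower_integral (return borel y) (inf_conv Pg c \<phi>) - ereal (\<integral>x. \<phi> x \<partial>p))"
    using duality return_Pg p unfolding duality_holds_def by blast
  also have "\<dots> \<le> ereal r"
  proof (rule SUP_least)
    fix \<phi> :: "'a \<Rightarrow> real" assume \<phi>: "\<phi> \<in> Phi_gamma_b \<gamma> borel dist"
    have "lower_integral (return borel y) (inf_conv Pg c \<phi>) \<le> ereal ((\<integral>x. \<phi> x \<partial>p) + r)"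
      unfolding lower_integral_def
    proof (rule SUP_least, safe)
      fix f :: "'a \<Rightarrow> real" assume f: "f \<in> borel_measurable (return borel y)"
        and le: "\<forall>x\<in>space (return borel y). ereal (f x) \<le> inf_conv Pg c \<phi> x"
      have "f y \<le> (\<integral>x. \<phi> x \<partial>q) + c y q" if "q \<in> Pg" for q
      proof -
        have "ereal (f y) \<le> inf_conv Pg c \<phi> y" using le by simp
        also have "\<dots> \<le> ereal ((\<integral>x. \<phi> x \<partial>q) + c y q)" unfolding inf_conv_def using that by (rule INF_lower)
        finally show ?thesis by simp
      qed
      from bound[OF \<phi> this] have "f y \<le> (\<integral>x. \<phi> x \<partial>p) + r" .
      then show "ereal (\<integral>x. f x \<partial>return borel y) \<le> ereal ((\<integral>x. \<phi> x \<partial>p) + r)"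
        using f by (simp add: integral_return)
    qed
    then show "lower_integral (return borel y) (inf_conv Pg c \<phi>) - ereal (\<integral>x. \<phi> x \<partial>p) \<le> ereal r"
      by (simp add: ereal_minus_le add.commute)
  qed
  finally have "transport_cost \<gamma> c p (return borel y) \<le> ereal r" .
  from order_trans[OF cost_le_transport_cost_return[OF p] this] show ?thesis by simp
qed

text \<open>Convexity. Each affine minorant of \<open>c y\<close> lies below every
  \<open>c y (q l)\<close>, and averaging with the weights \<open>w\<close> keeps it below;
  \<open>cost_leI\<close> says that such minorants determine \<open>c y m\<close>. The mixture
  \<open>m\<close> enters only through integrals of test functions.\<close>

lemma cost_finite_mixture:
  assumes m: "m \<in> Pg" and q: "\<And>l. l \<in> I \<Longrightarrow> q l \<in> Pg" and w: "\<And>l. l \<in> I \<Longrightarrow> 0 \<le> w l" "sum w I = 1"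
    and mix: "\<And>\<phi>. \<phi> \<in> Phi_gamma \<gamma> borel dist \<Longrightarrow> (\<integral>x. \<phi> x \<partial>m) = (\<Sum>l\<in>I. w l * (\<integral>x. \<phi> x \<partial>q l))"
  shows "c y m \<le> (\<Sum>l\<in>I. w l * c y (q l))"
proof (rule cost_leI[OF m])
  fix \<phi> :: "'a \<Rightarrow> real" and s
  assume \<phi>: "\<phi> \<in> Phi_gamma_b \<gamma> borel dist" and s: "\<And>q. q \<in> Pg \<Longrightarrow> s \<le> (\<integral>x. \<phi> x \<partial>q) + c y q"
  have "s = (\<Sum>l\<in>I. w l * s)" using w(2) by (simp flip: sum_distrib_right)
  also have "\<dots> \<le> (\<Sum>l\<in>I. w l * ((\<integral>x. \<phi> x \<partial>q l) + c y (q l)))"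
    by (intro sum_mono mult_left_mono s q w(1))
  also have "\<dots> = (\<integral>x. \<phi> x \<partial>m) + (\<Sum>l\<in>I. w l * c y (q l))"
    using mix \<phi> by (simp add: Phi_gamma_b_def distrib_left sum.distrib)
  finally show "s \<le> (\<integral>x. \<phi> x \<partial>m) + (\<Sum>l\<in>I. w l * c y (q l))" .
qed

text \<open>Lower semicontinuity. Some affine minorant is within \<open>e/2\<close> of
  \<open>c y\<close> at \<open>m\<close>; convergence of the integral of its one test function costs
  another \<open>e/2\<close>.\<close>

lemma cost_eventually_ge:
  assumes m: "m \<in> Pg" and q: "\<And>k. q k \<in> Pg" and e: "0 < e"
    and lim: "\<And>\<phi>. \<phi> \<in> Phi_gamma \<gamma> borel dist \<Longrightarrow> (\<lambda>k. \<integral>x. \<phi> x \<partial>q k) \<longlonglongrightarrow> (\<integral>x. \<phi> x \<partial>m)"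
  shows "eventually (\<lambda>k. c y m - e \<le> c y (q k)) sequentially"
proof -
  have "\<not> c y m \<le> c y m - e/2" using e by simp
  then obtain \<phi> :: "'a \<Rightarrow> real" and s where \<phi>: "\<phi> \<in> Phi_gamma_b \<gamma> borel dist"
    and s: "\<And>q. q \<in> Pg \<Longrightarrow> s \<le> (\<integral>x. \<phi> x \<partial>q) + c y q" and less: "(\<integral>x. \<phi> x \<partial>m) + (c y m - e/2) < s"
    using cost_leI[OF m, of y "c y m - e/2"] by (meson not_le)
  have "(\<lambda>k. \<integral>x. \<phi> x \<partial>q k) \<longlonglongrightarrow> (\<integral>x. \<phi> x \<partial>m)" using lim \<phi> by (simp add: Phi_gamma_b_def)
  then have "eventually (\<lambda>k. (\<integral>x. \<phi> x \<partial>q k) < (\<integral>x. \<phi> x \<partial>m) + e/2) sequentially"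
    by (rule order_tendstoD) (use e in simp)
  then show ?thesis
  proof eventually_elim
    case (elim k)
    then show ?case using s[OF q[of k]] less by linarith
  qed
qed

end

section \<open>The one-dimensional step\<close>

text \<open>A penalty in \<open>[0, \<infinity>]\<close>: it is infinite at 0, where the library
  logarithm would give 0, so that null sections count as infinitely expensive. It is applied to
  numbers in \<open>[0, 1]\<close>.\<close>

definition neg_ln :: "real \<Rightarrow> ennreal" where
  "neg_ln x = (if x \<le> 0 then \<infinity> else ennreal (- ln x))"

lemma neg_ln_measurable [measurable]: "neg_ln \<in> borel_measurable borel"
  unfolding neg_ln_def by measurable

lemma mult_ln_bounds:
  fixes t :: real
  assumes "0 \<le> t" "t \<le> 1"
  shows "t * ln t \<le> 0" "-1 \<le> t * ln t"
proof -
  show "t * ln t \<le> 0" using assms by (cases "t = 0") (auto intro!: mult_nonneg_nonpos)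
  show "-1 \<le> t * ln t"
  proof (cases "t = 0")
    case False
    then have t: "t > 0" using assms by simp
    have "ln (1/t) \<le> 1/t - 1" by (rule ln_le_minus_one) (use t in simp)
    then have "- ln t \<le> 1/t - 1" using t by (simp add: ln_div)
    from mult_left_mono[OF this, of t] t show ?thesis by (simp add: algebra_simps)
  qed simp
qed

lemma rel_entropy_density:
  assumes "prob_space \<mu>" and f: "f \<in> borel_measurable \<mu>" "\<And>x. 0 \<le> f x"
    and int: "integrable \<mu> (\<lambda>x. f x * ln (f x))"
  shows "rel_entropy (density \<mu> (\<lambda>x. ennreal (f x))) \<mu> = ereal (\<integral>x. f x * ln (f x) \<partial>\<mu>)"
proof -
  interpret prob_space \<mu> by fact
  note f(1)[measurable]
  let ?\<nu> = "density \<mu> (\<lambda>x. ennreal (f x))"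
  have "AE x in \<mu>. ennreal (f x) = RN_deriv \<mu> ?\<nu> x" by (rule RN_deriv_unique) auto
  then have "AE x in \<mu>. f x *\<^sub>R entropy_density (exp 1) \<mu> ?\<nu> x = f x * ln (f x)"
  proof eventually_elim
    case (elim x)
    then have "entropy_density (exp 1) \<mu> ?\<nu> x = log (exp 1) (enn2real (ennreal (f x)))"
      by (simp add: entropy_density_def)
    then show ?case using f(2) by (simp add: log_ln[symmetric])
  qed
  moreover have "(\<lambda>x. f x *\<^sub>R entropy_density (exp 1) \<mu> ?\<nu> x) \<in> borel_measurable \<mu>"
    by (intro borel_measurable_scaleR f measurable_entropy_density)
  ultimately have "integrable \<mu> (\<lambda>x. f x *\<^sub>R entropy_density (exp 1) \<mu> ?\<nu> x)"
    using int by (subst integrable_cong_AE[where g = "\<lambda>x. f x * ln (f x)"]) auto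
  then have "integrable ?\<nu> (entropy_density (exp 1) \<mu> ?\<nu>)"
    using f by (subst integrable_density) (auto intro: measurable_entropy_density)
  moreover have "absolutely_continuous \<mu> ?\<nu>" by (rule absolutely_continuousI_density) simp
  moreover have "KL_divergence (exp 1) \<mu> ?\<nu> = (\<integral>x. f x * ln (f x) \<partial>\<mu>)"
    using f by (subst KL_density) (auto simp: log_ln[symmetric])
  ultimately show ?thesis by (simp add: rel_entropy_def)
qed

text \<open>The chain rule of the entropy for the first marginal of the normalised restriction of a
  product measure to a set whose sections have measure \<open>f\<close>.\<close>

lemma entropy_chain:
  fixes f :: "'b \<Rightarrow> real"
  assumes "prob_space \<mu>" and f[measurable]: "f \<in> borel_measurable \<mu>"
    and f01: "\<And>x. 0 \<le> f x" "\<And>x. f x \<le> 1" and m: "m = (\<integral>x. f x \<partial>\<mu>)" "0 < m"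
  obtains h e where "rel_entropy (density \<mu> (\<lambda>x. ennreal (f x / m))) \<mu> = ereal h"
    "(\<integral>\<^sup>+x. neg_ln (f x) \<partial>density \<mu> (\<lambda>x. ennreal (f x / m))) = ennreal e" "0 \<le> e" "h + e = - ln m"
proof -
  interpret prob_space \<mu> by fact
  have if_: "integrable \<mu> f" using f01 by (intro integrable_const_bound[of _ 1]) auto
  have ifl: "integrable \<mu> (\<lambda>x. f x * ln (f x))"
    using mult_ln_bounds[OF f01] by (intro integrable_const_bound[of _ 1]) (auto simp: abs_le_iff minus_le_iff intro: order_trans[of _ 0])
  \<comment> \<open>Integrated, the first term is cancelled by the mean of
    \<open>neg_ln (f x)\<close> under the density, and the second gives \<open>- ln m\<close>,
    because \<open>f / m\<close> has integral 1.\<close>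
  have eq: "f x / m * ln (f x / m) = f x * ln (f x) / m - ln m * (f x / m)" for x
    using m(2) f01(1)[of x] by (cases "f x = 0") (auto simp: ln_div field_simps)
  have ih: "integrable \<mu> (\<lambda>x. f x / m * ln (f x / m))"
    unfolding eq using if_ ifl by simp
  have 1: "rel_entropy (density \<mu> (\<lambda>x. ennreal (f x / m))) \<mu> = ereal (\<integral>x. f x / m * ln (f x / m) \<partial>\<mu>)"
    using m f01 by (intro rel_entropy_density ih) (auto simp: prob_space_axioms)
  have "(\<integral>\<^sup>+x. neg_ln (f x) \<partial>density \<mu> (\<lambda>x. ennreal (f x / m))) =
      (\<integral>\<^sup>+x. ennreal (f x / m) * neg_ln (f x) \<partial>\<mu>)"
    by (rule nn_integral_density) auto
  also have "\<dots> = (\<integral>\<^sup>+x. ennreal (- (f x * ln (f x)) / m) \<partial>\<mu>)"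
  proof (rule nn_integral_cong)
    fix x
    show "ennreal (f x / m) * neg_ln (f x) = ennreal (- (f x * ln (f x)) / m)"
    proof (cases "f x = 0")
      case False
      then have "0 < f x" "ln (f x) \<le> 0" using f01[of x] by auto
      then show ?thesis using m(2) by (simp add: neg_ln_def ennreal_mult[symmetric])
    qed simp
  qed
  also have "\<dots> = ennreal (\<integral>x. - (f x * ln (f x)) / m \<partial>\<mu>)"
    using ifl m(2) mult_ln_bounds[OF f01] by (intro nn_integral_eq_integral) (auto simp: divide_le_0_iff)
  finally have 2: "(\<integral>\<^sup>+x. neg_ln (f x) \<partial>density \<mu> (\<lambda>x. ennreal (f x / m))) =
      ennreal (\<integral>x. - (f x * ln (f x)) / m \<partial>\<mu>)" .
  have 3: "0 \<le> (\<integral>x. - (f x * ln (f x)) / m \<partial>\<mu>)"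
    using m(2) mult_ln_bounds[OF f01]
    by (intro Bochner_Integration.integral_nonneg) (auto simp: divide_le_0_iff)
  have 4: "(\<integral>x. f x / m * ln (f x / m) \<partial>\<mu>) + (\<integral>x. - (f x * ln (f x)) / m \<partial>\<mu>) = - ln m"
    unfolding eq using if_ ifl m by simp
  show thesis by (rule that[OF 1 2 3 4])
qed

context transport_setting
begin

text \<open>A density bounded by \<open>b\<close> multiplies the \<gamma>-moment by at most
  \<open>b\<close>.\<close>

lemma density_Pg:
  assumes \<mu>: "\<mu> \<in> Pg" and f[measurable]: "f \<in> borel_measurable borel" and f0: "\<And>x. 0 \<le> f x" "\<And>x. f x \<le> b"
    and 1: "(\<integral>x. f x \<partial>\<mu>) = 1"
  shows "density \<mu> (\<lambda>x. ennreal (f x)) \<in> Pg"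
proof -
  interpret prob_space \<mu> using PgD[OF \<mu>] by simp
  have [measurable_cong]: "sets \<mu> = sets borel" using PgD[OF \<mu>] by simp
  have b: "0 \<le> b" using f0 order_trans by blast
  have i: "integrable \<mu> f" using f0 by (intro integrable_const_bound[of _ b]) auto
  have "emeasure (density \<mu> (\<lambda>x. ennreal (f x))) (space \<mu>) = 1"
    using nn_integral_eq_integral[OF i] f0 1 by (simp add: emeasure_density)
  then have "prob_space (density \<mu> (\<lambda>x. ennreal (f x)))" by (intro prob_spaceI) simp
  moreover have "(\<integral>\<^sup>+ x. ennreal (\<gamma> (dist x x0)) \<partial>density \<mu> (\<lambda>x. ennreal (f x))) < \<infinity>" for x0
  proof -
    have "(\<integral>\<^sup>+ x. ennreal (\<gamma> (dist x x0)) \<partial>density \<mu> (\<lambda>x. ennreal (f x))) =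
        (\<integral>\<^sup>+ x. ennreal (f x) * ennreal (\<gamma> (dist x x0)) \<partial>\<mu>)"
      by (rule nn_integral_density) auto
    also have "\<dots> \<le> (\<integral>\<^sup>+ x. ennreal b * ennreal (\<gamma> (dist x x0)) \<partial>\<mu>)"
      using f0 by (intro nn_integral_mono mult_right_mono ennreal_leI) auto
    also have "\<dots> = ennreal b * (\<integral>\<^sup>+ x. ennreal (\<gamma> (dist x x0)) \<partial>\<mu>)" by (rule nn_integral_cmult) simp
    also have "\<dots> < \<infinity>" using PgD(5)[OF \<mu>, of x0] by (simp add: ennreal_mult_less_top)
    finally show ?thesis .
  qed
  ultimately show ?thesis using PgD[OF \<mu>] by (intro PgI) auto
qed

text \<open>In the application \<open>f\<close> and \<open>g\<close> are the section measures of
  \<open>A\<close> and \<open>B\<close>. The transport inequality for the two normalised densities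
  bounds the cost by entropies, and \<open>entropy_chain\<close> rewrites each entropy as
  \<open>neg_ln\<close> of the total mass minus a mean of \<open>neg_ln\<close> of the sections.
  Moving these means to the left gives the claim, since the law with density \<open>f / mf\<close>
  is the average of the kernel \<open>p\<close>. The error \<open>e\<close> pays for an infimum that
  need not be attained.\<close>

lemma one_dimensional_step:
  assumes T: "T_inequality \<gamma> c a1 a2 \<mu>" and \<mu>: "\<mu> \<in> Pg" and a: "0 < a1" "0 < a2" and e: "0 < e"
    and f[measurable]: "f \<in> borel_measurable borel" and f01: "\<And>x. 0 \<le> f x" "\<And>x. f x \<le> 1"
    and g[measurable]: "g \<in> borel_measurable borel" and g01: "\<And>x. 0 \<le> g x" "\<And>x. g x \<le> 1"
    and m: "mf = (\<integral>x. f x \<partial>\<mu>)" "mg = (\<integral>x. g x \<partial>\<mu>)" "0 < mg"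
  obtains p where "p \<in> borel \<rightarrow>\<^sub>M P_gamma_algebra \<gamma> borel dist"
    "(\<integral>\<^sup>+z. ennreal (c z (p z)) + a1 * (\<integral>\<^sup>+x. neg_ln (f x) \<partial>p z) + a2 * neg_ln (g z)
        \<partial>density \<mu> (\<lambda>x. ennreal (g x / mg))) \<le> a1 * neg_ln mf + a2 * neg_ln mg + ennreal e"
proof (cases "mf = 0")
  case True
  \<comment> \<open>The right-hand side is infinite, so any kernel will do.\<close>
  show thesis
  proof (rule that)
    show "(\<lambda>_. \<mu>) \<in> borel \<rightarrow>\<^sub>M P_gamma_algebra \<gamma> borel dist"
      using \<mu> PgD(4)[OF \<mu>] by (simp add: kernel_iff)
  qed (use True a in \<open>simp add: neg_ln_def ennreal_mult_top\<close>)
next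
  case False
  interpret prob_space \<mu> using PgD[OF \<mu>] by simp
  have s\<mu>[measurable_cong]: "sets \<mu> = sets borel" using PgD[OF \<mu>] by simp
  have "0 \<le> mf" unfolding m using f01 by (intro Bochner_Integration.integral_nonneg) auto
  then have mf: "0 < mf" using False by simp
  have if_: "integrable \<mu> f" using f01 by (intro integrable_const_bound[of _ 1]) auto
  have ig: "integrable \<mu> g" using g01 by (intro integrable_const_bound[of _ 1]) auto
  have le1: "mf \<le> 1" "mg \<le> 1"
    unfolding m using integral_mono[OF if_, of "\<lambda>_. 1"] integral_mono[OF ig, of "\<lambda>_. 1"] f01 g01 prob_space by auto
  define \<nu>1 where "\<nu>1 = density \<mu> (\<lambda>x. ennreal (f x / mf))"
  define \<nu>2 where "\<nu>2 = density \<mu> (\<lambda>x. ennreal (g x / mg))"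
  have n1: "\<nu>1 \<in> Pg"
    unfolding \<nu>1_def using f01 mf m by (intro density_Pg[OF \<mu>, where b = "1 / mf"]) (auto intro: divide_right_mono)
  have n2: "\<nu>2 \<in> Pg"
    unfolding \<nu>2_def using g01 m by (intro density_Pg[OF \<mu>, where b = "1 / mg"]) (auto intro: divide_right_mono)
  have [measurable_cong]: "sets \<nu>1 = sets borel" "sets \<nu>2 = sets borel" using PgD n1 n2 by auto
  interpret N2: prob_space \<nu>2 using PgD[OF n2] by simp
  have fm: "f \<in> borel_measurable \<mu>" "g \<in> borel_measurable \<mu>" by auto
  obtain h1 e1 where h1: "rel_entropy \<nu>1 \<mu> = ereal h1" "(\<integral>\<^sup>+x. neg_ln (f x) \<partial>\<nu>1) = ennreal e1" "0 \<le> e1" "h1 + e1 = - ln mf"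
    unfolding \<nu>1_def using entropy_chain[OF prob_space_axioms fm(1) f01 m(1) mf] by metis
  obtain h2 e2 where h2: "rel_entropy \<nu>2 \<mu> = ereal h2" "(\<integral>\<^sup>+x. neg_ln (g x) \<partial>\<nu>2) = ennreal e2" "0 \<le> e2" "h2 + e2 = - ln mg"
    unfolding \<nu>2_def using entropy_chain[OF prob_space_axioms fm(2) g01 m(2,3)] by metis
  define h where "h = a1 * h1 + a2 * h2"
  have "transport_cost \<gamma> c \<nu>1 \<nu>2 \<le> ereal h"
    using T n1 n2 h1(1) h2(1) unfolding T_inequality_def h_def by fastforce
  also have "\<dots> < ereal (h + e)" using e by simp
  finally obtain \<pi> p where \<pi>: "\<pi> \<in> couplings \<nu>2 \<nu>1" and p: "p \<in> disintegrations \<gamma> \<nu>2 \<pi>"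
    and less: "enn2ereal (\<integral>\<^sup>+x. ennreal (c x (p x)) \<partial>\<nu>2) < ereal (h + e)"
    unfolding transport_cost_def INF_less_iff by blast
  have cost: "(\<integral>\<^sup>+x. ennreal (c x (p x)) \<partial>\<nu>2) \<le> ennreal (h + e)"
    using e2ennreal_mono[OF less_imp_le[OF less]] by simp
  \<comment> \<open>Read off from the nonnegative cost; it allows \<open>ennreal\<close> to be split
    over the sum below.\<close>
  have "0 \<le> h + e"
    using less by (metis enn2ereal_nonneg ereal_less_eq(5) less_imp_le order_trans)
  have pk: "p \<in> borel \<rightarrow>\<^sub>M P_gamma_algebra \<gamma> borel dist" using p by (simp add: disintegrations_def)
  have pm: "p \<in> borel \<rightarrow>\<^sub>M prob_algebra borel" using pk by (simp add: kernel_iff)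
  have pm2: "p \<in> \<nu>2 \<rightarrow>\<^sub>M prob_algebra borel" using pm by simp
  have pm3: "p \<in> \<nu>2 \<rightarrow>\<^sub>M subprob_algebra borel" using pm2 by (rule measurable_prob_algebraD)
  have [measurable]: "p \<in> borel \<rightarrow>\<^sub>M subprob_algebra borel" using pm by (rule measurable_prob_algebraD)
  \<comment> \<open>The kernel transports \<open>\<nu>2\<close> to \<open>\<nu>1\<close>, so the
    penalty under \<open>\<nu>1\<close> becomes an iterated integral under \<open>\<nu>2\<close> and
    can share one integrand with the cost.\<close>
  have "\<nu>1 = \<nu>2 \<bind> p"
  proof (rule measure_eqI)
    have "sets (\<nu>2 \<bind> p) = sets borel" by (rule sets_bind'[OF PgD(4)[OF n2] pm])
    then show "sets \<nu>1 = sets (\<nu>2 \<bind> p)" by (simp add: PgD[OF n1])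
    fix B assume "B \<in> sets \<nu>1"
    then have B: "B \<in> sets borel" by (simp add: PgD[OF n1])
    show "emeasure \<nu>1 B = emeasure (\<nu>2 \<bind> p) B"
      unfolding emeasure_bind_prob_algebra[OF PgD(4)[OF n2] pm B]
      by (rule disintegration_second_marginal[OF \<pi> p B])
  qed
  then have bind: "(\<integral>\<^sup>+x. neg_ln (f x) \<partial>\<nu>1) = (\<integral>\<^sup>+z. \<integral>\<^sup>+x. neg_ln (f x) \<partial>p z \<partial>\<nu>2)"
    using nn_integral_bind[OF _ pm3, of "\<lambda>x. neg_ln (f x)"] by simp
  have [measurable]: "(\<lambda>z. c z (p z)) \<in> borel_measurable borel" by (rule cost_measurable[OF pk])
  have "(\<integral>\<^sup>+z. ennreal (c z (p z)) + a1 * (\<integral>\<^sup>+x. neg_ln (f x) \<partial>p z) + a2 * neg_ln (g z) \<partial>\<nu>2)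
      = (\<integral>\<^sup>+x. ennreal (c x (p x)) \<partial>\<nu>2) + a1 * ennreal e1 + a2 * ennreal e2"
    using h1(2) h2(2) bind by (simp add: nn_integral_add nn_integral_cmult)
  also have "\<dots> \<le> ennreal (h + e) + a1 * ennreal e1 + a2 * ennreal e2"
    by (intro add_right_mono cost)
  also have "\<dots> = ennreal (a1 * (h1 + e1) + a2 * (h2 + e2) + e)"
  proof -
    have "0 \<le> a1 * e1" "0 \<le> a2 * e2" using a h1(3) h2(3) by auto
    then have "ennreal (h + e) + a1 * ennreal e1 + a2 * ennreal e2 = ennreal (h + e + a1 * e1 + a2 * e2)"
      using a h1(3) h2(3) \<open>0 \<le> h + e\<close> by (simp only: ennreal_plus ennreal_mult add_nonneg_nonneg less_imp_le)
    also have "h + e + a1 * e1 + a2 * e2 = a1 * (h1 + e1) + a2 * (h2 + e2) + e"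
      by (simp add: h_def algebra_simps)
    finally show ?thesis .
  qed
  also have "\<dots> = a1 * neg_ln mf + a2 * neg_ln mg + ennreal e"
  proof -
    have "0 \<le> - ln mf" "0 \<le> - ln mg" using mf m(3) le1 by auto
    then have "ennreal (a1 * (- ln mf) + a2 * (- ln mg) + e) = a1 * ennreal (- ln mf) + a2 * ennreal (- ln mg) + ennreal e"
      using a e by (simp only: ennreal_plus ennreal_mult mult_nonneg_nonneg add_nonneg_nonneg less_imp_le)
    then show ?thesis using mf m(3) by (simp add: h1(4) h2(4) neg_ln_def)
  qed
  finally show thesis using that[OF pk] unfolding \<nu>2_def by blast
qed

end

section \<open>Mixtures of couplings along a coordinate\<close>

lemma integral_finite_range:
  fixes h :: "nat \<Rightarrow> real"
  assumes "prob_space p" and \<kappa>[measurable]: "\<kappa> \<in> p \<rightarrow>\<^sub>M count_space UNIV" and fin: "finite (range \<kappa>)"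
  shows "integrable p (\<lambda>x. h (\<kappa> x))"
    "(\<integral>x. h (\<kappa> x) \<partial>p) = (\<Sum>l\<in>range \<kappa>. measure p {x\<in>space p. \<kappa> x = l} * h l)"
proof -
  interpret prob_space p by fact
  have eq: "h (\<kappa> x) = (\<Sum>l\<in>range \<kappa>. indicator {x\<in>space p. \<kappa> x = l} x * h l)" if "x \<in> space p" for x
  proof -
    have "(\<Sum>l\<in>range \<kappa>. indicator {x\<in>space p. \<kappa> x = l} x * h l) = (\<Sum>l\<in>{\<kappa> x}. indicator {x\<in>space p. \<kappa> x = l} x * h l)"
      using fin that by (intro sum.mono_neutral_right) auto
    then show ?thesis using that by simp
  qed
  have i: "integrable p (\<lambda>x. indicator {x\<in>space p. \<kappa> x = l} x * h l)" for l
    by (intro integrable_mult_left integrable_real_indicator) (auto simp: less_top[symmetric])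
  show "integrable p (\<lambda>x. h (\<kappa> x))"
    by (subst Bochner_Integration.integrable_cong[OF refl eq]) (use i in auto)
  show "(\<integral>x. h (\<kappa> x) \<partial>p) = (\<Sum>l\<in>range \<kappa>. measure p {x\<in>space p. \<kappa> x = l} * h l)"
    by (subst Bochner_Integration.integral_cong[OF refl eq])
       (use i in \<open>auto simp: Bochner_Integration.integral_sum\<close>)
qed

text \<open>Nonnegative functions are handled by the nonnegative integral of a bind, signed ones by
  their positive and negative parts. Finitely many kernels occur, so integrability against each of
  them suffices.\<close>

lemma integral_bind_finite_range:
  fixes f :: "'b \<Rightarrow> real"
  assumes p: "p \<in> space (prob_algebra M)" and \<kappa>[measurable]: "\<kappa> \<in> M \<rightarrow>\<^sub>M count_space UNIV" and fin: "finite (range \<kappa>)"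
    and k: "\<And>l :: nat. k l \<in> space (prob_algebra N)" and f[measurable]: "f \<in> borel_measurable N"
    and int: "\<And>l. integrable (k l) f"
  shows "(\<integral>x. f x \<partial>(p \<bind> (\<lambda>x. k (\<kappa> x)))) = (\<Sum>l\<in>range \<kappa>. measure p {x\<in>space p. \<kappa> x = l} * (\<integral>x. f x \<partial>k l))"
proof -
  interpret prob_space p using p by (simp add: space_prob_algebra)
  have [measurable_cong]: "sets p = sets M" using p by (simp add: space_prob_algebra)
  have km: "(\<lambda>x. k (\<kappa> x)) \<in> M \<rightarrow>\<^sub>M prob_algebra N"
    by (rule measurable_compose[OF \<kappa>]) (use k in simp)
  have km': "(\<lambda>x. k (\<kappa> x)) \<in> p \<rightarrow>\<^sub>M subprob_algebra N" using measurable_prob_algebraD[OF km] by simp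
  have \<kappa>p: "\<kappa> \<in> p \<rightarrow>\<^sub>M count_space UNIV" by simp
  have sb: "sets (p \<bind> (\<lambda>x. k (\<kappa> x))) = sets N" by (rule sets_bind'[OF p km])
  have pos: "has_bochner_integral (p \<bind> (\<lambda>x. k (\<kappa> x))) g
      (\<Sum>l\<in>range \<kappa>. measure p {x\<in>space p. \<kappa> x = l} * (\<integral>x. g x \<partial>k l))"
    if [measurable]: "g \<in> borel_measurable N" and g: "\<And>x. 0 \<le> g x" "\<And>l. integrable (k l) g" for g :: "'b \<Rightarrow> real"
  proof (rule has_bochner_integral_nn_integral)
    show "g \<in> borel_measurable (p \<bind> (\<lambda>x. k (\<kappa> x)))" by (simp add: measurable_cong_sets[OF sb refl])
    show "0 \<le> (\<Sum>l\<in>range \<kappa>. measure p {x\<in>space p. \<kappa> x = l} * (\<integral>x. g x \<partial>k l))"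
      using g by (intro sum_nonneg mult_nonneg_nonneg Bochner_Integration.integral_nonneg) auto
    have "(\<integral>\<^sup>+x. ennreal (g x) \<partial>(p \<bind> (\<lambda>x. k (\<kappa> x)))) = (\<integral>\<^sup>+x. \<integral>\<^sup>+y. ennreal (g y) \<partial>k (\<kappa> x) \<partial>p)"
      by (rule nn_integral_bind[OF _ km']) simp
    also have "\<dots> = (\<integral>\<^sup>+x. ennreal (\<integral>y. g y \<partial>k (\<kappa> x)) \<partial>p)"
      using g by (intro nn_integral_cong nn_integral_eq_integral) auto
    also have "\<dots> = ennreal (\<integral>x. (\<integral>y. g y \<partial>k (\<kappa> x)) \<partial>p)"
      using g integral_finite_range(1)[OF prob_space_axioms \<kappa>p fin, of "\<lambda>l. \<integral>y. g y \<partial>k l"]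
      by (intro nn_integral_eq_integral) (auto intro!: Bochner_Integration.integral_nonneg)
    also have "(\<integral>x. (\<integral>y. g y \<partial>k (\<kappa> x)) \<partial>p) = (\<Sum>l\<in>range \<kappa>. measure p {x\<in>space p. \<kappa> x = l} * (\<integral>x. g x \<partial>k l))"
      by (rule integral_finite_range(2)[OF prob_space_axioms \<kappa>p fin])
    finally show "(\<integral>\<^sup>+x. ennreal (g x) \<partial>(p \<bind> (\<lambda>x. k (\<kappa> x)))) =
      ennreal (\<Sum>l\<in>range \<kappa>. measure p {x\<in>space p. \<kappa> x = l} * (\<integral>x. g x \<partial>k l))" .
  qed (use g in auto)
  let ?f1 = "\<lambda>x. max (f x) 0" and ?f2 = "\<lambda>x. max (- f x) 0"
  have i12: "integrable (k l) ?f1" "integrable (k l) ?f2" for l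
    using int[of l] by (auto intro!: integrable_max)
  have "has_bochner_integral (p \<bind> (\<lambda>x. k (\<kappa> x))) (\<lambda>x. ?f1 x - ?f2 x)
     ((\<Sum>l\<in>range \<kappa>. measure p {x\<in>space p. \<kappa> x = l} * (\<integral>x. ?f1 x \<partial>k l)) -
      (\<Sum>l\<in>range \<kappa>. measure p {x\<in>space p. \<kappa> x = l} * (\<integral>x. ?f2 x \<partial>k l)))"
    using i12 by (intro has_bochner_integral_diff pos) auto
  from has_bochner_integral_integral_eq[OF this]
  have "(\<integral>x. ?f1 x - ?f2 x \<partial>(p \<bind> (\<lambda>x. k (\<kappa> x)))) =
     ((\<Sum>l\<in>range \<kappa>. measure p {x\<in>space p. \<kappa> x = l} * (\<integral>x. ?f1 x \<partial>k l)) -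
      (\<Sum>l\<in>range \<kappa>. measure p {x\<in>space p. \<kappa> x = l} * (\<integral>x. ?f2 x \<partial>k l)))"
    .
  also have "(\<integral>x. ?f1 x - ?f2 x \<partial>(p \<bind> (\<lambda>x. k (\<kappa> x)))) = (\<integral>x. f x \<partial>(p \<bind> (\<lambda>x. k (\<kappa> x))))"
    by (rule Bochner_Integration.integral_cong) (auto simp: max_def)
  also have "(\<Sum>l\<in>range \<kappa>. measure p {x\<in>space p. \<kappa> x = l} * (\<integral>x. ?f1 x \<partial>k l)) -
      (\<Sum>l\<in>range \<kappa>. measure p {x\<in>space p. \<kappa> x = l} * (\<integral>x. ?f2 x \<partial>k l)) = (\<Sum>l\<in>range \<kappa>. measure p {x\<in>space p. \<kappa> x = l} * ((\<integral>x. ?f1 x \<partial>k l) - (\<integral>x. ?f2 x \<partial>k l)))"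
    by (simp add: sum_subtractf right_diff_distrib)
  also have "\<dots> = (\<Sum>l\<in>range \<kappa>. measure p {x\<in>space p. \<kappa> x = l} * (\<integral>x. f x \<partial>k l))"
  proof -
    have "(\<integral>x. ?f1 x \<partial>k l) - (\<integral>x. ?f2 x \<partial>k l) = (\<integral>x. f x \<partial>k l)" for l
      unfolding Bochner_Integration.integral_diff[OF i12, symmetric]
      by (rule Bochner_Integration.integral_cong) (auto simp: max_def)
    then show ?thesis by simp
  qed
  finally show ?thesis .
qed

text \<open>The section at the last coordinate: index \<open>n\<close> is fixed, so the rest is
  again a point of the carrier of \<open>Xn n\<close>.\<close>

definition slice :: "nat \<Rightarrow> (nat \<Rightarrow> 'a::topological_space) set \<Rightarrow> 'a \<Rightarrow> (nat \<Rightarrow> 'a) set" where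
  "slice n A z = {y \<in> space (Xn n). y(n := z) \<in> A}"

text \<open>Unions of product cells of the partition of the space by \<kappa>. Slices of such a set
  depend on \<open>z\<close> through \<open>\<kappa> z\<close> only, so choices made slice by slice
  reduce to choices made label by label.\<close>

definition saturated :: "('a::topological_space \<Rightarrow> nat) \<Rightarrow> nat \<Rightarrow> (nat \<Rightarrow> 'a) set \<Rightarrow> bool" where
  "saturated \<kappa> n A \<longleftrightarrow> (\<forall>x\<in>A. \<forall>x'\<in>space (Xn n). (\<forall>i<n. \<kappa> (x i) = \<kappa> (x' i)) \<longrightarrow> x' \<in> A)"

lemma fun_upd_space_Xn: "y \<in> space (Xn n) \<Longrightarrow> y(n := z) \<in> space (Xn (Suc n))"
  by (auto simp: space_Xn PiE_iff extensional_def)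

lemma measurable_fun_upd_Xn [measurable]:
  "(\<lambda>(z, y). y(n := z)) \<in> borel \<Otimes>\<^sub>M Xn n \<rightarrow>\<^sub>M Xn (Suc n)"
  unfolding Xn_def lessThan_Suc
  using measurable_compose[OF measurable_pair_swap' measurable_add_dim[of n "{..<n}" "\<lambda>_. borel"]]
  by (simp add: case_prod_beta')

lemma measurable_fun_upd_Xn2 [measurable]: "(\<lambda>y. y(n := z)) \<in> Xn n \<rightarrow>\<^sub>M Xn (Suc n)"
  using measurable_compose[OF measurable_Pair1' measurable_fun_upd_Xn, of z n] by simp

lemma slice_measurable: "A \<in> sets (Xn (Suc n)) \<Longrightarrow> slice n A z \<in> sets (Xn n)"
  using measurable_sets[OF measurable_fun_upd_Xn2, of A n z]
  by (simp add: slice_def vimage_def Int_def conj_commute)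

lemma slice_cong:
  assumes "saturated \<kappa> (Suc n) A" "A \<subseteq> space (Xn (Suc n))" "\<kappa> z = \<kappa> z'"
  shows "slice n A z = slice n A z'"
proof -
  have "y(n := z') \<in> A" if "y(n := z) \<in> A" "y \<in> space (Xn n)" "\<kappa> z = \<kappa> z'" for y z z'
    using assms(1) that fun_upd_space_Xn[of y n z'] unfolding saturated_def by fastforce
  from this[of _ z z'] this[of _ z' z] show ?thesis using assms(3) by (auto simp: slice_def)
qed

lemma saturated_slice:
  assumes "saturated \<kappa> (Suc n) A"
  shows "saturated \<kappa> n (slice n A z)"
  unfolding saturated_def
proof (intro ballI impI)
  fix x x' assume x: "x \<in> slice n A z" and x': "x' \<in> space (Xn n)" and eq: "\<forall>i<n. \<kappa> (x i) = \<kappa> (x' i)"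
  have "\<forall>i<Suc n. \<kappa> ((x(n := z)) i) = \<kappa> ((x'(n := z)) i)" using eq by (auto simp: less_Suc_eq)
  moreover have "x(n := z) \<in> A" using x by (simp add: slice_def)
  ultimately have "x'(n := z) \<in> A"
    using assms fun_upd_space_Xn[OF x'] unfolding saturated_def by blast
  then show "x' \<in> slice n A z" using x' by (simp add: slice_def)
qed

context transport_setting
begin

text \<open>Only the marginals enter \<open>cost_n\<close>, and the condition on them passes to
  mixtures directly. The joint \<gamma>-moment demanded by \<open>P_gamma\<close> is recovered at
  the very end, for the limit measure.\<close>

definition admissible :: "nat \<Rightarrow> (nat \<Rightarrow> 'a) measure set" where
  "admissible n = {q \<in> space (prob_algebra (Xn n)). \<forall>i<n. marginal i q \<in> Pg}"

text \<open>A counterpart of \<open>cost_to_set\<close> that can be integrated over slices. The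
  infimum over no measures is \<infinity>, which is the right value for an empty slice.\<close>

definition set_cost :: "nat \<Rightarrow> (nat \<Rightarrow> 'a) set \<Rightarrow> (nat \<Rightarrow> 'a) \<Rightarrow> ennreal" where
  "set_cost n A y = (INF q\<in>{q \<in> admissible n. emeasure q A = 1}. ennreal (cost_n c n y q))"

lemma cost_n_nonneg: "q \<in> admissible n \<Longrightarrow> 0 \<le> cost_n c n y q"
  by (auto simp: cost_n_def admissible_def intro!: sum_nonneg c_nonneg)

lemma return_admissible:
  assumes "y \<in> space (Xn n)"
  shows "return (Xn n) y \<in> admissible n"
proof -
  have "marginal i (return (Xn n) y) = return borel (y i)" if "i < n" for i
    unfolding marginal_def using assms that
    by (intro distr_return) (auto simp: Xn_def)
  then show ?thesis using assms return_Pg by (auto simp: admissible_def space_prob_algebra prob_space_return)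
qed

text \<open>Gluing: draw the last coordinate \<open>x\<close> from \<open>p\<close>, then the others
  from a nearly optimal measure on the slice at \<open>x\<close>. The last marginal is
  \<open>p\<close> and costs \<open>c z p\<close>; each other marginal is a mixture, whose cost
  convexity bounds by the average cost. One measure per label is enough, which makes the dependence
  on \<open>x\<close> measurable.\<close>

lemma set_cost_Suc:
  assumes \<kappa>: "\<kappa> \<in> borel \<rightarrow>\<^sub>M count_space UNIV" "finite (range \<kappa>)"
    and A: "A \<in> sets (Xn (Suc n))" "saturated \<kappa> (Suc n) A" and p: "p \<in> Pg"
  shows "set_cost (Suc n) A (y(n := z)) \<le> ennreal (c z p) + (\<integral>\<^sup>+x. set_cost n (slice n A x) y \<partial>p)"
proof (cases "(\<integral>\<^sup>+x. set_cost n (slice n A x) y \<partial>p) < \<infinity>")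
  case fin: True
  note \<kappa>(1)[measurable]
  interpret p: prob_space p using PgD[OF p] by simp
  have sp[measurable_cong]: "sets p = sets borel" and spp: "space p = UNIV" using PgD[OF p] by auto
  \<comment> \<open>\<open>inv_into\<close> picks a representative of the cell; by saturation the
    slice does not depend on it.\<close>
  define D where "D l = slice n A (inv_into UNIV \<kappa> l)" for l
  have AX: "A \<subseteq> space (Xn (Suc n))" using sets.sets_into_space[OF A(1)] .
  have D: "slice n A x = D (\<kappa> x)" for x
    unfolding D_def by (rule slice_cong[OF A(2) AX]) (simp add: f_inv_into_f)
  show ?thesis
  proof (rule ennreal_le_epsilon)
    fix e :: real assume e: "0 < e"
    have "\<exists>q\<in>admissible n. set_cost n (D l) y < \<infinity> \<longrightarrow>
        emeasure q (D l) = 1 \<and> ennreal (cost_n c n y q) \<le> set_cost n (D l) y + ennreal e" for l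
    proof (cases "set_cost n (D l) y < \<infinity>")
      case True
      then have "set_cost n (D l) y < set_cost n (D l) y + ennreal e"
        using e by (cases "set_cost n (D l) y") (auto simp: ennreal_less_iff simp flip: ennreal_plus)
      then show ?thesis unfolding set_cost_def[of n "D l"] INF_less_iff by (auto intro: less_imp_le)
    next
      case False
      \<comment> \<open>A default for labels whose slice has infinite cost. These carry no
        \<open>p\<close>-mass, because the integral of the slice costs is finite.\<close>
      have "(\<lambda>i. if i < n then undefined else undefined) \<in> space (Xn n)" by (auto simp: space_Xn)
      then show ?thesis using False return_admissible by blast
    qed
    then obtain q where q: "\<And>l. q l \<in> admissible n"
      and qD: "\<And>l. set_cost n (D l) y < \<infinity> \<Longrightarrow> emeasure (q l) (D l) = 1"
      and qc: "\<And>l. set_cost n (D l) y < \<infinity> \<Longrightarrow> ennreal (cost_n c n y (q l)) \<le> set_cost n (D l) y + ennreal e"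
      by metis
    have qp: "q l \<in> space (prob_algebra (Xn n))" for l using q by (simp add: admissible_def)
    have qm[measurable]: "(\<lambda>x. q (\<kappa> x)) \<in> borel \<rightarrow>\<^sub>M prob_algebra (Xn n)"
      by (rule measurable_compose[OF \<kappa>(1)]) (use qp in simp)
    have sq[measurable_cong]: "sets (q l) = sets (Xn n)" for l using qp[of l] by (simp add: space_prob_algebra)
    have pq: "prob_space (q l)" for l using qp[of l] by (simp add: space_prob_algebra)
    define K where "K x = distr (q (\<kappa> x)) (Xn (Suc n)) (\<lambda>y'. y'(n := x))" for x
    have K: "K \<in> borel \<rightarrow>\<^sub>M prob_algebra (Xn (Suc n))"
      unfolding K_def by (rule measurable_distr_prob_space2[OF qm]) simp
    have Kp: "K \<in> p \<rightarrow>\<^sub>M subprob_algebra (Xn (Suc n))" using measurable_prob_algebraD[OF K] by simp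
    define m where "m = p \<bind> K"
    have m: "m \<in> space (prob_algebra (Xn (Suc n)))"
      unfolding m_def using prob_space_bind'[OF PgD(4)[OF p] K] sets_bind'[OF PgD(4)[OF p] K]
      by (simp add: space_prob_algebra)
    have marg: "marginal i m = p \<bind> (\<lambda>x. distr (q (\<kappa> x)) borel (\<lambda>y'. (y'(n := x)) i))" if "i < Suc n" for i
    proof -
      have [measurable]: "(\<lambda>y'. y' i) \<in> Xn (Suc n) \<rightarrow>\<^sub>M borel"
        unfolding Xn_def by (rule measurable_component_singleton) (use that in simp)
      have "marginal i m = p \<bind> (\<lambda>x. distr (K x) borel (\<lambda>y'. y' i))"
        unfolding marginal_def m_def by (rule distr_bind[OF Kp]) (auto simp: spp)
      also have "\<dots> = p \<bind> (\<lambda>x. distr (q (\<kappa> x)) borel (\<lambda>y'. (y'(n := x)) i))"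
        unfolding K_def by (subst distr_distr) (auto simp: comp_def)
      finally show ?thesis .
    qed
    have mn: "marginal n m = p"
    proof -
      have "marginal n m = p \<bind> (\<lambda>x. return borel x)"
        unfolding marg[OF lessI] by (simp add: prob_space.distr_const[OF pq])
      also have "\<dots> = p" by (rule bind_return''[OF sp])
      finally show ?thesis .
    qed
    have mi: "marginal i m = p \<bind> (\<lambda>x. marginal i (q (\<kappa> x)))" if "i < n" for i
      using marg[of i] that by (simp add: marginal_def)
    have qi: "marginal i (q l) \<in> Pg" if "i < n" for i l using q[of l] that by (simp add: admissible_def)
    have miP: "marginal i m \<in> Pg" if i: "i < n" for i
    proof (rule PgI)
      have k: "(\<lambda>x. marginal i (q (\<kappa> x))) \<in> borel \<rightarrow>\<^sub>M prob_algebra borel"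
        by (rule measurable_compose[OF \<kappa>(1)]) (use PgD(4)[OF qi[OF i]] in simp)
      show "prob_space (marginal i m)" "sets (marginal i m) = sets borel"
        unfolding mi[OF i] using prob_space_bind'[OF PgD(4)[OF p] k] sets_bind'[OF PgD(4)[OF p] k] by auto
      fix x0
      let ?G = "\<lambda>l. \<integral>\<^sup>+x. ennreal (\<gamma> (dist x x0)) \<partial>marginal i (q l)"
      have "(\<integral>\<^sup>+x. ennreal (\<gamma> (dist x x0)) \<partial>marginal i m) = (\<integral>\<^sup>+x. ?G (\<kappa> x) \<partial>p)"
        unfolding mi[OF i] by (rule nn_integral_bind[where B = borel]) (use measurable_prob_algebraD[OF k] in auto)
      also have "\<dots> \<le> (\<integral>\<^sup>+x. (\<Sum>l\<in>range \<kappa>. ?G l) \<partial>p)"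
        using \<kappa>(2) by (intro nn_integral_mono) (auto intro!: sum_nonneg member_le_sum)
      also have "\<dots> = (\<Sum>l\<in>range \<kappa>. ?G l)" by (simp add: p.emeasure_space_1)
      also have "\<dots> < \<infinity>" using PgD(5)[OF qi[OF i]] \<kappa>(2) by (simp add: less_top[symmetric])
      finally show "(\<integral>\<^sup>+x. ennreal (\<gamma> (dist x x0)) \<partial>marginal i m) < \<infinity>" .
    qed
    have adm: "m \<in> admissible (Suc n)"
      using m mn miP p by (auto simp: admissible_def less_Suc_eq)
    have "emeasure m A = (\<integral>\<^sup>+x. emeasure (K x) A \<partial>p)"
      unfolding m_def by (rule emeasure_bind_prob_algebra[OF PgD(4)[OF p] K A(1)])
    also have "\<dots> = (\<integral>\<^sup>+x. 1 \<partial>p)"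
    proof (rule nn_integral_cong_AE)
      have "(\<lambda>x. set_cost n (D (\<kappa> x)) y) \<in> borel_measurable p" by simp
      then have "AE x in p. set_cost n (D (\<kappa> x)) y \<noteq> \<infinity>"
        by (rule nn_integral_PInf_AE) (use fin D in auto)
      then show "AE x in p. emeasure (K x) A = 1"
      proof eventually_elim
        case (elim x)
        have "emeasure (K x) A = emeasure (q (\<kappa> x)) ((\<lambda>y'. y'(n := x)) -` A \<inter> space (q (\<kappa> x)))"
          unfolding K_def using A by (intro emeasure_distr) auto
        also have "(\<lambda>y'. y'(n := x)) -` A \<inter> space (q (\<kappa> x)) = D (\<kappa> x)"
          unfolding D[symmetric] slice_def using sets_eq_imp_space_eq[OF sq] by auto
        also have "emeasure (q (\<kappa> x)) (D (\<kappa> x)) = 1" using elim qD by (simp add: less_top)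
        finally show ?case .
      qed
    qed
    also have "\<dots> = 1" by (simp add: p.emeasure_space_1)
    finally have mA: "emeasure m A = 1" .
    let ?w = "\<lambda>l. measure p {x\<in>space p. \<kappa> x = l}"
    have \<kappa>p: "\<kappa> \<in> p \<rightarrow>\<^sub>M count_space UNIV" by simp
    have w1: "(\<Sum>l\<in>range \<kappa>. ?w l) = 1"
      using integral_finite_range(2)[OF p.prob_space_axioms \<kappa>p \<kappa>(2), of "\<lambda>_. 1"] p.prob_space by simp
    \<comment> \<open>By \<open>mi\<close>, the marginal is the mixture of the marginals of the
      \<open>q l\<close> with weights \<open>?w l\<close>, so convexity of the cost applies.\<close>
    have conv: "c (y i) (marginal i m) \<le> (\<Sum>l\<in>range \<kappa>. ?w l * c (y i) (marginal i (q l)))" if i: "i < n" for i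
    proof (rule cost_finite_mixture[OF miP[OF i] qi[OF i] _ w1])
      fix \<phi> :: "'a \<Rightarrow> real" assume \<phi>: "\<phi> \<in> Phi_gamma \<gamma> borel dist"
      show "(\<integral>x. \<phi> x \<partial>marginal i m) = (\<Sum>l\<in>range \<kappa>. ?w l * (\<integral>x. \<phi> x \<partial>marginal i (q l)))"
        unfolding mi[OF i]
        using borel_measurable_continuous_onI[OF Phi_continuous[OF \<phi>]] Phi_integrable[OF \<phi> qi[OF i]]
        by (intro integral_bind_finite_range[OF PgD(4)[OF p] \<kappa> PgD(4)[OF qi[OF i]]]) auto
    qed auto
    have "cost_n c (Suc n) (y(n := z)) m = c z p + (\<Sum>i<n. c (y i) (marginal i m))"
      unfolding cost_n_def by (simp add: mn)
    also have "\<dots> \<le> c z p + (\<Sum>i<n. \<Sum>l\<in>range \<kappa>. ?w l * c (y i) (marginal i (q l)))"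
      by (intro add_left_mono sum_mono conv) auto
    also have "(\<Sum>i<n. \<Sum>l\<in>range \<kappa>. ?w l * c (y i) (marginal i (q l))) = (\<Sum>l\<in>range \<kappa>. ?w l * cost_n c n y (q l))"
      unfolding cost_n_def by (subst sum.swap) (simp add: sum_distrib_left)
    also have "\<dots> = (\<integral>x. cost_n c n y (q (\<kappa> x)) \<partial>p)"
      by (rule integral_finite_range(2)[OF p.prob_space_axioms \<kappa>p \<kappa>(2), symmetric])
    finally have "cost_n c (Suc n) (y(n := z)) m \<le> c z p + (\<integral>x. cost_n c n y (q (\<kappa> x)) \<partial>p)" .
    then have "ennreal (cost_n c (Suc n) (y(n := z)) m) \<le> ennreal (c z p) + ennreal (\<integral>x. cost_n c n y (q (\<kappa> x)) \<partial>p)"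
      using c_nonneg[OF p] by (simp add: ennreal_leI Bochner_Integration.integral_nonneg cost_n_nonneg q flip: ennreal_plus)
    also have "ennreal (\<integral>x. cost_n c n y (q (\<kappa> x)) \<partial>p) = (\<integral>\<^sup>+x. ennreal (cost_n c n y (q (\<kappa> x))) \<partial>p)"
      using integral_finite_range(1)[OF p.prob_space_axioms \<kappa>p \<kappa>(2), of "\<lambda>l. cost_n c n y (q l)"]
      by (intro nn_integral_eq_integral[symmetric]) (auto simp: cost_n_nonneg q)
    also have "\<dots> \<le> (\<integral>\<^sup>+x. set_cost n (D (\<kappa> x)) y + ennreal e \<partial>p)"
    proof (rule nn_integral_mono)
      fix x show "ennreal (cost_n c n y (q (\<kappa> x))) \<le> set_cost n (D (\<kappa> x)) y + ennreal e"
        using qc[of "\<kappa> x"] by (cases "set_cost n (D (\<kappa> x)) y < \<infinity>") (auto simp: less_top[symmetric])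
    qed
    also have "\<dots> = (\<integral>\<^sup>+x. set_cost n (slice n A x) y \<partial>p) + ennreal e"
      unfolding D by (subst nn_integral_add) (auto simp: p.emeasure_space_1)
    finally have *: "ennreal (cost_n c (Suc n) (y(n := z)) m) \<le> ennreal (c z p) + ((\<integral>\<^sup>+x. set_cost n (slice n A x) y \<partial>p) + ennreal e)"
      by (simp add: add_left_mono del: fun_upd_apply)
    have "set_cost (Suc n) A (y(n := z)) \<le> ennreal (cost_n c (Suc n) (y(n := z)) m)"
      unfolding set_cost_def using adm mA by (intro INF_lower) auto
    also note *
    finally show "set_cost (Suc n) A (y(n := z)) \<le> ennreal (c z p) + (\<integral>\<^sup>+x. set_cost n (slice n A x) y \<partial>p) + ennreal e"
      by (simp only: add.assoc)
  qed
qed (simp add: less_top[symmetric])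

end

section \<open>Induction over the coordinates\<close>

lemma sets_power_measure: "sets \<mu> = sets borel \<Longrightarrow> sets (power_measure n \<mu>) = sets (Xn n)"
  unfolding Xn_def by (rule sets_PiM_cong) auto

lemma prob_space_power_measure: "prob_space \<mu> \<Longrightarrow> prob_space (power_measure n \<mu>)"
  by (rule prob_space_PiM)

text \<open>Fubini in the last coordinate; it supplies the functions and masses to which the
  one-dimensional step is applied.\<close>

lemma measure_slice:
  fixes \<mu> :: "'a::topological_space measure"
  assumes \<mu>: "prob_space \<mu>" "sets \<mu> = sets borel" and A: "A \<in> sets (Xn (Suc n))"
  shows "(\<lambda>x. measure (power_measure n \<mu>) (slice n A x)) \<in> borel_measurable borel"
    "(\<integral>x. measure (power_measure n \<mu>) (slice n A x) \<partial>\<mu>) = measure (power_measure (Suc n) \<mu>) A"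
proof -
  interpret prob_space \<mu> by fact
  interpret product_sigma_finite "\<lambda>_ :: nat. \<mu>" ..
  interpret P: prob_space "power_measure n \<mu>" by (rule prob_space_power_measure[OF \<mu>(1)])
  interpret S: prob_space "power_measure (Suc n) \<mu>" by (rule prob_space_power_measure[OF \<mu>(1)])
  note [measurable_cong] = \<mu>(2) sets_power_measure[OF \<mu>(2)]
  have sp: "space (power_measure k \<mu>) = space (Xn k)" for k
    by (rule sets_eq_imp_space_eq) (rule sets_power_measure[OF \<mu>(2)])
  define Q where "Q = (\<lambda>(z, y). y(n := z)) -` A \<inter> space (borel \<Otimes>\<^sub>M Xn n)"
  have Q: "Q \<in> sets (borel \<Otimes>\<^sub>M power_measure n \<mu>)"
    unfolding Q_def using measurable_sets[OF measurable_fun_upd_Xn A]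
    by (simp add: sets_pair_measure_cong[OF refl sets_power_measure[OF \<mu>(2)]])
  have PQ: "Pair x -` Q = slice n A x" for x
    by (auto simp: Q_def slice_def space_pair_measure)
  have em: "(\<lambda>x. emeasure (power_measure n \<mu>) (slice n A x)) \<in> borel_measurable borel"
    using P.measurable_emeasure_Pair[OF Q] by (simp add: PQ)
  then show m: "(\<lambda>x. measure (power_measure n \<mu>) (slice n A x)) \<in> borel_measurable borel"
    unfolding measure_def by measurable
  have A': "A \<in> sets (power_measure (Suc n) \<mu>)" using A sets_power_measure[OF \<mu>(2)] by blast
  have "emeasure (power_measure (Suc n) \<mu>) A = (\<integral>\<^sup>+x. indicator A x \<partial>(\<Pi>\<^sub>M i\<in>insert n {..<n}. \<mu>))"
    using A' by (simp add: lessThan_Suc)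
  also have "\<dots> = (\<integral>\<^sup>+z. \<integral>\<^sup>+y. indicator A (y(n := z)) \<partial>power_measure n \<mu> \<partial>\<mu>)"
    using A' by (intro product_nn_integral_insert_rev) (auto simp: lessThan_Suc)
  also have "\<dots> = (\<integral>\<^sup>+z. emeasure (power_measure n \<mu>) (slice n A z) \<partial>\<mu>)"
  proof (rule nn_integral_cong)
    fix z
    have "(\<integral>\<^sup>+y. indicator A (y(n := z)) \<partial>power_measure n \<mu>) = (\<integral>\<^sup>+y. indicator (slice n A z) y \<partial>power_measure n \<mu>)"
      by (rule nn_integral_cong) (auto simp: slice_def sp indicator_def)
    then show "(\<integral>\<^sup>+y. indicator A (y(n := z)) \<partial>power_measure n \<mu>) = emeasure (power_measure n \<mu>) (slice n A z)"
      using slice_measurable[OF A, of z] by (simp add: sets_power_measure[OF \<mu>(2)])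
  qed
  also have "\<dots> = (\<integral>\<^sup>+z. ennreal (measure (power_measure n \<mu>) (slice n A z)) \<partial>\<mu>)"
    by (simp add: P.emeasure_eq_measure)
  also have "\<dots> = ennreal (\<integral>z. measure (power_measure n \<mu>) (slice n A z) \<partial>\<mu>)"
    using m P.prob_le_1 by (intro nn_integral_eq_integral integrable_const_bound[of _ 1]) auto
  finally show "(\<integral>x. measure (power_measure n \<mu>) (slice n A x) \<partial>\<mu>) = measure (power_measure (Suc n) \<mu>) A"
    by (simp add: S.emeasure_eq_measure Bochner_Integration.integral_nonneg)
qed

text \<open>The points of mass zero form a countable union of null sets, so the measure lives on its
  atoms.\<close>

lemma ex_pmf_of_prob_space:
  fixes M :: "'b::countable measure"
  assumes "prob_space M" "sets M = UNIV"
  obtains Q where "measure_pmf Q = M"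
proof -
  interpret prob_space M by fact
  have "{x} \<in> null_sets M" if "measure M {x} = 0" for x
    using that assms(2) by (simp add: null_sets_def emeasure_eq_measure)
  then have "(\<Union>x\<in>{x. measure M {x} = 0}. {x}) \<in> null_sets M"
    by (intro null_sets_UN') auto
  then have "AE x in M. measure M {x} \<noteq> 0"
    by (rule AE_I') auto
  with assms that[of "Abs_pmf M"] show thesis by (simp add: Abs_pmf_inverse)
qed

lemma liminf_add_const_ennreal:
  fixes u :: "nat \<Rightarrow> ennreal"
  shows "liminf (\<lambda>k. u k + b) = liminf u + b"
  by (rule Liminf_compose_continuous_mono)
     (auto intro!: continuous_on_add_ennreal continuous_on_id continuous_on_const monoI add_right_mono)

text \<open>Turns an averaged inequality into a point that satisfies it; the induction picks each
  coordinate in this way.\<close>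

lemma (in prob_space) ex_le_of_nn_integral_le:
  assumes f: "f \<in> borel_measurable M" and le: "(\<integral>\<^sup>+x. f x \<partial>M) \<le> b" and b: "b < \<infinity>"
  shows "\<exists>x\<in>space M. f x \<le> b"
proof (rule ccontr)
  assume "\<not> (\<exists>x\<in>space M. f x \<le> b)"
  then have gt: "b < f x" if "x \<in> space M" for x using that by auto
  have "(\<integral>\<^sup>+x. f x - b \<partial>M) + b = (\<integral>\<^sup>+x. (f x - b) + b \<partial>M)"
    using f by (subst nn_integral_add) (auto simp: emeasure_space_1)
  also have "\<dots> = (\<integral>\<^sup>+x. f x \<partial>M)"
    by (intro nn_integral_cong diff_add_cancel_ennreal less_imp_le gt)
  finally have "(\<integral>\<^sup>+x. f x - b \<partial>M) + b \<le> 0 + b" using le by simp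
  then have "(\<integral>\<^sup>+x. f x - b \<partial>M) = 0"
    using b by (metis add.commute ennreal_add_left_cancel_le le_zero_eq less_irrefl infinity_ennreal_def)
  then have "AE x in M. f x - b = 0"
    using f by (subst (asm) nn_integral_0_iff_AE) auto
  then have "AE x in M. False"
    using AE_space
  proof eventually_elim
    case (elim x)
    then show ?case using gt[of x] by (auto simp: diff_eq_0_iff_ennreal not_le[symmetric])
  qed
  then show False using AE_False by simp
qed

context transport_setting
begin

text \<open>The form that survives the induction. \<open>W k\<close> is a random set, since fixing
  the last coordinate \<open>z\<close> replaces \<open>A\<close> by its slice at a random point
  drawn from the kernel at \<open>z\<close>; \<open>C k\<close> collects the cost already paid. The
  lower limit in \<open>k\<close> lets one point of \<open>B\<close> serve all partitions. Half of
  \<open>e\<close> is spent on the last coordinate and half on the others.\<close>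

lemma concentration_saturated:
  fixes W :: "nat \<Rightarrow> (nat \<Rightarrow> 'a) set pmf" and C :: "nat \<Rightarrow> ennreal" and \<kappa> :: "nat \<Rightarrow> 'a \<Rightarrow> nat"
  assumes T: "T_inequality \<gamma> c a1 a2 \<mu>" and \<mu>: "\<mu> \<in> Pg" and a: "0 < a1" "0 < a2"
    and \<kappa>: "\<And>k. \<kappa> k \<in> borel \<rightarrow>\<^sub>M count_space UNIV" "\<And>k. finite (range (\<kappa> k))"
    and W: "\<And>k. finite (set_pmf (W k))" "\<And>k A. A \<in> set_pmf (W k) \<Longrightarrow> A \<in> sets (Xn n)"
      "\<And>k A. A \<in> set_pmf (W k) \<Longrightarrow> saturated (\<kappa> k) n A"
    and B: "B \<in> sets (Xn n)" "0 < measure (power_measure n \<mu>) B" and e: "0 < e"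
  shows "\<exists>y\<in>B. liminf (\<lambda>k. C k + (\<integral>\<^sup>+A. set_cost n A y \<partial>measure_pmf (W k))) \<le>
      liminf (\<lambda>k. C k + (\<integral>\<^sup>+A. ennreal a1 * neg_ln (measure (power_measure n \<mu>) A) \<partial>measure_pmf (W k)))
      + (ennreal a2 * neg_ln (measure (power_measure n \<mu>) B) + ennreal e)"
  using W B e
proof (induction n arbitrary: W C B e)
  case 0
  have sX: "space (Xn 0 :: (nat \<Rightarrow> 'a) measure) = {\<lambda>_. undefined}" by (simp add: space_Xn)
  have "B \<noteq> {}" using 0(5) by auto
  then obtain y where y: "y \<in> B" by blast
  \<comment> \<open>There is only one point. Either \<open>A\<close> is empty and the bound is
    infinite, or \<open>A\<close> is everything and the cost is an empty sum.\<close>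
  have le: "set_cost 0 A y \<le> ennreal a1 * neg_ln (measure (power_measure 0 \<mu>) A)" if A: "A \<in> sets (Xn 0)" for A
  proof (cases "A = {}")
    case True
    then show ?thesis using a by (simp add: neg_ln_def ennreal_mult_top)
  next
    case False
    then have A1: "A = {\<lambda>_. undefined}" using sets.sets_into_space[OF A] sX by auto
    have "emeasure (return (Xn 0) (\<lambda>_. undefined)) A = 1" using A A1 by simp
    then have "set_cost 0 A y \<le> ennreal (cost_n c 0 y (return (Xn 0) (\<lambda>_. undefined)))"
      unfolding set_cost_def using return_admissible[of "\<lambda>_. undefined" 0] sX by (intro INF_lower) auto
    then show ?thesis by (simp add: cost_n_def)
  qed
  have "liminf (\<lambda>k. C k + (\<integral>\<^sup>+A. set_cost 0 A y \<partial>measure_pmf (W k))) \<le>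
      liminf (\<lambda>k. C k + (\<integral>\<^sup>+A. ennreal a1 * neg_ln (measure (power_measure 0 \<mu>) A) \<partial>measure_pmf (W k)))"
  proof -
    have "(\<integral>\<^sup>+A. set_cost 0 A y \<partial>measure_pmf (W k)) \<le>
        (\<integral>\<^sup>+A. ennreal a1 * neg_ln (measure (power_measure 0 \<mu>) A) \<partial>measure_pmf (W k))" for k
      by (rule nn_integral_mono_AE, subst AE_measure_pmf_iff, rule ballI, rule le[OF 0(2)])
    then show ?thesis by (intro Liminf_mono always_eventually allI add_left_mono)
  qed
  also have "\<dots> \<le> \<dots> + (ennreal a2 * neg_ln (measure (power_measure 0 \<mu>) B) + ennreal e)" by simp
  finally show ?case using y by blast
next
  case (Suc n)
  interpret prob_space \<mu> using PgD[OF \<mu>] by simp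
  have s\<mu>[measurable_cong]: "sets \<mu> = sets borel" using PgD[OF \<mu>] by simp
  interpret P: prob_space "power_measure n \<mu>" by (rule prob_space_power_measure) unfold_locales
  interpret S: prob_space "power_measure (Suc n) \<mu>" by (rule prob_space_power_measure) unfold_locales
  let ?P = "measure (power_measure n \<mu>)" and ?S = "measure (power_measure (Suc n) \<mu>)"
  let ?f = "\<lambda>A x. ?P (slice n A x)"
  define g where "g = ?f B"
  define mg where "mg = ?S B"
  note slm = measure_slice[OF prob_space_axioms s\<mu>]
  have g[measurable]: "g \<in> borel_measurable borel" and mg: "mg = (\<integral>x. g x \<partial>\<mu>)" "0 < mg"
    using slm[OF Suc.prems(4)] Suc.prems(5) by (auto simp: g_def mg_def)
  have g01: "0 \<le> g x" "g x \<le> 1" for x by (auto simp: g_def)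
  have e2: "0 < e/2" using Suc.prems(6) by simp
  let ?R = "ennreal a2 * neg_ln mg + ennreal (e/2)"
  show ?case
  proof (cases "liminf (\<lambda>k. C k + (\<integral>\<^sup>+A. ennreal a1 * neg_ln (?S A) \<partial>measure_pmf (W k))) + ?R < \<infinity>")
    case False
    have "B \<noteq> {}" using Suc.prems(5) by auto
    then obtain y where "y \<in> B" by blast
    moreover have "liminf (\<lambda>k. C k + (\<integral>\<^sup>+A. ennreal a1 * neg_ln (?S A) \<partial>measure_pmf (W k)))
      + (ennreal a2 * neg_ln (?S B) + ennreal e) = \<infinity>"
      using False by (auto simp: mg_def less_top[symmetric])
    ultimately show ?thesis by (intro bexI[of _ y]) auto
  next
    case fin: True
    have "\<exists>p. p \<in> borel \<rightarrow>\<^sub>M P_gamma_algebra \<gamma> borel dist \<and>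
        (\<integral>\<^sup>+z. ennreal (c z (p z)) + ennreal a1 * (\<integral>\<^sup>+x. neg_ln (?f A x) \<partial>p z) + ennreal a2 * neg_ln (g z)
          \<partial>density \<mu> (\<lambda>x. ennreal (g x / mg))) \<le> ennreal a1 * neg_ln (?S A) + ?R"
      if A: "A \<in> sets (Xn (Suc n))" for A
    proof -
      have SA: "?S A = (\<integral>x. ?f A x \<partial>\<mu>)" using slm(2)[OF A] by simp
      show ?thesis
        unfolding add.assoc[symmetric]
        by (rule one_dimensional_step[OF T \<mu> a e2 slm(1)[OF A] measure_nonneg P.prob_le_1 g g01 SA mg])
          (rule exI, rule conjI)
    qed
    then have "\<forall>A\<in>sets (Xn (Suc n)). \<exists>p. p \<in> borel \<rightarrow>\<^sub>M P_gamma_algebra \<gamma> borel dist \<and>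
        (\<integral>\<^sup>+z. ennreal (c z (p z)) + ennreal a1 * (\<integral>\<^sup>+x. neg_ln (?f A x) \<partial>p z) + ennreal a2 * neg_ln (g z)
          \<partial>density \<mu> (\<lambda>x. ennreal (g x / mg))) \<le> ennreal a1 * neg_ln (?S A) + ?R"
      by (rule ballI)
    \<comment> \<open>No measurability in \<open>A\<close> is required of this choice, because each
      \<open>W k\<close> has finite support.\<close>
    from bchoice[OF this] obtain p where p: "\<forall>A\<in>sets (Xn (Suc n)). p A \<in> borel \<rightarrow>\<^sub>M P_gamma_algebra \<gamma> borel dist \<and>
        (\<integral>\<^sup>+z. ennreal (c z (p A z)) + ennreal a1 * (\<integral>\<^sup>+x. neg_ln (?f A x) \<partial>p A z) + ennreal a2 * neg_ln (g z)
          \<partial>density \<mu> (\<lambda>x. ennreal (g x / mg))) \<le> ennreal a1 * neg_ln (?S A) + ?R" ..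
    note pk = p[rule_format, THEN conjunct1] and pint = p[rule_format, THEN conjunct2]
    define \<nu> where "\<nu> = density \<mu> (\<lambda>x. ennreal (g x / mg))"
    have \<nu>: "\<nu> \<in> Pg"
      unfolding \<nu>_def using g01 mg by (intro density_Pg[OF \<mu>, where b = "1 / mg"]) (auto intro: divide_right_mono)
    interpret N: prob_space \<nu> using PgD[OF \<nu>] by simp
    have [measurable_cong]: "sets \<nu> = sets borel" using PgD[OF \<nu>] by simp
    \<comment> \<open>\<open>H A z\<close> is the cost paid at \<open>z\<close> plus the penalty of
      \<open>A\<close> left for the other coordinates, \<open>G k\<close> its mean over the random
      set, and \<open>L\<close> the penalty left for \<open>B\<close>, which does not depend on
      \<open>k\<close>.\<close>
    define H where "H A z = ennreal (c z (p A z)) + ennreal a1 * (\<integral>\<^sup>+x. neg_ln (?f A x) \<partial>p A z)" for A z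
    define G where "G k z = (\<integral>\<^sup>+A. H A z \<partial>measure_pmf (W k))" for k z
    define L where "L z = ennreal a2 * neg_ln (g z)" for z
    have Hm: "H A \<in> borel_measurable borel" if A: "A \<in> sets (Xn (Suc n))" for A
    proof -
      have [measurable]: "p A \<in> borel \<rightarrow>\<^sub>M subprob_algebra borel"
        using pk[OF A] by (intro measurable_prob_algebraD) (simp add: kernel_iff)
      note [measurable] = cost_measurable[OF pk[OF A]] slm(1)[OF A]
      show ?thesis unfolding H_def by measurable
    qed
    have Gsum: "G k z = (\<Sum>A\<in>set_pmf (W k). H A z * pmf (W k) A)" for k z
      unfolding G_def by (rule nn_integral_measure_pmf_finite[OF Suc.prems(1)]) simp
    have Gm[measurable]: "G k \<in> borel_measurable borel" for k
      unfolding Gsum[abs_def] using Hm Suc.prems(2)[of _ k] by (intro borel_measurable_sum borel_measurable_times) auto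
    have Lm[measurable]: "L \<in> borel_measurable borel" unfolding L_def by measurable
    have step: "(\<integral>\<^sup>+z. C k + G k z + L z \<partial>\<nu>) \<le> C k + (\<integral>\<^sup>+A. ennreal a1 * neg_ln (?S A) \<partial>measure_pmf (W k)) + ?R" for k
    proof -
      have "C k + G k z + L z = C k + (\<Sum>A\<in>set_pmf (W k). (H A z + L z) * pmf (W k) A)" for z
      proof -
        have "G k z + L z = (\<integral>\<^sup>+A. H A z + L z \<partial>measure_pmf (W k))"
          unfolding G_def by (subst nn_integral_add) (auto simp: measure_pmf.emeasure_space_1)
        also have "\<dots> = (\<Sum>A\<in>set_pmf (W k). (H A z + L z) * pmf (W k) A)"
          by (rule nn_integral_measure_pmf_finite[OF Suc.prems(1)]) simp
        finally show ?thesis by (simp add: add.assoc)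
      qed
      then have "(\<integral>\<^sup>+z. C k + G k z + L z \<partial>\<nu>) = (\<integral>\<^sup>+z. C k + (\<Sum>A\<in>set_pmf (W k). (H A z + L z) * pmf (W k) A) \<partial>\<nu>)"
        by (intro nn_integral_cong) (simp only:)
      also have "\<dots> = C k + (\<Sum>A\<in>set_pmf (W k). (\<integral>\<^sup>+z. H A z + L z \<partial>\<nu>) * pmf (W k) A)"
      proof -
        have m[measurable]: "H A \<in> borel_measurable borel" if "A \<in> set_pmf (W k)" for A
          using Hm Suc.prems(2)[OF that] by blast
        have "(\<integral>\<^sup>+z. C k + (\<Sum>A\<in>set_pmf (W k). (H A z + L z) * pmf (W k) A) \<partial>\<nu>) =
           C k + (\<integral>\<^sup>+z. (\<Sum>A\<in>set_pmf (W k). (H A z + L z) * pmf (W k) A) \<partial>\<nu>)"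
          by (subst nn_integral_add) (auto simp: N.emeasure_space_1 intro!: borel_measurable_sum)
        also have "(\<integral>\<^sup>+z. (\<Sum>A\<in>set_pmf (W k). (H A z + L z) * pmf (W k) A) \<partial>\<nu>) =
            (\<Sum>A\<in>set_pmf (W k). (\<integral>\<^sup>+z. (H A z + L z) * pmf (W k) A \<partial>\<nu>))"
          by (rule nn_integral_sum) auto
        also have "\<dots> = (\<Sum>A\<in>set_pmf (W k). (\<integral>\<^sup>+z. H A z + L z \<partial>\<nu>) * pmf (W k) A)"
          by (intro sum.cong refl nn_integral_multc) auto
        finally show ?thesis .
      qed
      also have "\<dots> \<le> C k + (\<Sum>A\<in>set_pmf (W k). (ennreal a1 * neg_ln (?S A) + ?R) * pmf (W k) A)"
        using pint[OF Suc.prems(2)[of _ k]]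
        by (intro add_left_mono sum_mono mult_right_mono) (auto simp: H_def L_def \<nu>_def)
      also have "(\<Sum>A\<in>set_pmf (W k). (ennreal a1 * neg_ln (?S A) + ?R) * pmf (W k) A) =
          (\<integral>\<^sup>+A. ennreal a1 * neg_ln (?S A) + ?R \<partial>measure_pmf (W k))"
        by (rule nn_integral_measure_pmf_finite[OF Suc.prems(1), symmetric]) simp
      also have "\<dots> = (\<integral>\<^sup>+A. ennreal a1 * neg_ln (?S A) \<partial>measure_pmf (W k)) + ?R"
        by (subst nn_integral_add) (auto simp: measure_pmf.emeasure_space_1)
      finally show ?thesis by (simp only: add.assoc)
    qed
    \<comment> \<open>Fatou is what permits a single \<open>z\<close> for all \<open>k\<close>: the
      lower limit is taken before the point is chosen.\<close>
    have "(\<integral>\<^sup>+z. liminf (\<lambda>k. C k + G k z + L z) \<partial>\<nu>) \<le> liminf (\<lambda>k. \<integral>\<^sup>+z. C k + G k z + L z \<partial>\<nu>)"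
      by (rule nn_integral_liminf) simp
    also have "\<dots> \<le> liminf (\<lambda>k. C k + (\<integral>\<^sup>+A. ennreal a1 * neg_ln (?S A) \<partial>measure_pmf (W k)) + ?R)"
      using step by (intro Liminf_mono always_eventually allI)
    also have "\<dots> = liminf (\<lambda>k. C k + (\<integral>\<^sup>+A. ennreal a1 * neg_ln (?S A) \<partial>measure_pmf (W k))) + ?R"
      by (rule liminf_add_const_ennreal)
    finally obtain z where "liminf (\<lambda>k. C k + G k z + L z) \<le> liminf (\<lambda>k. C k + (\<integral>\<^sup>+A. ennreal a1 * neg_ln (?S A) \<partial>measure_pmf (W k))) + ?R"
      using N.ex_le_of_nn_integral_le[OF _ _ fin, of "\<lambda>z. liminf (\<lambda>k. C k + G k z + L z)"] by auto
    then have z: "liminf (\<lambda>k. C k + G k z) + L z \<le> liminf (\<lambda>k. C k + (\<integral>\<^sup>+A. ennreal a1 * neg_ln (?S A) \<partial>measure_pmf (W k))) + ?R"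
      by (simp only: liminf_add_const_ennreal)
    \<comment> \<open>Finiteness at \<open>z\<close> excludes an infinite penalty, so the slice of
      \<open>B\<close> has positive measure, as the induction hypothesis demands.\<close>
    have gz: "0 < g z"
    proof (rule ccontr)
      assume "\<not> 0 < g z"
      then have "L z = \<infinity>" using a by (simp add: L_def neg_ln_def ennreal_mult_top)
      then show False using le_less_trans[OF z fin] by simp
    qed
    have pz: "p A z \<in> Pg" if "A \<in> set_pmf (W k)" for A k
      using pk[OF Suc.prems(2)[OF that]] by (simp add: kernel_iff)
    have \<kappa>m: "\<kappa> k \<in> p A z \<rightarrow>\<^sub>M count_space UNIV" if "A \<in> set_pmf (W k)" for A k
      using \<kappa>(1) by (simp add: measurable_cong_sets[OF PgD(2)[OF pz[OF that]] refl])
    have zpk: "\<exists>Q. measure_pmf Q = distr (p A z) (count_space UNIV) (\<kappa> k)" if A: "A \<in> set_pmf (W k)" for A k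
    proof -
      have "prob_space (distr (p A z) (count_space UNIV) (\<kappa> k))"
        using prob_space.prob_space_distr[OF PgD(1)[OF pz[OF A]] \<kappa>m[OF A]] .
      then show ?thesis using ex_pmf_of_prob_space[of "distr (p A z) (count_space UNIV) (\<kappa> k)"] by auto
    qed
    \<comment> \<open>The law of the label of a point drawn from the kernel at
      \<open>z\<close>.\<close>
    define Q where "Q k A = (SOME Q. measure_pmf Q = distr (p A z) (count_space UNIV) (\<kappa> k))" for k A
    have Q: "measure_pmf (Q k A) = distr (p A z) (count_space UNIV) (\<kappa> k)" if "A \<in> set_pmf (W k)" for A k
      unfolding Q_def using zpk[OF that] by (rule someI_ex)
    define D where "D k A l = slice n A (inv_into UNIV (\<kappa> k) l)" for k A l
    have D: "D k A (\<kappa> k x) = slice n A x" if "A \<in> set_pmf (W k)" for k A x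
      unfolding D_def using Suc.prems(3)[OF that] sets.sets_into_space[OF Suc.prems(2)[OF that]]
      by (rule slice_cong) (simp add: f_inv_into_f)
    \<comment> \<open>The next random set: draw \<open>A\<close>, then its slice at a point drawn
      from the kernel. Drawing the label instead of the point keeps the support finite.\<close>
    define W' where "W' k = bind_pmf (W k) (\<lambda>A. map_pmf (D k A) (Q k A))" for k
    have W': "(\<integral>\<^sup>+A. h A \<partial>measure_pmf (W' k)) = (\<integral>\<^sup>+A. (\<integral>\<^sup>+x. h (slice n A x) \<partial>p A z) \<partial>measure_pmf (W k))" for h :: "_ \<Rightarrow> ennreal" and k
    proof -
      have "(\<integral>\<^sup>+A. h A \<partial>measure_pmf (W' k)) = (\<integral>\<^sup>+A. (\<integral>\<^sup>+l. h (D k A l) \<partial>measure_pmf (Q k A)) \<partial>measure_pmf (W k))"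
        by (simp add: W'_def)
      also have "\<dots> = (\<integral>\<^sup>+A. (\<integral>\<^sup>+x. h (slice n A x) \<partial>p A z) \<partial>measure_pmf (W k))"
      proof (rule nn_integral_cong_AE, subst AE_measure_pmf_iff, rule ballI)
        fix A assume A: "A \<in> set_pmf (W k)"
        show "(\<integral>\<^sup>+l. h (D k A l) \<partial>measure_pmf (Q k A)) = (\<integral>\<^sup>+x. h (slice n A x) \<partial>p A z)"
          unfolding Q[OF A] using \<kappa>m[OF A] by (subst nn_integral_distr) (auto simp: D[OF A])
      qed
      finally show ?thesis .
    qed
    \<comment> \<open>The expected cost at the fixed coordinate joins what has been paid
      before.\<close>
    define C' where "C' k = C k + (\<integral>\<^sup>+A. ennreal (c z (p A z)) \<partial>measure_pmf (W k))" for k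
    have W'sub: "A' \<in> (\<Union>A\<in>set_pmf (W k). D k A ` range (\<kappa> k))" if A': "A' \<in> set_pmf (W' k)" for A' k
    proof -
      obtain A l where A: "A \<in> set_pmf (W k)" and l: "l \<in> set_pmf (Q k A)" "A' = D k A l"
        using A' by (auto simp: W'_def)
      have "l \<in> range (\<kappa> k)"
      proof (rule ccontr)
        assume "l \<notin> range (\<kappa> k)"
        then have "\<kappa> k -` {l} \<inter> space (p A z) = {}" by auto
        then have "emeasure (measure_pmf (Q k A)) {l} = 0"
          unfolding Q[OF A] using \<kappa>m[OF A] by (simp add: emeasure_distr)
        then show False using l(1) by (simp add: emeasure_pmf_single set_pmf_iff)
      qed
      then show ?thesis using A l by blast
    qed
    have "\<exists>y\<in>slice n B z. liminf (\<lambda>k. C' k + (\<integral>\<^sup>+A. set_cost n A y \<partial>measure_pmf (W' k))) \<le>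
      liminf (\<lambda>k. C' k + (\<integral>\<^sup>+A. ennreal a1 * neg_ln (?P A) \<partial>measure_pmf (W' k))) + (ennreal a2 * neg_ln (?P (slice n B z)) + ennreal (e/2))"
    proof (rule Suc.IH[OF _ _ _ _ _ e2])
      show "finite (set_pmf (W' k))" for k
        by (rule finite_subset[of _ "\<Union>A\<in>set_pmf (W k). D k A ` range (\<kappa> k)"])
           (use W'sub Suc.prems(1) \<kappa>(2) in auto)
      show "A' \<in> sets (Xn n)" if "A' \<in> set_pmf (W' k)" for k A'
        using W'sub[OF that] Suc.prems(2)[of _ k] by (auto simp: D_def slice_measurable)
      show "saturated (\<kappa> k) n A'" if "A' \<in> set_pmf (W' k)" for k A'
        using W'sub[OF that] Suc.prems(3)[of _ k] by (auto simp: D_def saturated_slice)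
      show "slice n B z \<in> sets (Xn n)" by (rule slice_measurable[OF Suc.prems(4)])
      show "0 < ?P (slice n B z)" using gz by (simp add: g_def)
    qed
    then obtain y where y: "y \<in> slice n B z"
      and le: "liminf (\<lambda>k. C' k + (\<integral>\<^sup>+A. set_cost n A y \<partial>measure_pmf (W' k))) \<le>
        liminf (\<lambda>k. C' k + (\<integral>\<^sup>+A. ennreal a1 * neg_ln (?P A) \<partial>measure_pmf (W' k))) + (L z + ennreal (e/2))"
      by (auto simp: L_def g_def)
    have "C k + (\<integral>\<^sup>+A. set_cost (Suc n) A (y(n := z)) \<partial>measure_pmf (W k)) \<le> C' k + (\<integral>\<^sup>+A. set_cost n A y \<partial>measure_pmf (W' k))" for k
    proof -
      have "(\<integral>\<^sup>+A. set_cost (Suc n) A (y(n := z)) \<partial>measure_pmf (W k)) \<le>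
          (\<integral>\<^sup>+A. ennreal (c z (p A z)) + (\<integral>\<^sup>+x. set_cost n (slice n A x) y \<partial>p A z) \<partial>measure_pmf (W k))"
      proof (rule nn_integral_mono_AE, subst AE_measure_pmf_iff, rule ballI)
        fix A assume A: "A \<in> set_pmf (W k)"
        show "set_cost (Suc n) A (y(n := z)) \<le> ennreal (c z (p A z)) + (\<integral>\<^sup>+x. set_cost n (slice n A x) y \<partial>p A z)"
          by (rule set_cost_Suc[OF \<kappa> Suc.prems(2)[OF A] Suc.prems(3)[OF A] pz[OF A]])
      qed
      also have "\<dots> = (\<integral>\<^sup>+A. ennreal (c z (p A z)) \<partial>measure_pmf (W k)) + (\<integral>\<^sup>+A. set_cost n A y \<partial>measure_pmf (W' k))"
        unfolding W' by (rule nn_integral_add) auto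
      finally show ?thesis unfolding C'_def by (simp only: add.assoc add_left_mono)
    qed
    then have "liminf (\<lambda>k. C k + (\<integral>\<^sup>+A. set_cost (Suc n) A (y(n := z)) \<partial>measure_pmf (W k))) \<le>
        liminf (\<lambda>k. C' k + (\<integral>\<^sup>+A. set_cost n A y \<partial>measure_pmf (W' k)))"
      by (intro Liminf_mono always_eventually allI)
    also note le
    also have "(\<lambda>k. C' k + (\<integral>\<^sup>+A. ennreal a1 * neg_ln (?P A) \<partial>measure_pmf (W' k))) = (\<lambda>k. C k + G k z)"
    proof
      fix k
      have "(\<integral>\<^sup>+A. ennreal a1 * neg_ln (?P A) \<partial>measure_pmf (W' k)) = (\<integral>\<^sup>+A. ennreal a1 * (\<integral>\<^sup>+x. neg_ln (?f A x) \<partial>p A z) \<partial>measure_pmf (W k))"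
        unfolding W'
      proof (rule nn_integral_cong_AE, subst AE_measure_pmf_iff, rule ballI)
        fix A assume A: "A \<in> set_pmf (W k)"
        note [measurable] = slm(1)[OF Suc.prems(2)[OF A]]
        show "(\<integral>\<^sup>+x. ennreal a1 * neg_ln (?f A x) \<partial>p A z) = ennreal a1 * (\<integral>\<^sup>+x. neg_ln (?f A x) \<partial>p A z)"
          by (rule nn_integral_cmult) (simp add: measurable_cong_sets[OF PgD(2)[OF pz[OF A]] refl])
      qed
      moreover have "G k z = (\<integral>\<^sup>+A. ennreal (c z (p A z)) \<partial>measure_pmf (W k)) + (\<integral>\<^sup>+A. ennreal a1 * (\<integral>\<^sup>+x. neg_ln (?f A x) \<partial>p A z) \<partial>measure_pmf (W k))"
        unfolding G_def H_def by (rule nn_integral_add) auto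
      ultimately show "C' k + (\<integral>\<^sup>+A. ennreal a1 * neg_ln (?P A) \<partial>measure_pmf (W' k)) = C k + G k z"
        by (simp add: C'_def add.assoc)
    qed
    also have "liminf (\<lambda>k. C k + G k z) + (L z + ennreal (e/2)) \<le>
        liminf (\<lambda>k. C k + (\<integral>\<^sup>+A. ennreal a1 * neg_ln (?S A) \<partial>measure_pmf (W k))) + ?R + ennreal (e/2)"
      using add_right_mono[OF z] by (simp only: add.assoc)
    also have "\<dots> = liminf (\<lambda>k. C k + (\<integral>\<^sup>+A. ennreal a1 * neg_ln (?S A) \<partial>measure_pmf (W k))) + (ennreal a2 * neg_ln mg + ennreal e)"
      using e2 by (simp add: add.assoc flip: ennreal_plus)
    finally have "liminf (\<lambda>k. C k + (\<integral>\<^sup>+A. set_cost (Suc n) A (y(n := z)) \<partial>measure_pmf (W k))) \<le>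
        liminf (\<lambda>k. C k + (\<integral>\<^sup>+A. ennreal a1 * neg_ln (?S A) \<partial>measure_pmf (W k))) + (ennreal a2 * neg_ln (?S B) + ennreal e)"
      unfolding mg_def .
    moreover have "y(n := z) \<in> B" using y by (simp add: slice_def)
    ultimately show ?thesis by blast
  qed
qed

end

section \<open>From the transport inequality to enlargements\<close>

lemma inner_prob_bounds:
  assumes "prob_space P"
  shows "0 \<le> inner_prob P S" "inner_prob P S \<le> 1"
proof -
  interpret prob_space P by fact
  show "0 \<le> inner_prob P S"
    unfolding inner_prob_def by (rule cSUP_upper2[where x = "{}"]) (auto intro!: bdd_aboveI[of _ 1])
  show "inner_prob P S \<le> 1"
    unfolding inner_prob_def by (intro cSUP_least) auto
qed

lemma inner_prob_mono:
  assumes "prob_space P" "S \<subseteq> S'"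
  shows "inner_prob P S \<le> inner_prob P S'"
proof -
  interpret prob_space P by fact
  show ?thesis
    unfolding inner_prob_def
    by (intro cSUP_subset_mono) (use assms(2) in \<open>auto intro!: bdd_aboveI[of _ 1]\<close>)
qed

lemma measure_le_inner_prob:
  assumes "prob_space P" "B \<in> sets P" "B \<subseteq> S"
  shows "measure P B \<le> inner_prob P S"
proof -
  interpret prob_space P by fact
  show ?thesis
    unfolding inner_prob_def using assms(2,3) by (intro cSUP_upper) (auto intro!: bdd_aboveI[of _ 1])
qed

text \<open>Retraction of \<open>nat \<Rightarrow> 'a\<close> onto the carrier of
  \<open>Xn n\<close>. The function type is itself Polish, so compactness and regularity results for
  type-class topologies become available for \<open>X\<^sup>n\<close>.\<close>

definition restr :: "nat \<Rightarrow> (nat \<Rightarrow> 'a) \<Rightarrow> nat \<Rightarrow> 'a" where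
  "restr n x = (\<lambda>i. if i < n then x i else undefined)"

lemma restr_id: "x \<in> space (Xn n) \<Longrightarrow> restr n x = x"
proof (rule ext)
  fix i assume "x \<in> space (Xn n)"
  then have "i < n \<or> x i = undefined"
    using PiE_arb[of x "{..<n}" _ i] by (auto simp: space_Xn)
  then show "restr n x i = x i" by (auto simp: restr_def)
qed

lemma restr_space: "restr n x \<in> space (Xn n)"
  unfolding space_Xn by (rule PiE_I) (auto simp: restr_def)

lemma restr_measurable [measurable]:
  "restr n \<in> (borel :: (nat \<Rightarrow> 'a::second_countable_topology) measure) \<rightarrow>\<^sub>M Xn n"
proof -
  have "(\<lambda>x. restrict x {..<n}) \<in> (borel :: (nat \<Rightarrow> 'a) measure) \<rightarrow>\<^sub>M (\<Pi>\<^sub>M i\<in>{..<n}. borel)"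
    by (intro measurable_restrict) (rule measurable_product_coordinates)
  moreover have "(\<lambda>x. restrict x {..<n}) = (restr n :: (nat \<Rightarrow> 'a) \<Rightarrow> _)"
    by (auto simp: restr_def restrict_def fun_eq_iff)
  ultimately show ?thesis by (simp add: Xn_def)
qed

lemma id_Xn_measurable [measurable]:
  "(\<lambda>x. x) \<in> Xn n \<rightarrow>\<^sub>M (borel :: (nat \<Rightarrow> 'a::second_countable_topology) measure)"
proof (rule measurable_coordinatewise_then_product)
  fix i
  show "(\<lambda>x. x i) \<in> Xn n \<rightarrow>\<^sub>M (borel :: 'a measure)"
  proof (cases "i < n")
    case True
    then show ?thesis unfolding Xn_def by (intro measurable_component_singleton) simp
  next
    case False
    have "(\<lambda>x. x i) \<in> Xn n \<rightarrow>\<^sub>M (borel :: 'a measure) \<longleftrightarrow> (\<lambda>x :: nat \<Rightarrow> 'a. undefined) \<in> Xn n \<rightarrow>\<^sub>M (borel :: 'a measure)"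
      using PiE_arb[of _ "{..<n}" _ i] False by (intro measurable_cong) (simp add: space_Xn)
    then show ?thesis by simp
  qed
qed

lemma component_measurable_Xn: "i < n \<Longrightarrow> (\<lambda>x. x i) \<in> Xn n \<rightarrow>\<^sub>M borel"
  unfolding Xn_def by (intro measurable_component_singleton) simp

section \<open>Compact sets and fine partitions in the Polish space of sequences\<close>

lemma continuous_l1_dist: "continuous_on UNIV (\<lambda>x :: nat \<Rightarrow> 'a::metric_space. l1_dist n x y)"
  unfolding l1_dist_def by (intro continuous_intros continuous_on_product_coordinates)

text \<open>Tychonoff, with the singleton of \<open>undefined\<close> as factor from index
  \<open>n\<close> on.\<close>

lemma compact_box:
  fixes L :: "'a::topological_space set"
  assumes "compact L"
  shows "compact {x. \<forall>i. if i < n then x i \<in> L else x i = undefined}"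
proof -
  have "compactin (product_topology (\<lambda>_. euclidean) UNIV) (PiE UNIV (\<lambda>i. if i < n then L else {undefined}))"
    unfolding compactin_PiE using assms by auto
  moreover have "PiE UNIV (\<lambda>i. if i < n then L else {undefined}) = {x. \<forall>i. if i < n then x i \<in> L else x i = undefined}"
    by (auto simp: PiE_iff Ball_def split: if_splits)
  ultimately show ?thesis by (simp only: euclidean_product_topology compactin_euclidean_iff)
qed

text \<open>The metric on sequences weights truncated distances by powers of 1/2, whose total is
  2.\<close>

lemma dist_fun_le:
  fixes x y :: "nat \<Rightarrow> 'a::metric_space"
  assumes "\<And>i. dist (x i) (y i) \<le> e"
  shows "dist x y \<le> 2 * e"
proof -
  have e: "0 \<le> e" using assms[of 0] zero_le_dist order_trans by blast
  have s: "(\<lambda>n. (1/2::real)^n * e) sums (2 * e)"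
    using sums_mult2[OF geometric_sums[of "1/2::real"], of e] by simp
  have le: "(1/2)^n * min (dist (x (from_nat n)) (y (from_nat n))) 1 \<le> (1/2::real)^n * e" for n
    using assms by (intro mult_left_mono) (auto simp: min.coboundedI1)
  have "summable (\<lambda>n. (1/2)^n * min (dist (x (from_nat n)) (y (from_nat n))) 1)"
    by (rule summable_comparison_test'[OF sums_summable[OF s], of 0]) (use le in auto)
  then have "dist x y \<le> (\<Sum>n. (1/2)^n * e)"
    unfolding dist_fun_def using le sums_summable[OF s] by (intro suminf_le)
  then show ?thesis using sums_unique[OF s] by simp
qed

text \<open>A point of \<open>L\<close> is labelled by the least index of a ball of radius
  \<open>e/2\<close> containing it, shifted by one. The label 0 is reserved for the complement, so
  that cells which meet \<open>L\<close> stay inside \<open>L\<close>.\<close>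

lemma compact_mesh:
  fixes L :: "'a::{metric_space, second_countable_topology} set"
  assumes L: "compact L" and e: "0 < e"
  obtains \<kappa> :: "'a \<Rightarrow> nat" where "\<kappa> \<in> borel \<rightarrow>\<^sub>M count_space UNIV" "finite (range \<kappa>)"
    "\<And>x. \<kappa> x = 0 \<longleftrightarrow> x \<notin> L" "\<And>x y. x \<in> L \<Longrightarrow> \<kappa> x = \<kappa> y \<Longrightarrow> dist x y < e"
proof -
  have "L \<subseteq> (\<Union>x\<in>L. ball x (e/2))" using e by auto
  then obtain F where F: "F \<subseteq> L" "finite F" "L \<subseteq> (\<Union>x\<in>F. ball x (e/2))"
    using compactE_image[OF L, of L "\<lambda>x. ball x (e/2)"] by auto
  obtain f and N :: nat where f: "F = f ` {i. i < N}"
    using finite_imp_nat_seg_image_inj_on[OF F(2)] by auto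
  define l where "l x = (LEAST i. x \<in> ball (f i) (e/2))" for x
  define \<kappa> where "\<kappa> x = (if x \<in> L then Suc (l x) else 0)" for x
  have ex: "\<exists>i<N. x \<in> ball (f i) (e/2)" if "x \<in> L" for x
    using F(3) that unfolding f by blast
  have l: "x \<in> ball (f (l x)) (e/2)" "l x < N" if x: "x \<in> L" for x
  proof -
    obtain i where i: "i < N" "x \<in> ball (f i) (e/2)" using ex[OF x] by blast
    show "x \<in> ball (f (l x)) (e/2)" unfolding l_def using i(2) by (rule LeastI)
    have "l x \<le> i" unfolding l_def using i(2) by (rule Least_le)
    then show "l x < N" using i(1) by simp
  qed
  show thesis
  proof (rule that)
    have [measurable]: "L \<in> sets borel" using compact_imp_closed[OF L] by simp
    have [measurable]: "l \<in> borel \<rightarrow>\<^sub>M count_space UNIV"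
      unfolding l_def by (rule measurable_Least) simp
    show "\<kappa> \<in> borel \<rightarrow>\<^sub>M count_space UNIV" unfolding \<kappa>_def by measurable
    have "range \<kappa> \<subseteq> {..N}" using l(2) by (auto simp: \<kappa>_def Suc_le_eq)
    then show "finite (range \<kappa>)" by (rule finite_subset) simp
    show "\<kappa> x = 0 \<longleftrightarrow> x \<notin> L" for x by (simp add: \<kappa>_def)
    show "dist x y < e" if "x \<in> L" "\<kappa> x = \<kappa> y" for x y
    proof -
      have "y \<in> L" "l x = l y" using that by (auto simp: \<kappa>_def split: if_splits)
      then have "dist (f (l x)) x < e/2" "dist (f (l x)) y < e/2" using l(1)[of x] l(1)[of y] that by auto
      then show ?thesis using dist_triangle2[of x y "f (l x)"] by (simp add: dist_commute)
    qed
  qed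
qed

lemma neg_ln_antimono: "0 < x \<Longrightarrow> x \<le> y \<Longrightarrow> neg_ln y \<le> neg_ln x"
  by (auto simp: neg_ln_def intro!: ennreal_leI)

context transport_setting
begin

text \<open>Inner regularity inside a sublevel set of \<gamma>. A lower semicontinuous gauge may be
  unbounded on a compact set; the bound \<open>M\<close> guarantees a finite moment for every
  probability measure on \<open>K\<close>.\<close>

lemma inner_compact_bounded:
  fixes P :: "(nat \<Rightarrow> 'a) measure"
  assumes P: "prob_space P" "sets P = sets (Xn n)" and A: "A \<in> sets (Xn n)"
    and r0: "0 \<le> r" and r: "r < measure P A"
  obtains K M where "compact K" "K \<subseteq> A" "r < measure P K" "K \<in> sets (Xn n)"
    "\<And>x. x \<in> K \<Longrightarrow> \<gamma> (l1_dist n x x0) \<le> M"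
proof -
  interpret P: prob_space P by fact
  have sP: "space P = space (Xn n)" using sets_eq_imp_space_eq[OF P(2)] .
  have idm[measurable]: "(\<lambda>x. x) \<in> P \<rightarrow>\<^sub>M borel"
    using id_Xn_measurable by (simp add: measurable_cong_sets[OF P(2) refl])
  have l1[measurable]: "(\<lambda>x. l1_dist n x x0) \<in> borel_measurable borel"
    by (rule borel_measurable_continuous_onI[OF continuous_l1_dist])
  have l10: "0 \<le> l1_dist n x x0" for x by (simp add: l1_dist_def sum_nonneg)
  have "space (Xn n) = {x :: nat \<Rightarrow> 'a. restr n x = x}"
    using restr_id[of _ n] restr_space[of n] by (metis (mono_tags, lifting) Collect_cong Collect_mem_eq)
  also have "\<dots> = (\<Inter>i\<in>{n..}. (\<lambda>x. x i) -` {undefined})"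
    by (auto simp: restr_def fun_eq_iff)
  finally have "closed (space (Xn n) :: (nat \<Rightarrow> 'a) set)"
    by (auto intro!: closed_INT closed_vimage continuous_on_product_coordinates)
  then have spm[measurable]: "space (Xn n) \<in> sets (borel :: (nat \<Rightarrow> 'a) measure)" by simp
  have "A = restr n -` A \<inter> space (Xn n)"
    using sets.sets_into_space[OF A] restr_id by auto
  moreover have "restr n -` A \<inter> space borel \<in> sets borel" by (rule measurable_sets[OF restr_measurable A])
  ultimately have A'[measurable]: "A \<in> sets borel" using spm by (metis Int_UNIV_right sets.Int space_borel)
  \<comment> \<open>Closed by lower semicontinuity and increasing to the whole space, so one of
    these sets retains enough of the mass of \<open>A\<close>.\<close>
  define F where "F M = {x. \<gamma> (max 0 (l1_dist n x x0)) \<le> real M}" for M :: nat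
  have clF: "closed (F M)" for M
  proof -
    have "F M = (\<lambda>x. l1_dist n x x0) -` (- {u. real M < \<gamma> (max 0 u)})"
      by (auto simp: F_def)
    then show ?thesis using open_gamma_greater by (simp add: closed_vimage continuous_l1_dist closed_Compl)
  qed
  then have [measurable]: "F M \<in> sets borel" for M by simp
  have inP: "B \<in> sets P" if "B \<in> sets borel" "B \<subseteq> space (Xn n)" for B
    using measurable_sets[OF idm that(1)] that(2) sP by (simp add: vimage_def Int_absorb2)
  have AX: "A \<subseteq> space (Xn n)" using sets.sets_into_space[OF A] .
  have "(\<lambda>M. measure P (A \<inter> F M)) \<longlonglongrightarrow> measure P (\<Union>M. A \<inter> F M)"
    using AX by (intro P.finite_Lim_measure_incseq) (auto simp: incseq_def F_def intro!: inP)
  also have "(\<Union>M. A \<inter> F M) = A"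
    by (auto simp: F_def intro: real_arch_simple)
  finally have "eventually (\<lambda>M. r < measure P (A \<inter> F M)) sequentially"
    by (rule order_tendstoD) (rule r)
  then obtain M where M: "r < measure P (A \<inter> F M)" by (auto simp: eventually_sequentially)
  \<comment> \<open>The same law as a Borel measure on the Polish function type, where inner
    regularity applies.\<close>
  define Q where "Q = distr P borel (\<lambda>x. x)"
  interpret Q: prob_space Q unfolding Q_def by (rule P.prob_space_distr[OF idm])
  have Q: "emeasure Q B = emeasure P B" if "B \<in> sets borel" "B \<subseteq> space (Xn n)" for B
    unfolding Q_def using that sP by (subst emeasure_distr[OF idm]) (auto simp: Int_absorb2)
  have "emeasure Q (A \<inter> F M) = (SUP K\<in>{K. K \<subseteq> A \<inter> F M \<and> compact K}. emeasure Q K)"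
    by (rule inner_regular) (use Q.emeasure_space_1 in \<open>auto simp: Q_def\<close>)
  moreover have "ennreal r < emeasure Q (A \<inter> F M)"
    using M Q[of "A \<inter> F M"] AX r0 by (simp add: P.emeasure_eq_measure ennreal_less_iff le_infI1)
  ultimately obtain K where K: "K \<subseteq> A \<inter> F M" "compact K" "ennreal r < emeasure Q K"
    by (auto simp: less_SUP_iff)
  have Kb: "K \<in> sets borel" using compact_imp_closed[OF K(2)] by simp
  have KX: "K \<subseteq> space (Xn n)" using K(1) AX by auto
  show thesis
  proof (rule that[of K M])
    show "r < measure P K"
      using K(3) Q[OF Kb KX] r0 by (simp add: P.emeasure_eq_measure ennreal_less_iff)
    show "K \<in> sets (Xn n)" using inP[OF Kb KX] P(2) by simp
    show "\<gamma> (l1_dist n x x0) \<le> real M" if "x \<in> K" for x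
      using K(1) that l10[of x] by (auto simp: F_def max_absorb2)
  qed (use K in auto)
qed

text \<open>If a point \<open>y\<close> of \<open>B\<close> has cost at most \<open>R + e\<close> to
  infinitely many of the approximations \<open>S k\<close> of \<open>K\<close>, then nearly optimal
  measures subconverge to a law on \<open>K\<close>, of cost at most \<open>R + e\<close> by
  semicontinuity. So \<open>cost_to_set\<close> at \<open>y\<close> is at most \<open>R + e\<close>,
  while it exceeds \<open>t\<close>. One \<open>e\<close> comes from the induction, the other makes
  the inequality for the lower limit strict.\<close>

lemma enlargement_complement_bound_compact:
  assumes T: "T_inequality \<gamma> c a1 a2 \<mu>" and \<mu>: "\<mu> \<in> Pg" and a: "0 < a1" "0 < a2"
    and K: "compact K" "K \<in> sets (Xn n)" "K \<subseteq> A" "0 < measure (power_measure n \<mu>) K"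
      "\<And>x. x \<in> K \<Longrightarrow> \<gamma> (l1_dist n x x0) \<le> M" and x0: "x0 \<in> space (Xn n)" and A: "A \<in> sets (Xn n)"
    and B: "B \<in> sets (Xn n)" "0 < measure (power_measure n \<mu>) B" "\<And>y. y \<in> B \<Longrightarrow> ereal t < cost_to_set \<gamma> c n A y"
    and e: "0 < e"
  shows "t \<le> a1 * - ln (measure (power_measure n \<mu>) K) + a2 * - ln (measure (power_measure n \<mu>) B) + 2 * e"
proof -
  interpret prob_space \<mu> using PgD[OF \<mu>] by simp
  have s\<mu>[measurable_cong]: "sets \<mu> = sets borel" using PgD[OF \<mu>] by simp
  interpret P: prob_space "power_measure n \<mu>" by (rule prob_space_power_measure) unfold_locales
  let ?P = "measure (power_measure n \<mu>)"
  have sP: "sets (power_measure n \<mu>) = sets (Xn n)" by (rule sets_power_measure[OF s\<mu>])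
  have KX: "K \<subseteq> space (Xn n)" using sets.sets_into_space[OF K(2)] .
  \<comment> \<open>\<open>L0\<close> collects all coordinates of points of \<open>K\<close>; the
    box \<open>L\<close> over it is compact and contains every \<open>S k\<close>, since the label 0
    marks the complement of \<open>L0\<close>.\<close>
  define L0 where "L0 = (\<Union>i\<in>{..<n}. (\<lambda>x. x i) ` K)"
  have L0: "compact L0"
    unfolding L0_def by (intro compact_UN compact_continuous_image K(1) continuous_on_subset[OF continuous_on_product_coordinates]) auto
  define L where "L = {x :: nat \<Rightarrow> 'a. \<forall>i. if i < n then x i \<in> L0 else x i = undefined}"
  have L: "compact L" unfolding L_def by (rule compact_box[OF L0])
  have "\<forall>k. \<exists>\<kappa> :: 'a \<Rightarrow> nat. \<kappa> \<in> borel \<rightarrow>\<^sub>M count_space UNIV \<and> finite (range \<kappa>) \<and>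
    (\<forall>x. \<kappa> x = 0 \<longleftrightarrow> x \<notin> L0) \<and> (\<forall>x y. x \<in> L0 \<longrightarrow> \<kappa> x = \<kappa> y \<longrightarrow> dist x y < 1 / real (Suc k))"
  proof
    fix k
    show "\<exists>\<kappa> :: 'a \<Rightarrow> nat. \<kappa> \<in> borel \<rightarrow>\<^sub>M count_space UNIV \<and> finite (range \<kappa>) \<and>
      (\<forall>x. \<kappa> x = 0 \<longleftrightarrow> x \<notin> L0) \<and> (\<forall>x y. x \<in> L0 \<longrightarrow> \<kappa> x = \<kappa> y \<longrightarrow> dist x y < 1 / real (Suc k))"
      by (rule compact_mesh[OF L0, of "1 / real (Suc k)"]) (simp, blast)
  qed
  from choice[OF this] obtain \<kappa> :: "nat \<Rightarrow> 'a \<Rightarrow> nat" where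
    \<kappa>': "\<forall>k. \<kappa> k \<in> borel \<rightarrow>\<^sub>M count_space UNIV \<and> finite (range (\<kappa> k)) \<and>
      (\<forall>x. \<kappa> k x = 0 \<longleftrightarrow> x \<notin> L0) \<and> (\<forall>x y. x \<in> L0 \<longrightarrow> \<kappa> k x = \<kappa> k y \<longrightarrow> dist x y < 1 / real (Suc k))" ..
  then have \<kappa>: "\<And>k. \<kappa> k \<in> borel \<rightarrow>\<^sub>M count_space UNIV" "\<And>k. finite (range (\<kappa> k))"
    "\<And>k x. \<kappa> k x = 0 \<longleftrightarrow> x \<notin> L0" "\<And>k x y. x \<in> L0 \<Longrightarrow> \<kappa> k x = \<kappa> k y \<Longrightarrow> dist x y < 1 / real (Suc k)"
    by blast+
  define S where "S k = {x \<in> space (Xn n). \<exists>x'\<in>K. \<forall>i<n. \<kappa> k (x i) = \<kappa> k (x' i)}" for k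
  have Ssat: "saturated (\<kappa> k) n (S k)" for k
    unfolding saturated_def S_def by auto
  have Sm: "S k \<in> sets (Xn n)" for k
  proof -
    define F where "F = (\<lambda>x'. restrict (\<lambda>i. \<kappa> k (x' i)) {..<n}) ` K"
    have "finite F"
      by (rule finite_subset[of _ "PiE {..<n} (\<lambda>_. range (\<kappa> k))"]) (auto simp: F_def intro!: finite_PiE \<kappa>(2) restrict_PiE_iff[THEN iffD2])
    have "S k = (\<Union>w\<in>F. {x \<in> space (Xn n). \<forall>i\<in>{..<n}. \<kappa> k (x i) = w i})"
      unfolding S_def F_def by auto
    also have "\<dots> \<in> sets (Xn n)"
    proof (rule sets.finite_UN[OF \<open>finite F\<close>])
      fix w
      have [measurable]: "(\<lambda>x. \<kappa> k (x i)) \<in> Xn n \<rightarrow>\<^sub>M count_space UNIV" if "i \<in> {..<n}" for i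
        using that by (intro measurable_compose[OF component_measurable_Xn \<kappa>(1)]) auto
      show "{x \<in> space (Xn n). \<forall>i\<in>{..<n}. \<kappa> k (x i) = w i} \<in> sets (Xn n)" by measurable
    qed
    finally show ?thesis .
  qed
  have KS: "K \<subseteq> S k" for k using KX by (auto simp: S_def)
  have near: "x \<in> L" "\<exists>x'\<in>K. dist x x' \<le> 2 * (1 / real (Suc k))" if xS: "x \<in> S k" for x k
  proof -
    obtain x' where x': "x' \<in> K" "\<forall>i<n. \<kappa> k (x i) = \<kappa> k (x' i)" and xX: "x \<in> space (Xn n)"
      using xS by (auto simp: S_def)
    have L0': "x' i \<in> L0" if "i < n" for i using x'(1) that by (auto simp: L0_def)
    then have "x i \<in> L0" if "i < n" for i using x'(2) \<kappa>(3) that by metis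
    moreover have un: "x i = undefined" if "\<not> i < n" "x \<in> space (Xn n)" for x :: "nat \<Rightarrow> 'a" and i
      using that PiE_arb[of x "{..<n}" _ i] by (simp add: space_Xn)
    ultimately show "x \<in> L" using xX by (auto simp: L_def)
    have "dist (x i) (x' i) \<le> 1 / real (Suc k)" for i
    proof (cases "i < n")
      case True
      then have "dist (x' i) (x i) < 1 / real (Suc k)" using x'(2) L0' by (intro \<kappa>(4)) auto
      then show ?thesis by (simp add: dist_commute)
    next
      case False
      moreover have "x' \<in> space (Xn n)" using x'(1) KX by blast
      ultimately have "x i = undefined" "x' i = undefined" using un[OF False] xX by blast+
      then show ?thesis by simp
    qed
    then show "\<exists>x'\<in>K. dist x x' \<le> 2 * (1 / real (Suc k))" using x'(1) dist_fun_le by blast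
  qed
  define R where "R = a1 * - ln (?P K) + a2 * - ln (?P B) + e"
  have lnK: "0 \<le> - ln (?P K)" "0 \<le> - ln (?P B)" using K(4) B(2) P.prob_le_1 by auto
  have R0: "0 \<le> R" unfolding R_def using a e by (intro add_nonneg_nonneg mult_nonneg_nonneg lnK) auto
  \<comment> \<open>The start is deterministic and nothing has been paid; random sets arise only
    inside the induction.\<close>
  have "\<exists>y\<in>B. liminf (\<lambda>k. 0 + (\<integral>\<^sup>+A. set_cost n A y \<partial>measure_pmf (return_pmf (S k)))) \<le>
      liminf (\<lambda>k. 0 + (\<integral>\<^sup>+A. ennreal a1 * neg_ln (?P A) \<partial>measure_pmf (return_pmf (S k))))
      + (ennreal a2 * neg_ln (?P B) + ennreal e)"
    using Sm Ssat by (intro concentration_saturated[OF T \<mu> a \<kappa>(1,2) _ _ _ B(1,2) e]) auto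
  then obtain y where y: "y \<in> B" and yle: "liminf (\<lambda>k. set_cost n (S k) y) \<le>
      liminf (\<lambda>k. ennreal a1 * neg_ln (?P (S k))) + (ennreal a2 * neg_ln (?P B) + ennreal e)"
    by auto
  have "liminf (\<lambda>k. ennreal a1 * neg_ln (?P (S k))) \<le> liminf (\<lambda>k. ennreal a1 * neg_ln (?P K))"
    using Sm sP KS K(4)
    by (intro Liminf_mono always_eventually allI mult_left_mono neg_ln_antimono P.finite_measure_mono) auto
  also have "\<dots> = ennreal a1 * neg_ln (?P K)" by (simp add: Liminf_const)
  finally have "liminf (\<lambda>k. set_cost n (S k) y) \<le> ennreal a1 * neg_ln (?P K) + (ennreal a2 * neg_ln (?P B) + ennreal e)"
    using yle add_right_mono order_trans by blast
  also have "\<dots> = ennreal R"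
    using K(4) B(2) a e lnK unfolding R_def neg_ln_def
    by (simp only: ennreal_plus ennreal_mult mult_nonneg_nonneg add_nonneg_nonneg less_imp_le not_le[symmetric] if_False add.assoc)
  also have "\<dots> < ennreal (R + e)" using R0 e by (simp add: ennreal_less_iff)
  finally have lim: "liminf (\<lambda>k. set_cost n (S k) y) < ennreal (R + e)" .
  have "\<exists>k\<ge>j. set_cost n (S k) y < ennreal (R + e)" for j
  proof (rule ccontr)
    assume "\<not> ?thesis"
    then have "eventually (\<lambda>k. ennreal (R + e) \<le> set_cost n (S k) y) sequentially"
      unfolding eventually_sequentially by (intro exI[of _ j]) auto
    then have "ennreal (R + e) \<le> liminf (\<lambda>k. set_cost n (S k) y)" by (rule Liminf_bounded)
    then show False using lim by simp
  qed
  then obtain k where k: "\<And>j. j \<le> k j" "\<And>j. set_cost n (S (k j)) y < ennreal (R + e)" by metis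
  have "\<forall>j. \<exists>q. q \<in> admissible n \<and> emeasure q (S (k j)) = 1 \<and> cost_n c n y q \<le> R + e"
  proof
    fix j
    obtain q where q: "q \<in> admissible n" "emeasure q (S (k j)) = 1" "ennreal (cost_n c n y q) < ennreal (R + e)"
      using k(2)[of j] unfolding set_cost_def INF_less_iff by auto
    then show "\<exists>q. q \<in> admissible n \<and> emeasure q (S (k j)) = 1 \<and> cost_n c n y q \<le> R + e"
      using cost_n_nonneg[OF q(1)] by (auto simp: ennreal_less_iff)
  qed
  from choice[OF this] obtain q where
    q': "\<forall>j. q j \<in> admissible n \<and> emeasure (q j) (S (k j)) = 1 \<and> cost_n c n y (q j) \<le> R + e" ..
  then have q: "\<And>j. q j \<in> admissible n" "\<And>j. emeasure (q j) (S (k j)) = 1" "\<And>j. cost_n c n y (q j) \<le> R + e"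
    by blast+
  have qp: "prob_space (q j)" "sets (q j) = sets (Xn n)" for j
    using q(1)[of j] by (auto simp: admissible_def space_prob_algebra)
  have idq: "(\<lambda>x. x) \<in> q j \<rightarrow>\<^sub>M borel" for j
    using id_Xn_measurable by (simp add: measurable_cong_sets[OF qp(2) refl])
  have AEq: "AE x in q j. x \<in> S (k j)" for j
    using prob_space.AE_in_set_eq_1[OF qp(1)] Sm qp(2) q(2)[of j] by (simp add: measure_def)
  define p where "p j = distr (q j) borel (\<lambda>x. x)" for j
  have Lm: "L \<in> sets borel" using compact_imp_closed[OF L] by simp
  have p: "prob_space (p j)" "sets (p j) = sets borel" "AE x in p j. x \<in> L" for j
  proof -
    show "prob_space (p j)" unfolding p_def by (rule prob_space.prob_space_distr[OF qp(1) idq])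
    show "sets (p j) = sets borel" by (simp add: p_def)
    have "AE x in q j. x \<in> L" using AEq[of j] by eventually_elim (rule near)
    then show "AE x in p j. x \<in> L" unfolding p_def using Lm by (subst AE_distr_iff[OF idq]) auto
  qed
  obtain r :: "nat \<Rightarrow> nat" and pl where r: "strict_mono r" and pl: "prob_space pl" "sets pl = sets borel" "AE x in pl. x \<in> L"
    and conv: "\<And>\<phi> :: (nat \<Rightarrow> 'a) \<Rightarrow> real. continuous_on UNIV \<phi> \<Longrightarrow> (\<lambda>j. \<integral>x. \<phi> x \<partial>p (r j)) \<longlonglongrightarrow> (\<integral>x. \<phi> x \<partial>pl)"
    using weakly_compact_prob_on_compact[of L p, OF L p] by blast
  interpret pl: prob_space pl by fact
  note pl(2)[measurable_cong]
  have Kne: "K \<noteq> {}" using K(4) by auto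
  have AEpl: "AE x in pl. x \<in> K"
  proof -
    \<comment> \<open>The truncated distance to \<open>K\<close> has integral at most
      \<open>2 / (j + 1)\<close> under \<open>p j\<close>, so it vanishes almost surely in the
      limit.\<close>
    define f where "f x = min 1 (infdist x K)" for x
    have cf: "continuous_on UNIV f" unfolding f_def by (intro continuous_intros)
    have f01: "0 \<le> f x" "f x \<le> 1" for x by (auto simp: f_def infdist_nonneg)
    have [measurable]: "f \<in> borel_measurable borel" by (rule borel_measurable_continuous_onI[OF cf])
    have [measurable]: "f \<in> borel_measurable pl" by (simp add: measurable_cong_sets[OF pl(2) refl])
    have "(\<integral>x. f x \<partial>p j) \<le> 2 * (1 / real (Suc j))" for j
    proof -
      interpret q: prob_space "q j" by (rule qp)
      have [measurable]: "f \<in> borel_measurable (q j)"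
        using measurable_compose[OF idq \<open>f \<in> borel_measurable borel\<close>] .
      have "(\<integral>x. f x \<partial>p j) = (\<integral>x. f x \<partial>q j)" unfolding p_def by (rule integral_distr[OF idq]) simp
      also have "\<dots> \<le> (\<integral>x. 2 * (1 / real (Suc j)) \<partial>q j)"
      proof (rule integral_mono_AE)
        show "integrable (q j) f" using f01 by (intro q.integrable_const_bound[of _ 1]) auto
        show "AE x in q j. f x \<le> 2 * (1 / real (Suc j))"
          using AEq[of j]
        proof eventually_elim
          case (elim x)
          then obtain x' where x': "x' \<in> K" "dist x x' \<le> 2 * (1 / real (Suc (k j)))" using near by blast
          have "f x \<le> infdist x K" by (simp add: f_def)
          also have "\<dots> \<le> dist x x'" by (rule infdist_le[OF x'(1)])
          also note x'(2)
          also have "2 * (1 / real (Suc (k j))) \<le> 2 * (1 / real (Suc j))"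
            using k(1)[of j] by (intro mult_left_mono divide_left_mono) auto
          finally show ?case .
        qed
      qed simp
      finally show ?thesis by (simp add: q.prob_space)
    qed
    moreover have "(\<lambda>j. 2 * (1 / real (Suc (r j)))) \<longlonglongrightarrow> 2 * 0"
      using LIMSEQ_subseq_LIMSEQ[OF LIMSEQ_inverse_real_of_nat r]
      by (intro tendsto_mult tendsto_const) (simp add: comp_def inverse_eq_divide)
    ultimately have "(\<integral>x. f x \<partial>pl) \<le> 2 * 0"
      by (intro LIMSEQ_le[OF conv[OF cf]]) auto
    moreover have "0 \<le> (\<integral>x. f x \<partial>pl)" using f01 by (intro Bochner_Integration.integral_nonneg)
    ultimately have "(\<integral>x. f x \<partial>pl) = 0" by simp
    moreover have "integrable pl f" using f01 by (intro pl.integrable_const_bound[of _ 1]) auto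
    ultimately have "AE x in pl. f x = 0" using f01 by (simp add: integral_nonneg_eq_0_iff_AE)
    then show ?thesis
    proof eventually_elim
      case (elim x)
      then have "infdist x K = 0" by (auto simp: f_def min_def split: if_splits)
      then show ?case using in_closed_iff_infdist_zero[OF compact_imp_closed[OF K(1)] Kne] by simp
    qed
  qed
  \<comment> \<open>Returns the limit from the function type to \<open>Xn n\<close>; it lives on
    \<open>K\<close>, where \<open>restr n\<close> is the identity.\<close>
  define ql where "ql = distr pl (Xn n) (restr n)"
  have rm: "restr n \<in> pl \<rightarrow>\<^sub>M Xn n" by (simp add: measurable_cong_sets[OF pl(2) refl])
  have qlp: "prob_space ql" unfolding ql_def by (rule pl.prob_space_distr[OF rm])
  have l1: "(\<lambda>x. l1_dist n x x0) \<in> borel_measurable (Xn n)"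
    using measurable_compose[OF id_Xn_measurable borel_measurable_continuous_onI[OF continuous_l1_dist]] .
  have glm: "(\<lambda>x. \<gamma> (l1_dist n x x0)) \<in> borel_measurable (Xn n)"
    by (rule gamma_measurable[OF l1]) (simp add: l1_dist_def sum_nonneg)
  have "(\<integral>\<^sup>+x. ennreal (\<gamma> (l1_dist n x x0)) \<partial>ql) = (\<integral>\<^sup>+x. ennreal (\<gamma> (l1_dist n (restr n x) x0)) \<partial>pl)"
    unfolding ql_def using glm by (intro nn_integral_distr rm) auto
  also have "\<dots> \<le> (\<integral>\<^sup>+x. ennreal M \<partial>pl)"
  proof (rule nn_integral_mono_AE)
    show "AE x in pl. ennreal (\<gamma> (l1_dist n (restr n x) x0)) \<le> ennreal M"
      using AEpl
    proof eventually_elim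
      case (elim x)
      then have "restr n x = x" using KX restr_id by blast
      then show ?case using K(5)[OF elim] by (simp add: ennreal_leI)
    qed
  qed
  also have "\<dots> < \<infinity>" by (simp add: pl.emeasure_space_1)
  finally have qlP: "ql \<in> P_gamma \<gamma> (Xn n) (l1_dist n)"
    using qlp x0 by (auto simp: P_gamma_def space_prob_algebra ql_def)
  have AEql: "AE x in ql. x \<in> A"
    unfolding ql_def using A
  proof (subst AE_distr_iff[OF rm])
    show "AE x in pl. restr n x \<in> A" using AEpl
    proof eventually_elim
      case (elim x)
      then have "restr n x = x" using KX restr_id by blast
      then show ?case using elim K(3) by auto
    qed
  qed (use A in auto)
  have qlA: "emeasure ql A = 1"
    using prob_space.emeasure_eq_1_AE[OF qlp _ AEql] A by (simp add: ql_def)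
  have marg: "(\<lambda>j. \<integral>x. \<phi> x \<partial>marginal i (q (r j))) \<longlonglongrightarrow> (\<integral>x. \<phi> x \<partial>marginal i ql)"
    if i: "i < n" and \<phi>: "\<phi> \<in> Phi_gamma \<gamma> borel dist" for i and \<phi> :: "'a \<Rightarrow> real"
  proof -
    have c1: "continuous_on UNIV \<phi>" by (rule Phi_continuous[OF \<phi>])
    have c2: "continuous_on UNIV (\<lambda>x :: nat \<Rightarrow> 'a. \<phi> (x i))"
      by (rule continuous_on_compose2[OF c1 continuous_on_product_coordinates]) auto
    have \<phi>m: "\<phi> \<in> borel_measurable borel" by (rule borel_measurable_continuous_onI[OF c1])
    have \<phi>m2: "(\<lambda>x :: nat \<Rightarrow> 'a. \<phi> (x i)) \<in> borel_measurable borel" by (rule borel_measurable_continuous_onI[OF c2])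
    have 1: "(\<integral>x. \<phi> x \<partial>marginal i (q j)) = (\<integral>x. \<phi> (x i) \<partial>p j)" for j
    proof -
      have "(\<lambda>x. x i) \<in> q j \<rightarrow>\<^sub>M borel"
        using component_measurable_Xn[OF i] by (simp add: measurable_cong_sets[OF qp(2) refl])
      then have "(\<integral>x. \<phi> x \<partial>marginal i (q j)) = (\<integral>x. \<phi> (x i) \<partial>q j)"
        unfolding marginal_def using \<phi>m by (intro integral_distr) auto
      also have "\<dots> = (\<integral>x. \<phi> (x i) \<partial>p j)"
        unfolding p_def using \<phi>m2 by (intro integral_distr[symmetric] idq) auto
      finally show ?thesis .
    qed
    have "(\<integral>x. \<phi> x \<partial>marginal i ql) = (\<integral>x. \<phi> (x i) \<partial>ql)"
      unfolding marginal_def using \<phi>m component_measurable_Xn[OF i] by (intro integral_distr) (auto simp: ql_def)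
    also have "\<dots> = (\<integral>x. \<phi> (restr n x i) \<partial>pl)"
      unfolding ql_def using measurable_compose[OF component_measurable_Xn[OF i] \<phi>m] by (intro integral_distr rm) auto
    also have "\<dots> = (\<integral>x. \<phi> (x i) \<partial>pl)" using i by (simp add: restr_def)
    finally show ?thesis using conv[OF c2] 1 by simp
  qed
  have qi: "marginal i (q j) \<in> Pg" if "i < n" for i j using q(1)[of j] that by (simp add: admissible_def)
  have "cost_n c n y ql \<le> R + e"
  proof (rule field_le_epsilon)
    fix d :: real assume d: "0 < d"
    \<comment> \<open>The loss \<open>d\<close> is shared among the coordinates;
      \<open>Suc n\<close> instead of \<open>n\<close> also covers \<open>n = 0\<close>.\<close>
    have d': "0 < d / real (Suc n)" using d by simp
    have "eventually (\<lambda>j. \<forall>i\<in>{..<n}. c (y i) (marginal i ql) - d / real (Suc n) \<le> c (y i) (marginal i (q (r j)))) sequentially"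
    proof (rule eventually_ball_finite, simp, rule ballI)
      fix i assume "i \<in> {..<n}"
      then have i: "i < n" by simp
      show "eventually (\<lambda>j. c (y i) (marginal i ql) - d / real (Suc n) \<le> c (y i) (marginal i (q (r j)))) sequentially"
        by (rule cost_eventually_ge[OF marginals[OF i qlP] qi[OF i] d' marg[OF i]])
    qed
    then obtain j where j: "\<forall>i\<in>{..<n}. c (y i) (marginal i ql) - d / real (Suc n) \<le> c (y i) (marginal i (q (r j)))"
      by (auto simp: eventually_sequentially)
    have "cost_n c n y ql - real n * (d / real (Suc n)) = (\<Sum>i<n. c (y i) (marginal i ql) - d / real (Suc n))"
      by (simp add: cost_n_def sum_subtractf)
    also have "\<dots> \<le> cost_n c n y (q (r j))" unfolding cost_n_def using j by (intro sum_mono) auto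
    also have "\<dots> \<le> R + e" by (rule q(3))
    finally have "cost_n c n y ql \<le> R + e + real n * (d / real (Suc n))" by simp
    also have "real n * (d / real (Suc n)) \<le> d" using d by (simp add: field_simps)
    finally show "cost_n c n y ql \<le> R + e + d" by simp
  qed
  moreover have "cost_to_set \<gamma> c n A y \<le> ereal (cost_n c n y ql)"
    unfolding cost_to_set_def using qlP qlA by (intro INF_lower) auto
  ultimately have "ereal t < ereal (R + e)"
    using B(3)[OF y] by (meson ereal_less_eq(3) less_le_trans order_trans)
  then show ?thesis by (simp add: R_def)
qed

text \<open>In logarithmic form the compact case passes to \<open>A\<close> by inner regularity. It
  then bounds the measure of every measurable subset of the complement, hence the inner
  measure.\<close>

lemma enlargement_bound:
  assumes T: "T_inequality \<gamma> c a1 a2 \<mu>" and \<mu>: "\<mu> \<in> Pg" and a: "0 < a1" "0 < a2"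
    and A: "A \<in> sets (Xn n)"
  shows "inner_prob (power_measure n \<mu>) (space (Xn n) - enlargement \<gamma> c n A t) powr a2
      * measure (power_measure n \<mu>) A powr a1 \<le> exp (- t)"
proof (cases "measure (power_measure n \<mu>) A = 0")
  case False
  interpret prob_space \<mu> using PgD[OF \<mu>] by simp
  have s\<mu>: "sets \<mu> = sets borel" using PgD[OF \<mu>] by simp
  interpret P: prob_space "power_measure n \<mu>" by (rule prob_space_power_measure) unfold_locales
  let ?P = "measure (power_measure n \<mu>)"
  have sP: "sets (power_measure n \<mu>) = sets (Xn n)" by (rule sets_power_measure[OF s\<mu>])
  have PA: "0 < ?P A" using False by (simp add: zero_less_measure_iff)
  \<comment> \<open>The largest value of \<open>?P B\<close> allowed by
    \<open>t \<le> - a1 * ln (?P A) - a2 * ln (?P B)\<close>.\<close>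
  define b where "b = exp ((- t - a1 * ln (?P A)) / a2)"
  define x0 :: "nat \<Rightarrow> 'a" where "x0 = restr n undefined"
  have x0: "x0 \<in> space (Xn n)" unfolding x0_def by (rule restr_space)
  have "?P B \<le> b" if B: "B \<in> sets (power_measure n \<mu>)" "B \<subseteq> space (Xn n) - enlargement \<gamma> c n A t" for B
  proof (cases "?P B = 0")
    case False
    then have PB: "0 < ?P B" by (simp add: zero_less_measure_iff)
    have B1: "B \<in> sets (Xn n)" using B(1) sP by simp
    have B3: "ereal t < cost_to_set \<gamma> c n A y" if "y \<in> B" for y
      using B(2) that by (auto simp: enlargement_def not_le)
    have "t \<le> a1 * - ln (?P A) + a2 * - ln (?P B)"
    proof (rule field_le_epsilon)
      fix d :: real assume d: "0 < d"
      \<comment> \<open>The compact case loses \<open>2 * e\<close>, and shrinking \<open>A\<close>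
        to a set of measure above \<open>?P A * exp (- e)\<close> loses
        \<open>a1 * e\<close>.\<close>
      define e where "e = d / (2 + a1)"
      have e: "0 < e" using d a by (simp add: e_def)
      have "?P A * exp (- e) < ?P A * 1" using PA e by (intro mult_strict_left_mono) auto
      then have lt: "?P A * exp (- e) < ?P A" by simp
      obtain K M where K: "compact K" "K \<subseteq> A" "?P A * exp (- e) < ?P K" "K \<in> sets (Xn n)"
          "\<And>x. x \<in> K \<Longrightarrow> \<gamma> (l1_dist n x x0) \<le> M"
        using inner_compact_bounded[OF P.prob_space_axioms sP A _ lt, of x0] PA by auto
      have PK: "0 < ?P K" using K(3) PA by (smt (verit) exp_gt_zero mult_pos_pos)
      have "t \<le> a1 * - ln (?P K) + a2 * - ln (?P B) + 2 * e"
        by (rule enlargement_complement_bound_compact[OF T \<mu> a K(1,4,2) PK K(5) x0 A B1 PB B3 e])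
      moreover have "ln (?P A * exp (- e)) \<le> ln (?P K)" using K(3) PA PK by simp
      then have "ln (?P A) - e \<le> ln (?P K)" using PA by (simp add: ln_mult)
      then have "a1 * (ln (?P A) - e) \<le> a1 * ln (?P K)" using a by (intro mult_left_mono) auto
      moreover have "(2 + a1) * e = d" using a by (simp add: e_def)
      ultimately show "t \<le> a1 * - ln (?P A) + a2 * - ln (?P B) + d" by (simp add: algebra_simps)
    qed
    then have "ln (?P B) \<le> (- t - a1 * ln (?P A)) / a2" using a by (simp add: field_simps)
    then show ?thesis unfolding b_def using PB exp_le_cancel_iff[of "ln (?P B)"] by simp
  qed (simp add: b_def)
  then have "inner_prob (power_measure n \<mu>) (space (Xn n) - enlargement \<gamma> c n A t) \<le> b"
    unfolding inner_prob_def by (intro cSUP_least) auto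
  moreover have "0 \<le> inner_prob (power_measure n \<mu>) (space (Xn n) - enlargement \<gamma> c n A t)"
    by (rule inner_prob_bounds[OF P.prob_space_axioms])
  ultimately have "inner_prob (power_measure n \<mu>) (space (Xn n) - enlargement \<gamma> c n A t) powr a2 \<le> b powr a2"
    using a by (intro powr_mono2) auto
  also have "\<dots> = exp (- t - a1 * ln (?P A))" using a by (simp add: b_def powr_def)
  finally have "inner_prob (power_measure n \<mu>) (space (Xn n) - enlargement \<gamma> c n A t) powr a2 * ?P A powr a1
      \<le> exp (- t - a1 * ln (?P A)) * exp (a1 * ln (?P A))"
    using PA by (simp add: powr_def mult_right_mono)
  also have "\<dots> = exp (- t)" by (simp flip: exp_add)
  finally show ?thesis .
qed simp

end

section \<open>From enlargements to functions\<close>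

lemma Phi_gamma_Xn_measurable:
  fixes \<phi> :: "(nat \<Rightarrow> 'a::{metric_space, second_countable_topology}) \<Rightarrow> real"
  assumes "\<phi> \<in> Phi_gamma \<gamma> (Xn n) (l1_dist n)"
  shows "\<phi> \<in> borel_measurable (Xn n)"
proof (rule borel_measurableI)
  fix U :: "real set" assume U: "open U"
  interpret M: Metric_space "space (Xn n) :: (nat \<Rightarrow> 'a) set" "l1_dist n" by (rule Metric_space_l1)
  have "continuous_map M.mtopology euclideanreal \<phi>" using assms by (simp add: Phi_gamma_def)
  then have "openin M.mtopology {x \<in> topspace M.mtopology. \<phi> x \<in> U}"
    using U by (intro openin_continuous_map_preimage[of _ euclideanreal]) auto
  moreover have "{x \<in> topspace M.mtopology. \<phi> x \<in> U} = \<phi> -` U \<inter> space (Xn n)" by auto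
  ultimately show "\<phi> -` U \<inter> space (Xn n) \<in> sets (Xn n)"
    unfolding sets_Xn_eq_borel by (auto intro: sigma_sets.Basic)
qed

lemma inf_conv_le_cost_to_set:
  fixes \<phi> :: "(nat \<Rightarrow> 'a::polish_space) \<Rightarrow> real"
  assumes \<phi>: "\<phi> \<in> Phi_gamma \<gamma> (Xn n) (l1_dist n)" "\<And>x. x \<in> space (Xn n) \<Longrightarrow> 0 \<le> \<phi> x"
  shows "inf_conv (P_gamma \<gamma> (Xn n) (l1_dist n)) (cost_n c n) \<phi> x
    \<le> cost_to_set \<gamma> c n {x \<in> space (Xn n). \<phi> x \<le> v} x + ereal v"
proof -
  let ?A = "{x \<in> space (Xn n). \<phi> x \<le> v}"
  note m = Phi_gamma_Xn_measurable[OF \<phi>(1)]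
  have A: "?A \<in> sets (Xn n)" using m by measurable
  have "inf_conv (P_gamma \<gamma> (Xn n) (l1_dist n)) (cost_n c n) \<phi> x - ereal v \<le> cost_to_set \<gamma> c n ?A x"
    unfolding cost_to_set_def
  proof (rule INF_greatest, safe)
    fix p assume p: "p \<in> P_gamma \<gamma> (Xn n) (l1_dist n)" and pA: "emeasure p ?A = 1"
    have sp: "sets p = sets (Xn n)" and "prob_space p" using p by (auto simp: P_gamma_def space_prob_algebra)
    interpret p: prob_space p by fact
    have mp: "\<phi> \<in> borel_measurable p" using m by (simp add: measurable_cong_sets[OF sp refl])
    have AE: "AE x in p. x \<in> ?A"
      using p.AE_in_set_eq_1[of ?A] A sp pA by (simp add: measure_def)
    \<comment> \<open>Nonnegativity makes \<phi> almost surely bounded under \<open>p\<close>, so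
      its Bochner integral is genuine and at most \<open>v\<close>.\<close>
    have AE1: "AE x in p. norm (\<phi> x) \<le> v" and AE2: "AE x in p. \<phi> x \<le> v"
      using AE by (eventually_elim, use \<phi>(2) in auto)+
    have i: "integrable p \<phi>" by (rule p.integrable_const_bound[OF AE1 mp])
    have "(\<integral>x. \<phi> x \<partial>p) \<le> (\<integral>x. v \<partial>p)" by (rule integral_mono_AE[OF i _ AE2]) simp
    then have "(\<integral>x. \<phi> x \<partial>p) \<le> v" by (simp add: p.prob_space)
    have "inf_conv (P_gamma \<gamma> (Xn n) (l1_dist n)) (cost_n c n) \<phi> x \<le> ereal ((\<integral>x. \<phi> x \<partial>p) + cost_n c n x p)"
      unfolding inf_conv_def by (rule INF_lower[OF p])
    also have "\<dots> \<le> ereal (cost_n c n x p) + ereal v" using \<open>(\<integral>x. \<phi> x \<partial>p) \<le> v\<close> by simp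
    finally show "inf_conv (P_gamma \<gamma> (Xn n) (l1_dist n)) (cost_n c n) \<phi> x - ereal v \<le> ereal (cost_n c n x p)"
      by (simp add: ereal_minus_le)
  qed
  then show ?thesis by (simp add: ereal_minus_le)
qed

text \<open>For \<open>v \<le> u\<close> the set bound is used at \<open>t = u - v\<close>. For
  \<open>u < v\<close> this time is negative, but the left side is at most 1 and the exponential is
  at least 1; this is the origin of \<open>max K 1\<close>.\<close>

lemma functional_bound_of_set_bound:
  fixes \<phi> :: "(nat \<Rightarrow> 'a::polish_space) \<Rightarrow> real" and \<mu> :: "'a measure"
  assumes \<mu>: "prob_space \<mu>" and a: "0 \<le> a1" "0 \<le> a2"
    and K: "\<And>A t. A \<in> sets (Xn n) \<Longrightarrow> 0 \<le> t \<Longrightarrow>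
        inner_prob (power_measure n \<mu>) (space (Xn n) - enlargement \<gamma> c n A t) powr a2
          * measure (power_measure n \<mu>) A powr a1 \<le> K * exp (- t)"
    and \<phi>: "\<phi> \<in> Phi_gamma \<gamma> (Xn n) (l1_dist n)" "\<And>x. x \<in> space (Xn n) \<Longrightarrow> 0 \<le> \<phi> x"
  shows "inner_prob (power_measure n \<mu>)
        {x \<in> space (Xn n). inf_conv (P_gamma \<gamma> (Xn n) (l1_dist n)) (cost_n c n) \<phi> x > ereal u} powr a2
      * measure (power_measure n \<mu>) {x \<in> space (Xn n). \<phi> x \<le> v} powr a1 \<le> max K 1 * exp (- u + v)"
    (is "inner_prob ?P ?S powr a2 * measure ?P ?A powr a1 \<le> _")
proof -
  have P: "prob_space ?P" by (rule prob_space_power_measure[OF \<mu>])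
  interpret P: prob_space ?P by fact
  show ?thesis
  proof (cases "v \<le> u")
    case True
    have A: "?A \<in> sets (Xn n)" using Phi_gamma_Xn_measurable[OF \<phi>(1)] by measurable
    have "?S \<subseteq> space (Xn n) - enlargement \<gamma> c n ?A (u - v)"
    proof safe
      fix x assume "ereal u < inf_conv (P_gamma \<gamma> (Xn n) (l1_dist n)) (cost_n c n) \<phi> x"
        and "x \<in> enlargement \<gamma> c n ?A (u - v)"
      then have "ereal u < cost_to_set \<gamma> c n ?A x + ereal v" "cost_to_set \<gamma> c n ?A x \<le> ereal (u - v)"
        using inf_conv_le_cost_to_set[OF \<phi>, of c x v] by (auto simp: enlargement_def)
      then have "ereal u < ereal (u - v) + ereal v" using add_right_mono less_le_trans by blast
      then show False by simp
    qed
    then have "inner_prob ?P ?S powr a2 * measure ?P ?A powr a1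
        \<le> inner_prob ?P (space (Xn n) - enlargement \<gamma> c n ?A (u - v)) powr a2 * measure ?P ?A powr a1"
      using a inner_prob_bounds[OF P] by (intro mult_right_mono powr_mono2 inner_prob_mono[OF P]) auto
    also have "\<dots> \<le> K * exp (- (u - v))" using A True by (intro K) auto
    also have "\<dots> \<le> max K 1 * exp (- u + v)" by (simp add: mult_right_mono)
    finally show ?thesis .
  next
    case False
    have "inner_prob ?P ?S powr a2 * measure ?P ?A powr a1 \<le> 1 * 1"
      using a inner_prob_bounds[OF P] P.prob_le_1 by (intro mult_mono powr_le1) auto
    also have "\<dots> \<le> max K 1 * exp (- u + v)" using False by (intro mult_mono) auto
    finally show ?thesis .
  qed
qed

section \<open>Entropy duality and a dominant layer of an exponential moment\<close>

lemma (in prob_space) integral_exp_pos: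
  assumes "integrable M (\<lambda>x. exp (g x))"
  shows "0 < (\<integral>x. exp (g x) \<partial>M :: real)"
proof -
  have "(\<integral>x. exp (g x) \<partial>M :: real) \<noteq> 0"
  proof
    assume "(\<integral>x. exp (g x) \<partial>M :: real) = 0"
    then have "AE x in M. exp (g x) = (0::real)"
      using assms by (subst (asm) integral_nonneg_eq_0_iff_AE) auto
    then show False using AE_False by simp
  qed
  moreover have "0 \<le> (\<integral>x. exp (g x) \<partial>M :: real)" by (intro Bochner_Integration.integral_nonneg) simp
  ultimately show ?thesis by linarith
qed

text \<open>The Donsker-Varadhan inequality. With \<open>D\<close> the density of \<nu> and
  \<open>Z\<close> the exponential moment, integrate \<open>ln h \<le> h - 1\<close> for
  \<open>h = exp g / (Z * D)\<close> against \<nu>; the integral of \<open>h\<close> is at most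
  1.\<close>

lemma gibbs_variational:
  fixes g :: "'b \<Rightarrow> real"
  assumes "prob_space \<mu>" "prob_space \<nu>" and s: "sets \<nu> = sets \<mu>" and ac: "absolutely_continuous \<mu> \<nu>"
    and ent: "integrable \<nu> (entropy_density (exp 1) \<mu> \<nu>)"
    and g: "integrable \<nu> g" and eg: "integrable \<mu> (\<lambda>x. exp (g x))" and gm[measurable]: "g \<in> borel_measurable \<mu>"
  shows "(\<integral>x. g x \<partial>\<nu>) \<le> KL_divergence (exp 1) \<mu> \<nu> + ln (\<integral>x. exp (g x) \<partial>\<mu>)"
proof -
  interpret \<mu>: prob_space \<mu> by fact
  interpret \<nu>: prob_space \<nu> by fact
  have fin: "finite_measure \<nu>" by (rule \<nu>.finite_measure_axioms)
  obtain D where D[measurable]: "D \<in> borel_measurable \<mu>" and RN: "AE x in \<mu>. RN_deriv \<mu> \<nu> x = ennreal (D x)"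
    and Dpos: "AE x in \<nu>. 0 < D x" and D0: "\<And>x. 0 \<le> D x"
    using \<mu>.real_RN_deriv[OF fin ac s] by metis
  have dens: "\<nu> = density \<mu> (\<lambda>x. ennreal (D x))"
  proof -
    have "\<nu> = density \<mu> (RN_deriv \<mu> \<nu>)" using \<mu>.density_RN_deriv[OF ac s] by simp
    also have "\<dots> = density \<mu> (\<lambda>x. ennreal (D x))" by (rule density_cong) (use RN in auto)
    finally show ?thesis .
  qed
  have m\<nu>: "f \<in> borel_measurable \<nu>" if "f \<in> borel_measurable \<mu>" for f :: "'b \<Rightarrow> real"
    using that by (simp add: measurable_cong_sets[OF s refl])
  have "AE x in \<nu>. RN_deriv \<mu> \<nu> x = ennreal (D x)" by (rule absolutely_continuous_AE[OF s ac RN])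
  then have ed: "AE x in \<nu>. entropy_density (exp 1) \<mu> \<nu> x = ln (D x)"
    by eventually_elim (simp add: entropy_density_def D0 log_ln[symmetric])
  have iD: "integrable \<nu> (\<lambda>x. ln (D x))"
    using ent ed m\<nu>[of "\<lambda>x. ln (D x)"] m\<nu>[OF measurable_entropy_density]
    by (subst (asm) integrable_cong_AE[where g = "\<lambda>x. ln (D x)"]) auto
  have KL: "KL_divergence (exp 1) \<mu> \<nu> = (\<integral>x. ln (D x) \<partial>\<nu>)"
    unfolding KL_divergence_def
    using ed m\<nu>[of "\<lambda>x. ln (D x)"] m\<nu>[OF measurable_entropy_density] by (intro integral_cong_AE) auto
  define Z where "Z = (\<integral>x. exp (g x) \<partial>\<mu>)"
  have Z: "0 < Z" unfolding Z_def by (rule \<mu>.integral_exp_pos[OF eg])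
  define h where "h x = exp (g x) / (Z * D x)" for x
  have hm: "h \<in> borel_measurable \<mu>" unfolding h_def by measurable
  have h0: "0 \<le> h x" for x using Z D0 by (simp add: h_def)
  have hi: "(\<integral>\<^sup>+x. ennreal (h x) \<partial>\<nu>) \<le> 1"
  proof -
    have "(\<integral>\<^sup>+x. ennreal (h x) \<partial>\<nu>) = (\<integral>\<^sup>+x. ennreal (D x) * ennreal (h x) \<partial>\<mu>)"
      unfolding dens using hm by (intro nn_integral_density) auto
    \<comment> \<open>Only an inequality: where \<open>D\<close> vanishes, so does the left
      integrand.\<close>
    also have "\<dots> \<le> (\<integral>\<^sup>+x. ennreal (exp (g x) / Z) \<partial>\<mu>)"
      using Z D0 h0 by (intro nn_integral_mono) (auto simp: h_def ennreal_mult[symmetric] intro!: ennreal_leI)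
    also have "\<dots> = ennreal (\<integral>x. exp (g x) / Z \<partial>\<mu>)"
      using eg Z by (intro nn_integral_eq_integral) auto
    also have "(\<integral>x. exp (g x) / Z \<partial>\<mu>) = 1" using Z by (simp add: Z_def)
    finally show ?thesis by simp
  qed
  have ih: "integrable \<nu> h"
    using hi h0 by (intro integrableI_bounded m\<nu>[OF hm]) (auto intro: le_less_trans)
  have "(\<integral>x. h x \<partial>\<nu>) \<le> 1"
    using hi h0 nn_integral_eq_integral[OF ih] by (simp add: Bochner_Integration.integral_nonneg)
  have "(\<integral>x. g x - ln Z - ln (D x) \<partial>\<nu>) \<le> (\<integral>x. h x - 1 \<partial>\<nu>)"
  proof (rule integral_mono_AE)
    show "AE x in \<nu>. g x - ln Z - ln (D x) \<le> h x - 1"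
      using Dpos
    proof eventually_elim
      case (elim x)
      then have "ln (h x) = g x - ln Z - ln (D x)" "0 < h x"
        using Z by (simp_all add: h_def ln_div ln_mult)
      then show ?case using ln_le_minus_one[of "h x"] by simp
    qed
  qed (use g iD ih in auto)
  also have "\<dots> \<le> 0" using ih \<open>(\<integral>x. h x \<partial>\<nu>) \<le> 1\<close> by (simp add: \<nu>.prob_space)
  finally show ?thesis using g iD by (simp add: KL Z_def \<nu>.prob_space)
qed

text \<open>A converse to Markov's inequality. Below level \<open>- N\<close> at most half of the
  exponential moment is found; above it, \<open>N + m\<close> layers of unit height cover the range
  of \<open>Y\<close>, and one of them must carry the average share of the other half.\<close>

lemma (in prob_space) exponential_layer:
  fixes Y :: "'a \<Rightarrow> real"
  assumes Y[measurable]: "Y \<in> borel_measurable M" and ub: "\<And>x. Y x \<le> real m" and a: "0 < a"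
    and N: "exp (- real N / a) \<le> (\<integral>x. exp (Y x / a) \<partial>M) / 2" and pos: "0 < N + m"
  shows "\<exists>j :: int. (\<integral>x. exp (Y x / a) \<partial>M) / (2 * real (N + m)) \<le> exp ((real_of_int j + 1) / a) * prob {x \<in> space M. real_of_int j < Y x}"
proof (rule ccontr)
  assume "\<not> ?thesis"
  let ?E = "\<integral>x. exp (Y x / a) \<partial>M"
  let ?J = "{- int N..<int m}"
  from \<open>\<not> ?thesis\<close> have lt: "exp ((real_of_int j + 1) / a) * prob {x \<in> space M. real_of_int j < Y x} < ?E / (2 * real (N + m))" for j :: int
    by (auto simp: not_le)
  let ?h = "\<lambda>j x. exp ((real_of_int j + 1) / a) * indicator {x \<in> space M. real_of_int j < Y x} x"
  have pt: "exp (Y x / a) \<le> exp (- real N / a) + (\<Sum>j\<in>?J. ?h j x)" if x: "x \<in> space M" for x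
  proof (cases "Y x \<le> - real N")
    case True
    then have "exp (Y x / a) \<le> exp (- real N / a)" using a divide_right_mono[of "Y x" "- real N" a] by simp
    moreover have "0 \<le> (\<Sum>j\<in>?J. ?h j x)" by (intro sum_nonneg) simp
    ultimately show ?thesis by linarith
  next
    case False
    \<comment> \<open>The ceiling minus one, not the floor: the layer has to satisfy
      \<open>j < Y x\<close> strictly, also for integer values.\<close>
    define j where "j = \<lceil>Y x\<rceil> - 1"
    have j: "real_of_int j < Y x" "Y x \<le> real_of_int j + 1" unfolding j_def by linarith+
    have "- int N \<le> j" using False j(2) by linarith
    moreover have "j < int m" using j(1) ub[of x] by linarith
    ultimately have "j \<in> ?J" by simp
    have "exp (Y x / a) \<le> ?h j x" using j x a by (simp add: divide_right_mono)
    also have "\<dots> \<le> (\<Sum>j\<in>?J. ?h j x)" using \<open>j \<in> ?J\<close> by (intro member_le_sum) auto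
    finally show ?thesis using exp_ge_zero[of "- real N / a"] by linarith
  qed
  have ih: "integrable M (?h j)" for j
    by (intro integrable_mult_right integrable_real_indicator) (auto simp: less_top[symmetric])
  have iE: "integrable M (\<lambda>x. exp (Y x / a))"
    using ub a by (intro integrable_const_bound[of _ "exp (real m / a)"]) (auto simp: divide_right_mono)
  have "?E \<le> (\<integral>x. exp (- real N / a) + (\<Sum>j\<in>?J. ?h j x) \<partial>M)"
    by (intro integral_mono iE Bochner_Integration.integrable_add integrable_const Bochner_Integration.integrable_sum ih pt)
  also have "\<dots> = exp (- real N / a) + (\<integral>x. (\<Sum>j\<in>?J. ?h j x) \<partial>M)"
    by (subst Bochner_Integration.integral_add[OF integrable_const Bochner_Integration.integrable_sum[OF ih]])
      (simp add: prob_space)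
  also have "(\<integral>x. (\<Sum>j\<in>?J. ?h j x) \<partial>M) = (\<Sum>j\<in>?J. \<integral>x. ?h j x \<partial>M)"
    by (rule Bochner_Integration.integral_sum[OF ih])
  also have "\<dots> = (\<Sum>j\<in>?J. exp ((real_of_int j + 1) / a) * prob {x \<in> space M. real_of_int j < Y x})"
    by (intro sum.cong refl, subst integral_mult_right_zero) (simp add: Int_def conj_commute)
  also have "(\<Sum>j\<in>?J. exp ((real_of_int j + 1) / a) * prob {x \<in> space M. real_of_int j < Y x}) < (\<Sum>j\<in>?J. ?E / (2 * real (N + m)))"
    using pos lt by (intro sum_strict_mono) auto
  also have "(\<Sum>j\<in>?J. ?E / (2 * real (N + m))) = ?E / 2"
  proof -
    have "real (card ?J) = real (N + m)" by simp
    then have "(\<Sum>j\<in>?J. ?E / (2 * real (N + m))) = real (N + m) * (?E / (2 * real (N + m)))"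
      by (simp only: sum_constant)
    also have "\<dots> = ?E / 2" using pos by (simp add: field_simps flip: of_nat_add)
    finally show ?thesis .
  qed
  finally show False using N by simp
qed

section \<open>From functions to the transport inequality\<close>

text \<open>The \<open>n\<close>-th root in logarithmic form: after division by \<open>n\<close>,
  constants and logarithms of polynomial factors tend to 0.\<close>

lemma nonpos_of_linear_le_ln:
  fixes A B b :: real
  assumes "\<And>n :: nat. 1 \<le> n \<Longrightarrow> real n * A \<le> B + b * ln (real n)"
  shows "A \<le> 0"
proof -
  have "(\<lambda>n. B * (1 / real n) + b * (ln (real n) / real n)) \<longlonglongrightarrow> B * 0 + b * 0"
    by (intro tendsto_add tendsto_mult tendsto_const lim_1_over_n lim_ln_over_n)
  moreover have "A \<le> B * (1 / real n) + b * (ln (real n) / real n)" if "1 \<le> n" for n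
    using assms[OF that] that by (simp add: field_simps)
  ultimately show ?thesis by (intro LIMSEQ_le_const[of _ "0"]) auto
qed

context transport_setting
begin

text \<open>Makes \<open>marginals\<close> quantitative, so that sums of one-coordinate test
  functions have the growth that \<open>Phi_gamma\<close> requires on \<open>X\<^sup>n\<close>.
  Without monotonicity of \<gamma> this domination is not evident. If it failed for every constant,
  points violating it ever more strongly would support a discrete law with finite joint moment whose
  marginal has an infinite one.\<close>

lemma gauge_component_bound:
  fixes x0 :: 'a
  assumes i: "i < n"
  shows "\<exists>D\<ge>0. \<forall>x\<in>space (Xn n). \<gamma> (dist (x i) x0) \<le> D * (1 + \<gamma> (l1_dist n x (restr n (\<lambda>_. x0))))"
proof (rule ccontr)
  assume neg: "\<not> ?thesis"
  let ?o = "restr n (\<lambda>_. x0)"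
  define G where "G x = \<gamma> (dist (x i) x0)" for x :: "nat \<Rightarrow> 'a"
  define H where "H x = \<gamma> (l1_dist n x ?o)" for x :: "nat \<Rightarrow> 'a"
  have H0: "0 \<le> H x" for x by (auto simp: H_def l1_dist_def intro!: gamma_nonneg sum_nonneg)
  have "\<forall>k :: nat. \<exists>x\<in>space (Xn n). 4 ^ k * (1 + H x) < G x"
  proof
    fix k :: nat
    have "\<not> (\<forall>x\<in>space (Xn n). G x \<le> 4 ^ k * (1 + H x))" using neg by (auto simp: G_def H_def)
    then show "\<exists>x\<in>space (Xn n). 4 ^ k * (1 + H x) < G x" by (auto simp: not_le)
  qed
  then obtain x where
    x: "\<And>k :: nat. x k \<in> space (Xn n)" "\<And>k. 4 ^ k * (1 + H (x k)) < G (x k)" by metis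
  have G1: "4 ^ k < G (x k)" for k
  proof -
    have "(4::real) ^ k * 1 \<le> 4 ^ k * (1 + H (x k))" using H0 by (intro mult_left_mono) auto
    then show ?thesis using x(2)[of k] by linarith
  qed
  have G0: "0 < G (x k)" for k using G1[of k] by (rule order_less_trans[rotated]) simp
  \<comment> \<open>Chosen between the two scales: the weights are summable and so are
    \<open>w k * H (x k)\<close>, both bounded by \<open>(1/2) ^ k\<close>, whereas
    \<open>w k * G (x k) = 2 ^ k\<close>.\<close>
  define w where "w k = 2 ^ k / G (x k)" for k
  have w0: "0 < w k" for k using G0 by (simp add: w_def)
  have q: "(2::real) ^ k / 4 ^ k = (1/2) ^ k" for k by (simp flip: power_divide)
  have wle: "w k \<le> (1/2) ^ k" for k
    unfolding w_def q[symmetric] using G1[of k] G0[of k] by (intro divide_left_mono) auto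
  have sw: "summable w"
    by (rule summable_comparison_test'[where N = 0 and g = "\<lambda>k. (1/2) ^ k"]) (use wle w0 in \<open>auto simp: less_imp_le abs_of_pos\<close>)
  define S where "S = suminf w"
  have S: "0 < S" unfolding S_def using sw w0 by (rule suminf_pos)
  define Q where "Q = embed_pmf (\<lambda>k. w k / S)"
  have "(\<integral>\<^sup>+k. ennreal (w k / S) \<partial>count_space UNIV) = (\<Sum>k. ennreal (w k / S))" by (rule nn_integral_count_space_nat)
  also have "\<dots> = ennreal (\<Sum>k. w k / S)"
    using w0 S sw by (intro suminf_ennreal2) (auto simp: less_imp_le)
  also have "(\<Sum>k. w k / S) = 1" using S suminf_divide[OF sw, of S] by (simp add: S_def)
  finally have pQ: "pmf Q k = w k / S" for k
    unfolding Q_def using w0 S by (intro pmf_embed_pmf) (auto simp: less_imp_le)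
  have xm: "x \<in> measure_pmf Q \<rightarrow>\<^sub>M Xn n" using x(1) by simp
  define p where "p = distr (measure_pmf Q) (Xn n) x"
  have pp: "prob_space p" unfolding p_def by (rule measure_pmf.prob_space_distr[OF xm])
  have l1: "(\<lambda>x. l1_dist n x ?o) \<in> borel_measurable (Xn n)"
    using measurable_compose[OF id_Xn_measurable borel_measurable_continuous_onI[OF continuous_l1_dist]] .
  have Hm: "H \<in> borel_measurable (Xn n)"
    unfolding H_def by (rule gamma_measurable[OF l1]) (simp add: l1_dist_def sum_nonneg)
  have "(\<integral>\<^sup>+y. ennreal (H y) \<partial>p) = (\<integral>\<^sup>+k. ennreal (H (x k)) \<partial>measure_pmf Q)"
    unfolding p_def using Hm by (intro nn_integral_distr xm) auto
  also have "\<dots> = (\<Sum>k. ennreal (w k / S) * ennreal (H (x k)))"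
    by (simp add: nn_integral_measure_pmf nn_integral_count_space_nat pQ)
  also have "\<dots> \<le> (\<Sum>k. ennreal ((1/2) ^ k / S))"
  proof (intro suminf_le summableI)
    fix k
    have "4 ^ k * (1 + H (x k)) = 4 ^ k + 4 ^ k * H (x k)" by (simp add: distrib_left)
    moreover have "(0::real) \<le> 4 ^ k" by simp
    ultimately have "4 ^ k * H (x k) \<le> G (x k)" using x(2)[of k] by linarith
    then have "H (x k) / G (x k) \<le> 1 / 4 ^ k" using G0[of k] by (simp add: field_simps)
    then have "2 ^ k * (H (x k) / G (x k)) \<le> 2 ^ k * (1 / 4 ^ k)" by (rule mult_left_mono) simp
    then have "w k * H (x k) \<le> (1/2) ^ k" using q[of k] by (simp add: w_def)
    then have "w k / S * H (x k) \<le> (1/2) ^ k / S" using S by (simp add: divide_right_mono)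
    then show "ennreal (w k / S) * ennreal (H (x k)) \<le> ennreal ((1/2) ^ k / S)"
      using w0[of k] S H0 by (simp add: ennreal_mult[symmetric] ennreal_leI)
  qed
  also have "\<dots> = ennreal (\<Sum>k. (1/2) ^ k / S)"
    using S by (intro suminf_ennreal2 summable_divide summable_geometric) auto
  also have "\<dots> < \<infinity>" by simp
  finally have "p \<in> P_gamma \<gamma> (Xn n) (l1_dist n)"
    using pp restr_space by (auto simp: P_gamma_def space_prob_algebra p_def H_def)
  from marginals[OF i this] have "(\<integral>\<^sup>+y. ennreal (\<gamma> (dist y x0)) \<partial>marginal i p) < \<infinity>"
    by (rule PgD)
  also have "(\<integral>\<^sup>+y. ennreal (\<gamma> (dist y x0)) \<partial>marginal i p) = (\<integral>\<^sup>+k. ennreal (G (x k)) \<partial>measure_pmf Q)"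
  proof -
    have "(\<integral>\<^sup>+y. ennreal (\<gamma> (dist y x0)) \<partial>marginal i p) = (\<integral>\<^sup>+y. ennreal (\<gamma> (dist (y i) x0)) \<partial>p)"
      unfolding marginal_def using component_measurable_Xn[OF i] by (intro nn_integral_distr) (auto simp: p_def)
    also have "\<dots> = (\<integral>\<^sup>+k. ennreal (G (x k)) \<partial>measure_pmf Q)"
      unfolding p_def G_def using component_measurable_Xn[OF i] by (intro nn_integral_distr xm) measurable
    finally show ?thesis .
  qed
  finally have fin: "(\<integral>\<^sup>+k. ennreal (G (x k)) \<partial>measure_pmf Q) < \<infinity>" .
  have big: "ennreal (2 ^ k / S) \<le> (\<integral>\<^sup>+k. ennreal (G (x k)) \<partial>measure_pmf Q)" for k
  proof -
    have "ennreal (2 ^ k / S) = ennreal (G (x k)) * emeasure (measure_pmf Q) {k}"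
      using G0[of k] S w0[of k] by (simp add: emeasure_pmf_single pQ ennreal_mult[symmetric] w_def less_imp_le)
    also have "\<dots> = (\<integral>\<^sup>+j. ennreal (G (x k)) * indicator {k} j \<partial>measure_pmf Q)"
      by (simp add: nn_integral_cmult_indicator)
    also have "\<dots> \<le> (\<integral>\<^sup>+j. ennreal (G (x j)) \<partial>measure_pmf Q)"
      by (intro nn_integral_mono) (auto simp: indicator_def)
    finally show ?thesis .
  qed
  obtain b where b: "0 \<le> b" "(\<integral>\<^sup>+k. ennreal (G (x k)) \<partial>measure_pmf Q) = ennreal b"
    using fin by (cases "\<integral>\<^sup>+k. ennreal (G (x k)) \<partial>measure_pmf Q") auto
  obtain k :: nat where "b * S < 2 ^ k" using real_arch_pow[of 2 "b * S"] by auto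
  moreover have "2 ^ k / S \<le> b" using big[of k] b by simp
  ultimately show False using S by (simp add: field_simps)
qed

lemma Phi_gamma_sum:
  fixes \<phi> :: "'a \<Rightarrow> real"
  assumes \<phi>: "\<phi> \<in> Phi_gamma \<gamma> borel dist"
  shows "(\<lambda>x. \<Sum>i<n. \<phi> (x i)) \<in> Phi_gamma \<gamma> (Xn n) (l1_dist n)"
proof -
  interpret M: Metric_space "space (Xn n) :: (nat \<Rightarrow> 'a) set" "l1_dist n" by (rule Metric_space_l1)
  obtain x0 a b where ab: "a \<ge> 0" "b \<ge> 0" "\<And>x. \<bar>\<phi> x\<bar> \<le> a + b * \<gamma> (dist x x0)"
    using \<phi> by (auto simp: Phi_gamma_def)
  let ?o = "restr n (\<lambda>_. x0)"
  have "\<forall>i\<in>{..<n}. \<exists>D\<ge>0. \<forall>x\<in>space (Xn n). \<gamma> (dist (x i) x0) \<le> D * (1 + \<gamma> (l1_dist n x ?o))"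
    using gauge_component_bound by blast
  from bchoice[OF this] obtain D where D: "\<And>i. i < n \<Longrightarrow> 0 \<le> D i"
    "\<And>i x. i < n \<Longrightarrow> x \<in> space (Xn n) \<Longrightarrow> \<gamma> (dist (x i) x0) \<le> D i * (1 + \<gamma> (l1_dist n x ?o))" by blast
  have D0: "0 \<le> (\<Sum>i<n. D i)" using D(1) by (intro sum_nonneg) auto
  have bound: "\<bar>\<Sum>i<n. \<phi> (x i)\<bar> \<le> (real n * a + b * (\<Sum>i<n. D i)) + (b * (\<Sum>i<n. D i)) * \<gamma> (l1_dist n x ?o)"
    if x: "x \<in> space (Xn n)" for x
  proof -
    have "\<bar>\<Sum>i<n. \<phi> (x i)\<bar> \<le> (\<Sum>i<n. \<bar>\<phi> (x i)\<bar>)" by (rule sum_abs)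
    also have "\<dots> \<le> (\<Sum>i<n. a + b * (D i * (1 + \<gamma> (l1_dist n x ?o))))"
    proof (rule sum_mono)
      fix i assume "i \<in> {..<n}"
      then have "b * \<gamma> (dist (x i) x0) \<le> b * (D i * (1 + \<gamma> (l1_dist n x ?o)))"
        using D(2)[of i x] x ab(2) by (intro mult_left_mono) auto
      then show "\<bar>\<phi> (x i)\<bar> \<le> a + b * (D i * (1 + \<gamma> (l1_dist n x ?o)))" using ab(3)[of "x i"] by linarith
    qed
    also have "\<dots> = (real n * a + b * (\<Sum>i<n. D i)) + (b * (\<Sum>i<n. D i)) * \<gamma> (l1_dist n x ?o)"
      by (simp add: sum.distrib sum_distrib_left sum_distrib_right algebra_simps)
    finally show ?thesis .
  qed
  have proj: "continuous_map M.mtopology euclidean (\<lambda>x. x i)" if i: "i < n" for i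
    unfolding continuous_map_def
  proof (intro conjI allI impI)
    fix U :: "'a set" assume "openin euclidean U"
    then have U: "open U" by simp
    show "openin M.mtopology {x \<in> topspace M.mtopology. x i \<in> U}"
      unfolding M.openin_mtopology
    proof (intro conjI allI impI)
      fix f assume f: "f \<in> {x \<in> topspace M.mtopology. x i \<in> U}"
      then obtain e where e: "e > 0" "\<And>y. dist y (f i) < e \<Longrightarrow> y \<in> U"
        using U unfolding open_dist by blast
      have "M.mball f e \<subseteq> {x \<in> topspace M.mtopology. x i \<in> U}"
      proof
        fix g assume g: "g \<in> M.mball f e"
        have "dist (f i) (g i) \<le> l1_dist n f g"
          unfolding l1_dist_def using i by (intro member_le_sum) auto
        with g show "g \<in> {x \<in> topspace M.mtopology. x i \<in> U}"
          by (auto simp: dist_commute intro!: e(2))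
      qed
      then show "\<exists>r>0. M.mball f r \<subseteq> {x \<in> topspace M.mtopology. x i \<in> U}" using e by blast
    qed auto
  qed auto
  have c\<phi>: "continuous_map euclidean euclideanreal \<phi>"
    using Phi_continuous[OF \<phi>] by (simp add: continuous_map_iff_continuous2)
  have "continuous_map M.mtopology euclideanreal (\<lambda>x. \<Sum>i<n. \<phi> (x i))"
    using continuous_map_compose[OF proj c\<phi>] by (intro continuous_map_sum) (auto simp: comp_def)
  moreover have "0 \<le> real n * a + b * (\<Sum>i<n. D i)" "0 \<le> b * (\<Sum>i<n. D i)"
    using ab D0 by auto
  ultimately show ?thesis
    unfolding Phi_gamma_def using bound restr_space[of n "\<lambda>_. x0"] by blast
qed

text \<open>Both the integral of the sum and \<open>cost_n\<close> depend on \<open>p\<close>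
  through its marginals only, so the one-dimensional bounds add up. The function \<open>f\<close> is
  a minorant of the kind that occurs in \<open>lower_integral\<close>, which avoids the
  measurability of the infimum convolution.\<close>

lemma sum_le_inf_conv:
  assumes \<phi>: "\<phi> \<in> Phi_gamma \<gamma> borel dist" and f: "\<And>x. ereal (f x) \<le> inf_conv Pg c \<phi> x"
  shows "ereal (\<Sum>i<n. f (x i)) \<le> inf_conv (P_gamma \<gamma> (Xn n) (l1_dist n)) (cost_n c n) (\<lambda>x. \<Sum>i<n. \<phi> (x i)) x"
  unfolding inf_conv_def
proof (rule INF_greatest)
  fix p :: "(nat \<Rightarrow> 'a) measure" assume p: "p \<in> P_gamma \<gamma> (Xn n) (l1_dist n)"
  have sp: "sets p = sets (Xn n)" using p by (auto simp: P_gamma_def space_prob_algebra)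
  have cm: "(\<lambda>x. x i) \<in> p \<rightarrow>\<^sub>M borel" if "i < n" for i
    using component_measurable_Xn[OF that] by (simp add: measurable_cong_sets[OF sp refl])
  have \<phi>m: "\<phi> \<in> borel_measurable borel" by (rule borel_measurable_continuous_onI[OF Phi_continuous[OF \<phi>]])
  have int: "integrable p (\<lambda>x. \<phi> (x i))" "(\<integral>x. \<phi> (x i) \<partial>p) = (\<integral>x. \<phi> x \<partial>marginal i p)" if "i < n" for i
    using Phi_integrable[OF \<phi> marginals[OF that p]] cm[OF that] \<phi>m
    unfolding marginal_def by (auto simp: integrable_distr_eq integral_distr)
  have "f (x i) \<le> (\<integral>x. \<phi> x \<partial>marginal i p) + c (x i) (marginal i p)" if "i < n" for i
  proof -
    have "ereal (f (x i)) \<le> ereal ((\<integral>x. \<phi> x \<partial>marginal i p) + c (x i) (marginal i p))"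
      using f[of "x i"] unfolding inf_conv_def by (rule order_trans) (rule INF_lower[OF marginals[OF that p]])
    then show ?thesis by simp
  qed
  then have "(\<Sum>i<n. f (x i)) \<le> (\<Sum>i<n. (\<integral>x. \<phi> x \<partial>marginal i p) + c (x i) (marginal i p))"
    by (intro sum_mono) auto
  also have "\<dots> = (\<integral>x. (\<Sum>i<n. \<phi> (x i)) \<partial>p) + cost_n c n x p"
    using int by (simp add: sum.distrib cost_n_def Bochner_Integration.integral_sum)
  finally show "ereal (\<Sum>i<n. f (x i)) \<le> ereal ((\<integral>x. (\<Sum>i<n. \<phi> (x i)) \<partial>p) + cost_n c n x p)" by simp
qed

text \<open>For the sums over \<open>n\<close> coordinates both exponential moments are
  \<open>n\<close>-th powers. A dominant layer of each supplies the levels at which (iii) is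
  applied; the exponentials of these levels cancel, leaving an error logarithmic in
  \<open>n\<close>.\<close>

lemma dual_exponential_inequality:
  assumes \<mu>: "\<mu> \<in> Pg" and a: "0 < a1" "0 < a2"
    and K: "\<And>n \<phi> u v. 1 \<le> n \<Longrightarrow> \<phi> \<in> Phi_gamma \<gamma> (Xn n) (l1_dist n) \<Longrightarrow> (\<And>x. x \<in> space (Xn n) \<Longrightarrow> 0 \<le> \<phi> x) \<Longrightarrow>
          inner_prob (power_measure n \<mu>)
              {x \<in> space (Xn n). inf_conv (P_gamma \<gamma> (Xn n) (l1_dist n)) (cost_n c n) \<phi> x > ereal u} powr a2
            * measure (power_measure n \<mu>) {x \<in> space (Xn n). \<phi> x \<le> v} powr a1
          \<le> K * exp (- u + v)"
    and \<phi>: "\<phi> \<in> Phi_gamma \<gamma> borel dist" "\<And>x. 0 \<le> \<phi> x"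
    and f: "f \<in> borel_measurable borel" "\<And>x. \<bar>f x\<bar> \<le> b" "\<And>x. ereal (f x) \<le> inf_conv Pg c \<phi> x"
  shows "a2 * ln (\<integral>x. exp (f x / a2) \<partial>\<mu>) + a1 * ln (\<integral>x. exp (- \<phi> x / a1) \<partial>\<mu>) \<le> 0"
proof -
  interpret prob_space \<mu> using PgD[OF \<mu>] by simp
  have s\<mu>[measurable_cong]: "sets \<mu> = sets borel" and sp\<mu>: "space \<mu> = UNIV" using PgD[OF \<mu>] by auto
  interpret prod: product_sigma_finite "\<lambda>_ :: nat. \<mu>" ..
  have \<phi>m[measurable]: "\<phi> \<in> borel_measurable borel" by (rule borel_measurable_continuous_onI[OF Phi_continuous[OF \<phi>(1)]])
  note f(1)[measurable]
  define \<alpha> where "\<alpha> = (\<integral>x. exp (f x / a2) \<partial>\<mu>)"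
  define \<beta> where "\<beta> = (\<integral>x. exp (- \<phi> x / a1) \<partial>\<mu>)"
  have f2: "f x \<le> b" for x using f(2)[of x] by linarith
  have i\<alpha>: "integrable \<mu> (\<lambda>x. exp (f x / a2))"
    using f2 a by (intro integrable_const_bound[of _ "exp (b / a2)"]) (auto simp: divide_right_mono)
  have i\<beta>: "integrable \<mu> (\<lambda>x. exp (- \<phi> x / a1))"
    using \<phi>(2) a by (intro integrable_const_bound[of _ 1]) auto
  have \<alpha>: "0 < \<alpha>" and \<beta>: "0 < \<beta>" unfolding \<alpha>_def \<beta>_def by (rule integral_exp_pos[OF i\<alpha>], rule integral_exp_pos[OF i\<beta>])
  \<comment> \<open>The level below which a layer decomposition may discard half of the
    moment.\<close>
  have cutoff: "\<exists>N :: nat. 1 \<le> N \<and> exp (- real N / s) \<le> d / 2" if "0 < d" "0 < s" for s d :: real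
  proof -
    obtain N :: nat where N: "- (s * ln (d / 2)) < real N" using reals_Archimedean2 by blast
    have "- real (Suc N) / s \<le> s * ln (d / 2) / s"
      using N that by (intro divide_right_mono) auto
    then have "exp (- real (Suc N) / s) \<le> exp (ln (d / 2))"
      using that by (simp only: exp_le_cancel_iff) simp
    then have "exp (- real (Suc N) / s) \<le> d / 2" using that by (simp only: exp_ln half_gt_zero)
    then show ?thesis by (intro exI[of _ "Suc N"]) simp
  qed
  obtain N1 where N1: "1 \<le> N1" "exp (- real N1 / a2) \<le> \<alpha> / 2" using cutoff[OF \<alpha> a(2)] by blast
  obtain N2 where N2: "1 \<le> N2" "exp (- real N2 / a1) \<le> \<beta> / 2" using cutoff[OF \<beta> a(1)] by blast
  obtain m :: nat where m: "b \<le> real m" using real_arch_simple by blast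
  \<comment> \<open>Cutoffs scale with the number of coordinates: at \<open>n * N\<close> the
    discarded part is at most \<open>(d/2) ^ n\<close>, still at most half of
    \<open>d ^ n\<close>.\<close>
  have power_half: "exp (- real (n * N) / s) \<le> d ^ n / 2" if "exp (- real N / s) \<le> d / 2" "1 \<le> n" "0 < d" for n N :: nat and s d :: real
  proof -
    have "exp (- real (n * N) / s) = exp (- real N / s) ^ n"
      by (simp add: exp_of_nat_mult[symmetric])
    also have "\<dots> \<le> (d / 2) ^ n" using that by (intro power_mono) auto
    also have "\<dots> = d ^ n / 2 ^ n" by (rule power_divide)
    also have "\<dots> \<le> d ^ n / 2 ^ 1" using that by (intro divide_left_mono power_increasing) auto
    finally show ?thesis by simp
  qed
  \<comment> \<open>The summand 2 comes from the unit heights of the two layers. Their numbers,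
    \<open>n * (N1 + m)\<close> and \<open>n * N2\<close>, account for the remaining
    logarithms.\<close>
  have main: "real n * (a2 * ln \<alpha> + a1 * ln \<beta>) \<le>
      (ln (max K 1) + 2 + a2 * ln (2 * real (N1 + m)) + a1 * ln (2 * real N2)) + (a1 + a2) * ln (real n)"
    if n: "1 \<le> n" for n :: nat
  proof -
    let ?P = "power_measure n \<mu>"
    have P: "prob_space ?P" by (rule prob_space_power_measure) unfold_locales
    interpret P: prob_space ?P by fact
    have sP[measurable_cong]: "sets ?P = sets (Xn n)" by (rule sets_power_measure[OF s\<mu>])
    have spP: "space ?P = space (Xn n)" by (rule sets_eq_imp_space_eq[OF sP])
    define Z where "Z x = (\<Sum>i<n. f (x i))" for x
    define V where "V x = (\<Sum>i<n. - \<phi> (x i))" for x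
    have comp[measurable]: "(\<lambda>x. x i) \<in> Xn n \<rightarrow>\<^sub>M borel" if "i \<in> {..<n}" for i
      using component_measurable_Xn that by auto
    have Zm: "Z \<in> borel_measurable ?P" unfolding Z_def by measurable
    have Vm: "V \<in> borel_measurable ?P" unfolding V_def by measurable
    have EZ: "(\<integral>x. exp (Z x / a2) \<partial>?P) = \<alpha> ^ n"
    proof -
      have "(\<integral>x. exp (Z x / a2) \<partial>?P) = (\<integral>x. (\<Prod>i\<in>{..<n}. exp (f (x i) / a2)) \<partial>?P)"
        by (simp add: Z_def sum_divide_distrib exp_sum)
      also have "\<dots> = (\<Prod>i\<in>{..<n}. \<alpha>)"
        unfolding \<alpha>_def by (rule prod.product_integral_prod) (auto intro: i\<alpha>)
      finally show ?thesis by simp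
    qed
    have EV: "(\<integral>x. exp (V x / a1) \<partial>?P) = \<beta> ^ n"
    proof -
      have "(\<integral>x. exp (V x / a1) \<partial>?P) = (\<integral>x. (\<Prod>i\<in>{..<n}. exp (- \<phi> (x i) / a1)) \<partial>?P)"
        by (simp add: V_def sum_divide_distrib exp_sum)
      also have "\<dots> = (\<Prod>i\<in>{..<n}. \<beta>)"
        unfolding \<beta>_def by (rule prod.product_integral_prod) (auto intro: i\<beta>[simplified])
      finally show ?thesis by simp
    qed
    have Zub: "Z x \<le> real (n * m)" for x
    proof -
      have "Z x \<le> (\<Sum>i<n. real m)" unfolding Z_def using f2 m by (intro sum_mono) (meson order_trans)
      then show ?thesis by simp
    qed
    have Vub: "V x \<le> real 0" for x
      unfolding V_def using \<phi>(2) by (simp add: sum_nonpos)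
    have "\<exists>j :: int. \<alpha> ^ n / (2 * real (n * N1 + n * m)) \<le>
        exp ((real_of_int j + 1) / a2) * measure ?P {x \<in> space ?P. real_of_int j < Z x}"
      using P.exponential_layer[OF Zm Zub a(2), of "n * N1"] power_half[OF N1(2) n \<alpha>] n N1(1) by (simp add: EZ)
    then obtain i :: int where i: "\<alpha> ^ n / (2 * real (n * N1 + n * m)) \<le>
        exp ((real_of_int i + 1) / a2) * measure ?P {x \<in> space ?P. real_of_int i < Z x}" by blast
    have "\<exists>j :: int. \<beta> ^ n / (2 * real (n * N2 + 0)) \<le>
        exp ((real_of_int j + 1) / a1) * measure ?P {x \<in> space ?P. real_of_int j < V x}"
      using P.exponential_layer[OF Vm Vub a(1), of "n * N2"] power_half[OF N2(2) n \<beta>] n N2(1) by (simp add: EV)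
    then obtain j :: int where j: "\<beta> ^ n / (2 * real (n * N2 + 0)) \<le>
        exp ((real_of_int j + 1) / a1) * measure ?P {x \<in> space ?P. real_of_int j < V x}" by blast
    let ?\<phi> = "\<lambda>x. \<Sum>i<n. \<phi> (x i)"
    let ?R = "inf_conv (P_gamma \<gamma> (Xn n) (l1_dist n)) (cost_n c n) ?\<phi>"
    define p1 where "p1 = measure ?P {x \<in> space ?P. real_of_int i < Z x}"
    define p2 where "p2 = measure ?P {x \<in> space ?P. real_of_int j < V x}"
    have p1le: "p1 \<le> inner_prob ?P {x \<in> space (Xn n). ?R x > ereal (real_of_int i)}"
      unfolding p1_def
    proof (rule measure_le_inner_prob[OF P])
      show "{x \<in> space ?P. real_of_int i < Z x} \<in> sets ?P" using Zm by measurable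
      show "{x \<in> space ?P. real_of_int i < Z x} \<subseteq> {x \<in> space (Xn n). ?R x > ereal (real_of_int i)}"
      proof (clarsimp simp: spP)
        fix x assume "real_of_int i < Z x"
        then have "ereal (real_of_int i) < ereal (Z x)" by simp
        also have "\<dots> \<le> ?R x" unfolding Z_def by (rule sum_le_inf_conv[OF \<phi>(1) f(3)])
        finally show "ereal (real_of_int i) < ?R x" .
      qed
    qed
    have p2le: "p2 \<le> measure ?P {x \<in> space (Xn n). ?\<phi> x \<le> - real_of_int j}"
      unfolding p2_def
    proof (rule P.finite_measure_mono)
      show "{x \<in> space ?P. real_of_int j < V x} \<subseteq> {x \<in> space (Xn n). ?\<phi> x \<le> - real_of_int j}"
        by (auto simp: spP V_def sum_negf)
      have "?\<phi> \<in> borel_measurable ?P" by measurable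
      then show "{x \<in> space (Xn n). ?\<phi> x \<le> - real_of_int j} \<in> sets ?P"
        unfolding spP[symmetric] by measurable
    qed
    have "p1 powr a2 * p2 powr a1 \<le>
        inner_prob ?P {x \<in> space (Xn n). ?R x > ereal (real_of_int i)} powr a2
        * measure ?P {x \<in> space (Xn n). ?\<phi> x \<le> - real_of_int j} powr a1"
      using a p1le p2le by (intro mult_mono powr_mono2) (auto simp: p1_def p2_def)
    \<comment> \<open>The levels are \<open>u = i\<close>, from the layer of \<open>Z\<close>, and
      \<open>v = - j\<close>, from that of \<open>V\<close>, the negated sum of \<phi>.\<close>
    also have "\<dots> \<le> K * exp (- real_of_int i + - real_of_int j)"
      using \<phi>(2) by (intro K[OF n Phi_gamma_sum[OF \<phi>(1)]]) (auto intro: sum_nonneg)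
    \<comment> \<open>A positive constant, for the logarithm taken below.\<close>
    also have "\<dots> \<le> max K 1 * exp (- real_of_int i + - real_of_int j)" by (simp add: mult_right_mono)
    finally have prod: "p1 powr a2 * p2 powr a1 \<le> max K 1 * exp (- real_of_int i + - real_of_int j)" .
    have d1: "0 < \<alpha> ^ n / (2 * real (n * N1 + n * m))" using \<alpha> n N1(1) by (intro divide_pos_pos zero_less_power mult_pos_pos) (auto simp: of_nat_0_less_iff simp del: of_nat_add of_nat_mult)
    have d2: "0 < \<beta> ^ n / (2 * real (n * N2 + 0))" using \<beta> n N2(1) by (intro divide_pos_pos zero_less_power mult_pos_pos) (auto simp: of_nat_0_less_iff simp del: of_nat_add of_nat_mult)
    have p1: "0 < p1" using less_le_trans[OF d1 i] by (simp add: p1_def zero_less_mult_iff)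
    have p2: "0 < p2" using less_le_trans[OF d2 j] by (simp add: p2_def zero_less_mult_iff)
    have "ln (p1 powr a2 * p2 powr a1) \<le> ln (max K 1 * exp (- real_of_int i + - real_of_int j))"
      using prod p1 p2 by (intro ln_mono) auto
    then have L: "a2 * ln p1 + a1 * ln p2 \<le> ln (max K 1) - real_of_int i - real_of_int j"
    proof -
      have "0 < max K 1" by simp
      then have "ln (max K 1 * exp (- real_of_int i + - real_of_int j)) = ln (max K 1) + (- real_of_int i + - real_of_int j)"
        by (subst ln_mult_pos) auto
      moreover have "ln (p1 powr a2 * p2 powr a1) = a2 * ln p1 + a1 * ln p2"
        using p1 p2 by (subst ln_mult_pos) (auto simp: ln_powr)
      ultimately show ?thesis
        using \<open>ln (p1 powr a2 * p2 powr a1) \<le> ln (max K 1 * exp (- real_of_int i + - real_of_int j))\<close> by linarith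
    qed
    have "ln (\<alpha> ^ n / (2 * real (n * N1 + n * m))) \<le> ln (exp ((real_of_int i + 1) / a2) * p1)"
      using i d1 by (intro ln_mono) (auto simp: p1_def)
    moreover have "2 * real (n * N1 + n * m) = real n * (2 * real (N1 + m))" by (simp add: algebra_simps)
    moreover have "ln (\<alpha> ^ n / (real n * (2 * real (N1 + m)))) = real n * ln \<alpha> - (ln (real n) + ln (2 * real (N1 + m)))"
      using \<alpha> n N1(1) by (simp add: ln_div ln_mult_pos ln_realpow del: of_nat_add)
    moreover have "ln (exp ((real_of_int i + 1) / a2) * p1) = (real_of_int i + 1) / a2 + ln p1"
      using p1 by (simp add: ln_mult_pos)
    ultimately have "real n * ln \<alpha> - (ln (real n) + ln (2 * real (N1 + m))) \<le> (real_of_int i + 1) / a2 + ln p1"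
      by (simp only:)
    from mult_left_mono[OF this less_imp_le[OF a(2)]]
    have L1: "a2 * (real n * ln \<alpha>) - a2 * ln (real n) - a2 * ln (2 * real (N1 + m)) \<le> real_of_int i + 1 + a2 * ln p1"
      using a(2) by (simp add: right_diff_distrib distrib_left add_divide_distrib del: of_nat_add)
    have "ln (\<beta> ^ n / (2 * real (n * N2 + 0))) \<le> ln (exp ((real_of_int j + 1) / a1) * p2)"
      using j d2 by (intro ln_mono) (auto simp: p2_def)
    moreover have "2 * real (n * N2 + 0) = real n * (2 * real N2)" by (simp add: algebra_simps)
    moreover have "ln (\<beta> ^ n / (real n * (2 * real N2))) = real n * ln \<beta> - (ln (real n) + ln (2 * real N2))"
      using \<beta> n N2(1) by (simp add: ln_div ln_mult_pos ln_realpow del: of_nat_add)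
    moreover have "ln (exp ((real_of_int j + 1) / a1) * p2) = (real_of_int j + 1) / a1 + ln p2"
      using p2 by (simp add: ln_mult_pos)
    ultimately have "real n * ln \<beta> - (ln (real n) + ln (2 * real N2)) \<le> (real_of_int j + 1) / a1 + ln p2"
      by (simp only:)
    from mult_left_mono[OF this less_imp_le[OF a(1)]]
    have L2: "a1 * (real n * ln \<beta>) - a1 * ln (real n) - a1 * ln (2 * real N2) \<le> real_of_int j + 1 + a1 * ln p2"
      using a(1) by (simp add: right_diff_distrib distrib_left add_divide_distrib)
    show ?thesis using L L1 L2 by (simp add: algebra_simps)
  qed
  show ?thesis using nonpos_of_linear_le_ln[OF main] by (simp add: \<alpha>_def \<beta>_def)
qed

text \<open>For each test function in the duality formula, the Gibbs inequality is used twice: for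
  \<open>g / a2\<close> under \<open>\<nu>2\<close> and for \<open>- \<psi> / a1\<close> under
  \<open>\<nu>1\<close>. Weighted by \<open>a2\<close> and \<open>a1\<close>, the logarithmic terms
  add up to at most 0, and only the entropies remain.\<close>

lemma T_inequality_of_functional_bound:
  assumes \<mu>: "\<mu> \<in> Pg" and a: "0 < a1" "0 < a2"
    and K: "\<And>n \<phi> u v. 1 \<le> n \<Longrightarrow> \<phi> \<in> Phi_gamma \<gamma> (Xn n) (l1_dist n) \<Longrightarrow> (\<And>x. x \<in> space (Xn n) \<Longrightarrow> 0 \<le> \<phi> x) \<Longrightarrow>
          inner_prob (power_measure n \<mu>)
              {x \<in> space (Xn n). inf_conv (P_gamma \<gamma> (Xn n) (l1_dist n)) (cost_n c n) \<phi> x > ereal u} powr a2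
            * measure (power_measure n \<mu>) {x \<in> space (Xn n). \<phi> x \<le> v} powr a1
          \<le> K * exp (- u + v)"
  shows "T_inequality \<gamma> c a1 a2 \<mu>"
  unfolding T_inequality_def
proof (intro ballI)
  fix \<nu>1 \<nu>2 assume n1: "\<nu>1 \<in> Pg" and n2: "\<nu>2 \<in> Pg"
  interpret \<mu>: prob_space \<mu> using PgD[OF \<mu>] by simp
  interpret N1: prob_space \<nu>1 using PgD[OF n1] by simp
  interpret N2: prob_space \<nu>2 using PgD[OF n2] by simp
  have s\<mu>[measurable_cong]: "sets \<mu> = sets borel" "sets \<nu>1 = sets borel" "sets \<nu>2 = sets borel" using PgD \<mu> n1 n2 by auto
  show "transport_cost \<gamma> c \<nu>1 \<nu>2 \<le> ereal a1 * rel_entropy \<nu>1 \<mu> + ereal a2 * rel_entropy \<nu>2 \<mu>"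
  proof (cases "rel_entropy \<nu>1 \<mu> = \<infinity> \<or> rel_entropy \<nu>2 \<mu> = \<infinity>")
    case True
    have "rel_entropy \<nu> \<mu> \<noteq> -\<infinity>" for \<nu> by (simp add: rel_entropy_def)
    then have inf: "ereal a1 * rel_entropy \<nu>1 \<mu> + ereal a2 * rel_entropy \<nu>2 \<mu> = \<infinity>"
      using True a by (cases "rel_entropy \<nu>1 \<mu>"; cases "rel_entropy \<nu>2 \<mu>") auto
    show ?thesis unfolding inf by simp
  next
    case False
    define h1 where "h1 = KL_divergence (exp 1) \<mu> \<nu>1"
    define h2 where "h2 = KL_divergence (exp 1) \<mu> \<nu>2"
    have ac: "absolutely_continuous \<mu> \<nu>1" "absolutely_continuous \<mu> \<nu>2"
      and ent: "integrable \<nu>1 (entropy_density (exp 1) \<mu> \<nu>1)" "integrable \<nu>2 (entropy_density (exp 1) \<mu> \<nu>2)"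
      and h: "rel_entropy \<nu>1 \<mu> = ereal h1" "rel_entropy \<nu>2 \<mu> = ereal h2"
      using False by (auto simp: rel_entropy_def h1_def h2_def split: if_splits)
    have "transport_cost \<gamma> c \<nu>1 \<nu>2 =
      (SUP \<phi>\<in>Phi_gamma_b \<gamma> borel dist. lower_integral \<nu>2 (inf_conv Pg c \<phi>) - ereal (\<integral>x. \<phi> x \<partial>\<nu>1))"
      using duality n1 n2 unfolding duality_holds_def by blast
    also have "\<dots> \<le> ereal (a1 * h1 + a2 * h2)"
    proof (rule SUP_least)
      fix \<phi> :: "'a \<Rightarrow> real" assume \<phi>b: "\<phi> \<in> Phi_gamma_b \<gamma> borel dist"
      then have \<phi>: "\<phi> \<in> Phi_gamma \<gamma> borel dist" and "bdd_below (range \<phi>)" by (auto simp: Phi_gamma_b_def)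
      then obtain m0 where "\<And>x. m0 \<le> \<phi> x" by (auto simp: bdd_below_def)
      then have m: "- \<bar>m0\<bar> \<le> \<phi> x" for x by (rule order_trans[rotated]) simp
      \<comment> \<open>(iii) concerns nonnegative functions, so \<phi> is raised by a constant. The
        minorant \<open>f\<close> is raised by the same constant, which cancels at the end.\<close>
      define m where "m = \<bar>m0\<bar>"
      define \<psi> where "\<psi> x = \<phi> x + m" for x
      have \<psi>0: "0 \<le> \<psi> x" for x using m[of x] by (simp add: \<psi>_def m_def)
      have \<psi>: "\<psi> \<in> Phi_gamma \<gamma> borel dist"
      proof -
        obtain x0 a b where ab: "a \<ge> 0" "b \<ge> 0" "\<And>x. \<bar>\<phi> x\<bar> \<le> a + b * \<gamma> (dist x x0)"
          using \<phi> by (auto simp: Phi_gamma_def)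
        have "\<bar>\<psi> x\<bar> \<le> (a + m) + b * \<gamma> (dist x x0)" for x
          using ab(3)[of x] by (auto simp: \<psi>_def m_def)
        moreover have "continuous_map (Metric_space.mtopology (space borel) dist) euclideanreal \<psi>"
          unfolding \<psi>_def using \<phi> by (intro continuous_map_add) (auto simp: Phi_gamma_def)
        moreover have "0 \<le> a + m" using ab by (simp add: m_def)
        ultimately show ?thesis unfolding Phi_gamma_def using ab(2) by auto
      qed
      have "lower_integral \<nu>2 (inf_conv Pg c \<phi>) \<le> ereal (a1 * h1 + a2 * h2 + (\<integral>x. \<phi> x \<partial>\<nu>1))"
        unfolding lower_integral_def
      proof (rule SUP_least, clarsimp)
        fix f :: "'a \<Rightarrow> real" assume fm: "f \<in> borel_measurable \<nu>2" and fb: "bounded (f ` space \<nu>2)"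
          and fle: "\<forall>x\<in>space \<nu>2. ereal (f x) \<le> inf_conv Pg c \<phi> x"
        have sp: "space \<nu>2 = UNIV" using PgD[OF n2] by simp
        have fm'[measurable]: "f \<in> borel_measurable borel" using fm by (simp add: measurable_cong_sets[OF s\<mu>(3) refl])
        obtain b where b: "\<And>x. \<bar>f x\<bar> \<le> b" using fb sp by (auto simp: bounded_iff)
        define g where "g x = f x + m" for x
        have gm[measurable]: "g \<in> borel_measurable borel" unfolding g_def by measurable
        have gb: "\<bar>g x\<bar> \<le> b + m" for x using b[of x] by (auto simp: g_def m_def)
        have gle: "ereal (g x) \<le> inf_conv Pg c \<psi> x" for x
          unfolding inf_conv_def
        proof (rule INF_greatest)
          fix p assume p: "p \<in> Pg"
          interpret p: prob_space p using PgD[OF p] by simp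
          have "ereal (f x) \<le> inf_conv Pg c \<phi> x" using fle sp by simp
          also have "\<dots> \<le> ereal ((\<integral>y. \<phi> y \<partial>p) + c x p)" unfolding inf_conv_def by (rule INF_lower[OF p])
          finally show "ereal (g x) \<le> ereal ((\<integral>y. \<psi> y \<partial>p) + c x p)"
            using Phi_integrable[OF \<phi> p] by (simp add: g_def \<psi>_def p.prob_space)
        qed
        have dual: "a2 * ln (\<integral>x. exp (g x / a2) \<partial>\<mu>) + a1 * ln (\<integral>x. exp (- \<psi> x / a1) \<partial>\<mu>) \<le> 0"
          by (rule dual_exponential_inequality[OF \<mu> a K \<psi> \<psi>0 gm gb gle])
        have \<psi>m[measurable]: "\<psi> \<in> borel_measurable borel" by (rule borel_measurable_continuous_onI[OF Phi_continuous[OF \<psi>]])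
        have g1: "(\<integral>x. g x / a2 \<partial>\<nu>2) \<le> h2 + ln (\<integral>x. exp (g x / a2) \<partial>\<mu>)"
          unfolding h2_def
        proof (rule gibbs_variational[OF \<mu>.prob_space_axioms N2.prob_space_axioms _ ac(2) ent(2)])
          show "sets \<nu>2 = sets \<mu>" using s\<mu> by simp
          show "integrable \<nu>2 (\<lambda>x. g x / a2)"
            using gb by (intro Bochner_Integration.integrable_divide N2.integrable_const_bound[of _ "b + m"]) auto
          have "g x \<le> b + m" for x using gb[of x] by linarith
          then show "integrable \<mu> (\<lambda>x. exp (g x / a2))"
            using a by (intro \<mu>.integrable_const_bound[of _ "exp ((b + m) / a2)"]) (auto simp: divide_right_mono)
        qed simp
        have g2: "(\<integral>x. - \<psi> x / a1 \<partial>\<nu>1) \<le> h1 + ln (\<integral>x. exp (- \<psi> x / a1) \<partial>\<mu>)"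
          unfolding h1_def
        proof (rule gibbs_variational[OF \<mu>.prob_space_axioms N1.prob_space_axioms _ ac(1) ent(1)])
          show "sets \<nu>1 = sets \<mu>" using s\<mu> by simp
          show "integrable \<nu>1 (\<lambda>x. - \<psi> x / a1)" using Phi_integrable[OF \<psi> n1] by simp
          show "integrable \<mu> (\<lambda>x. exp (- \<psi> x / a1))"
            using \<psi>0 a by (intro \<mu>.integrable_const_bound[of _ 1]) auto
        qed simp
        have ig: "integrable \<nu>2 f" using b by (intro N2.integrable_const_bound[of _ b]) auto
        have "a2 * (\<integral>x. g x / a2 \<partial>\<nu>2) = (\<integral>x. f x \<partial>\<nu>2) + m"
          using a ig by (simp add: g_def N2.prob_space)
        moreover have "a1 * (\<integral>x. - \<psi> x / a1 \<partial>\<nu>1) = - ((\<integral>x. \<phi> x \<partial>\<nu>1) + m)"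
          using a Phi_integrable[OF \<phi> n1] by (simp add: \<psi>_def N1.prob_space)
        moreover have "a2 * (\<integral>x. g x / a2 \<partial>\<nu>2) \<le> a2 * h2 + a2 * ln (\<integral>x. exp (g x / a2) \<partial>\<mu>)"
          using mult_left_mono[OF g1, of a2] a by (simp add: distrib_left)
        moreover have "a1 * (\<integral>x. - \<psi> x / a1 \<partial>\<nu>1) \<le> a1 * h1 + a1 * ln (\<integral>x. exp (- \<psi> x / a1) \<partial>\<mu>)"
          using mult_left_mono[OF g2, of a1] a by (simp add: distrib_left)
        ultimately show "(\<integral>x. f x \<partial>\<nu>2) \<le> a1 * h1 + a2 * h2 + (\<integral>x. \<phi> x \<partial>\<nu>1)"
          using dual by linarith
      qed
      then show "lower_integral \<nu>2 (inf_conv Pg c \<phi>) - ereal (\<integral>x. \<phi> x \<partial>\<nu>1) \<le> ereal (a1 * h1 + a2 * h2)"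
        by (simp add: ereal_minus_le)
    qed
    finally show ?thesis by (simp add: h)
  qed
qed

end

theorem theorem5p1:
  fixes \<gamma> :: "real \<Rightarrow> real" and C :: real
    and c :: "'a::polish_space \<Rightarrow> 'a measure \<Rightarrow> real"
    and \<mu> :: "'a measure" and a1 a2 :: real
  assumes gamma_nonneg: "\<And>u. 0 \<le> u \<Longrightarrow> 0 \<le> \<gamma> u"
    and gamma_lsc: "lower_semicontinuous_on {0..} \<gamma>"
    and gamma_zero: "\<gamma> 0 = 0"
    and gamma_add: "\<And>u v. 0 \<le> u \<Longrightarrow> 0 \<le> v \<Longrightarrow> \<gamma> (u + v) \<le> C * (\<gamma> u + \<gamma> v)"
    and base_point: "\<And>(p :: 'a measure) x0 x1. p \<in> space (prob_algebra borel) \<Longrightarrow>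
          (\<integral>\<^sup>+ x. ennreal (\<gamma> (dist x x0)) \<partial>p) < \<infinity> \<Longrightarrow> (\<integral>\<^sup>+ x. ennreal (\<gamma> (dist x x1)) \<partial>p) < \<infinity>"
    and marginals: "\<And>n i (p :: (nat \<Rightarrow> 'a) measure). i < n \<Longrightarrow>
          p \<in> P_gamma \<gamma> (Xn n) (l1_dist n) \<Longrightarrow> marginal i p \<in> P_gamma \<gamma> borel dist"
    and c_nonneg: "\<And>x p. p \<in> P_gamma \<gamma> borel dist \<Longrightarrow> 0 \<le> c x p"
    and c_measurable: "(\<lambda>(x, p). c x p) \<in>
          borel_measurable (borel \<Otimes>\<^sub>M P_gamma_algebra \<gamma> borel dist)"
    and c_dirac: "\<And>x. c x (return borel x) = 0"
    and duality: "duality_holds \<gamma> c"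
    and mu: "\<mu> \<in> P_gamma \<gamma> borel dist"
    and a_pos: "0 < a1" "0 < a2"
  shows "(T_inequality \<gamma> c a1 a2 \<mu>
      \<longleftrightarrow>
      (\<exists>K. \<forall>n\<ge>1. \<forall>A\<in>sets (Xn n). \<forall>t\<ge>0.
        inner_prob (power_measure n \<mu>) (space (Xn n) - enlargement \<gamma> c n A t) powr a2
          * measure (power_measure n \<mu>) A powr a1 \<le> K * exp (- t)))
    \<and>
    (T_inequality \<gamma> c a1 a2 \<mu>
      \<longleftrightarrow>
      (\<exists>K. \<forall>n\<ge>1. \<forall>\<phi>\<in>Phi_gamma \<gamma> (Xn n) (l1_dist n). (\<forall>x\<in>space (Xn n). 0 \<le> \<phi> x) \<longrightarrow>
        (\<forall>u v.
          inner_prob (power_measure n \<mu>)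
              {x \<in> space (Xn n). inf_conv (P_gamma \<gamma> (Xn n) (l1_dist n)) (cost_n c n) \<phi> x > ereal u} powr a2
            * measure (power_measure n \<mu>) {x \<in> space (Xn n). \<phi> x \<le> v} powr a1
          \<le> K * exp (- u + v))))"
proof -
  interpret transport_setting \<gamma> c
    by unfold_locales (fact assms)+
  have mu': "prob_space \<mu>" using PgD[OF mu] by simp
  let ?T = "T_inequality \<gamma> c a1 a2 \<mu>"
  let ?II = "\<exists>K. \<forall>n\<ge>1. \<forall>A\<in>sets (Xn n). \<forall>t\<ge>0.
        inner_prob (power_measure n \<mu>) (space (Xn n) - enlargement \<gamma> c n A t) powr a2
          * measure (power_measure n \<mu>) A powr a1 \<le> K * exp (- t)"
  let ?III = "\<exists>K. \<forall>n\<ge>1. \<forall>\<phi>\<in>Phi_gamma \<gamma> (Xn n) (l1_dist n). (\<forall>x\<in>space (Xn n). 0 \<le> \<phi> x) \<longrightarrow>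
        (\<forall>u v.
          inner_prob (power_measure n \<mu>)
              {x \<in> space (Xn n). inf_conv (P_gamma \<gamma> (Xn n) (l1_dist n)) (cost_n c n) \<phi> x > ereal u} powr a2
            * measure (power_measure n \<mu>) {x \<in> space (Xn n). \<phi> x \<le> v} powr a1
          \<le> K * exp (- u + v))"
  \<comment> \<open>Together with the other two implications this shows that a bound with any
    constant improves to one with constant 1.\<close>
  have 1: ?II if T: ?T
    using enlargement_bound[OF T mu a_pos] by (intro exI[of _ 1]) simp
  have 2: ?III if II: ?II
  proof -
    obtain K where K: "\<And>n A t. 1 \<le> n \<Longrightarrow> A \<in> sets (Xn n) \<Longrightarrow> 0 \<le> t \<Longrightarrow>
        inner_prob (power_measure n \<mu>) (space (Xn n) - enlargement \<gamma> c n A t) powr a2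
          * measure (power_measure n \<mu>) A powr a1 \<le> K * exp (- t)"
      using II by blast
    show ?thesis
      using functional_bound_of_set_bound[OF mu' less_imp_le[OF a_pos(1)] less_imp_le[OF a_pos(2)] K]
      by (intro exI[of _ "max K 1"] allI impI ballI) blast
  qed
  have 3: ?T if III: ?III
  proof -
    obtain K where K: "\<And>n \<phi> u v. 1 \<le> n \<Longrightarrow> \<phi> \<in> Phi_gamma \<gamma> (Xn n) (l1_dist n) \<Longrightarrow> (\<And>x. x \<in> space (Xn n) \<Longrightarrow> 0 \<le> \<phi> x) \<Longrightarrow>
          inner_prob (power_measure n \<mu>)
              {x \<in> space (Xn n). inf_conv (P_gamma \<gamma> (Xn n) (l1_dist n)) (cost_n c n) \<phi> x > ereal u} powr a2
            * measure (power_measure n \<mu>) {x \<in> space (Xn n). \<phi> x \<le> v} powr a1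
          \<le> K * exp (- u + v)"
      using III by blast
    show ?thesis by (rule T_inequality_of_functional_bound[OF mu a_pos K])
  qed
  show ?thesis using 1 2 3 by argo
qed

end
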